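(* For a stationary process $W$ and $\Delta>0$ let $$A^{\Delta}(W)=\Delta^{-1}\left(\mathbf{Var}\left(\int_{0}^{\Delta}W(t)dt\right)-\mathbf{Cov}\left(\int_{0}^{\Delta}W(t)dt,\int_{\Delta}^{2\Delta}W(t)dt\right)\right)^{1/2}.$$ Let $\widetilde{W}_{1}^{d}$ be the stationary discrete (spikes) traffic process and $\widehat{W}_{1}^{d}$ the stationary continuous ON/OFF traffic process described in the context. Then: (a) $A^{\Delta}\left(\widetilde{W}_{1}^{d}\right)\approx\Delta^{-1/2}\to0$ as $\Delta\to\infty$. (b) $A^{\Delta}\left(\widehat{W}_{1}^{d}\right)\to0$ as $\Delta\to0$ or $\Delta\to\infty$, and there exists a constant $K>0$ such that $$A^{\Delta}\left(\widehat{W}_{1}^{d}\right)\geq K\quad\text{for }\Delta=\mathbf{E}(O_{n}^{a}+O_{f}^{a})/2,$$ where $O_n^a$ and $O_f^a$ are the generic ON- and OFF-durations of $\widehat{W}_1^d$.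
   Context: The symbol $\approx$ means "is of the order of" (up to positive multiplicative constants). Continuous traffic $\widehat{W}_1^d$ (ON/OFF process). Let $\{O_{n}^{a}(i)\}_{i\ge1}$ (ON-durations; the subscript $n$ stands for "on") and $\{O_{f}^{a}(i)\}_{i\ge1}$ (OFF-durations) be two i.i.d. sequences of positive random variables, independent of each other, with $t^{p}\,\mathbf{P}(O_{n}^{a}(1)>t)\to C$ as $t\to\infty$ for some $p\in(1,2)$, $0<C<\infty$, and $\mathbf{E}\,O_{f}^{a}(1)^2<\infty$. Put $\widetilde{W}^{a}(t)=1$ if $\sum_{i=1}^{k-1}(O_{f}^{a}(i)+O_{n}^{a}(i))+O_{f}^{a}(k)\leq t\leq\sum_{i=1}^{k}(O_{f}^{a}(i)+O_{n}^{a}(i))$ for some $k\ge1$, and $\widetilde W^a(t)=0$ otherwise. $\widehat{W}_1^d$ is the "stationary" version $\widetilde W^a(u+t)$ of $\widetilde W^a$, with $u$ uniformly distributed on $[0,O_f^a(1)+O_n^a(1)]$. Discrete traffic $\widetilde{W}_1^d$. This is the packet-emission process with no OFF-periods ($O_f=0$ a.s.) and a single infinite ON-period ($O_n=\infty$ a.s.): let $R_j$, $j\ge1$, be i.i.d. random variables (gaps between consecutive packets) with $R_j\ge0$ a.s., $\mathbf{E}R_j^2<\infty$ and $\lim_{\delta\to0}\delta^{-1}\mathbf{P}(R_j<\delta)<\infty$. $\widetilde W_1^d$ is the stationary version of the process that has a unit Dirac delta at each time $\sum_{j=1}^{l}R_j$, $l\ge0$, and is $0$ otherwise; thus $\int_s^t\widetilde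 W_1^d(x)dx$ counts the packet emissions in the interval from $s$ to $t$.
   Formalization: In (a) the gaps R_j are assumed not a.s. constant (for R_j = 1 one has A^Δ = 0 at every integer Δ, so (a) fails); the stationary versions are taken with a length-biased first cycle and u uniform on that cycle, since otherwise the shifted process is not stationary. *)

theory Defs
  imports "HOL-Probability.Probability" "HOL-Library.Landau_Symbols"
begin

text \<open>
  A traffic process on \<open>P\<close> enters only through its integrals: \<open>I s t \<omega>\<close> is the traffic
  \<open>\<integral>\<^sub>s\<^sup>t W(x) dx\<close> in the window from \<open>s\<close> to \<open>t\<close>.  This treats functions and sums of Dirac deltas
  uniformly.
\<close>

definition covariance :: "'a measure \<Rightarrow> ('a \<Rightarrow> real) \<Rightarrow> ('a \<Rightarrow> real) \<Rightarrow> real" where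
  "covariance P X Y =
     prob_space.expectation P (\<lambda>\<omega>. (X \<omega> - prob_space.expectation P X) *
                                    (Y \<omega> - prob_space.expectation P Y))"

definition A_dev :: "'a measure \<Rightarrow> (real \<Rightarrow> real \<Rightarrow> 'a \<Rightarrow> real) \<Rightarrow> real \<Rightarrow> real" where
  "A_dev P I \<Delta> =
     sqrt (prob_space.variance P (I 0 \<Delta>) - covariance P (I 0 \<Delta>) (I \<Delta> (2 * \<Delta>))) / \<Delta>"

text \<open>
  \<open>X\<close> is the length of the first cycle of a regenerative process on \<open>M\<close> with i.i.d. cycles.  Under
  the law below, on pairs \<open>(\<omega>, u)\<close>, the shift \<open>u\<close> is, given the cycles, uniform on
  \<open>[0, X \<omega>]\<close>, and the process shifted by \<open>u\<close> is stationary.  The first coordinate has density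
  \<open>X / E X\<close> with respect to \<open>M\<close>: the cycle straddling the time origin is length-biased (Palm
  inversion).  With the unbiased law of \<open>\<omega>\<close> the shifted process would not be stationary.
\<close>

definition stationary_law :: "'a measure \<Rightarrow> ('a \<Rightarrow> real) \<Rightarrow> ('a \<times> real) measure" where
  "stationary_law M X =
     uniform_measure (M \<Otimes>\<^sub>M lborel) {(\<omega>, u). \<omega> \<in> space M \<and> 0 \<le> u \<and> u \<le> X \<omega>}"


text \<open>Sequences are indexed from 0: \<open>R 0\<close>, \<open>Off 0\<close>, \<open>On 0\<close> are the first gap and durations.\<close>

locale packet_gaps = prob_space M for M :: "'a measure" +
  fixes R :: "nat \<Rightarrow> 'a \<Rightarrow> real"
  assumes indep: "indep_vars (\<lambda>_. borel) R UNIV"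
    and ident: "\<And>j. distr M borel (R j) = distr M borel (R 0)"
    and nonneg: "AE \<omega> in M. 0 \<le> R 0 \<omega>"
    and square_integrable: "integrable M (\<lambda>\<omega>. (R 0 \<omega>)\<^sup>2)"
    and small_gaps: "\<exists>L. ((\<lambda>\<delta>. prob {\<omega> \<in> space M. R 0 \<omega> < \<delta>} / \<delta>) \<longlongrightarrow> L) (at_right 0)"

text \<open>
  The half-open window makes adjacent windows disjoint; the endpoints carry a packet with
  probability 0.
\<close>

definition packet_count ::
  "(nat \<Rightarrow> 'a \<Rightarrow> real) \<Rightarrow> real \<Rightarrow> real \<Rightarrow> 'a \<Rightarrow> real" where
  "packet_count R s t \<omega> = real (card {l. s < (\<Sum>j<l. R j \<omega>) \<and> (\<Sum>j<l. R j \<omega>) \<le> t})"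

definition A_discrete :: "'a measure \<Rightarrow> (nat \<Rightarrow> 'a \<Rightarrow> real) \<Rightarrow> real \<Rightarrow> real" where
  "A_discrete M R =
     A_dev (stationary_law M (R 0)) (\<lambda>s t (\<omega>, u). packet_count R (u + s) (u + t) \<omega>)"


locale on_off_durations = prob_space M for M :: "'a measure" +
  fixes Off On :: "nat \<Rightarrow> 'a \<Rightarrow> real" and p C :: real
  assumes indep_On: "indep_vars (\<lambda>_. borel) On UNIV"
    and indep_Off: "indep_vars (\<lambda>_. borel) Off UNIV"
    and indep_On_Off: "indep_var (\<Pi>\<^sub>M i\<in>UNIV. borel) (\<lambda>\<omega> i. On i \<omega>)
                                 (\<Pi>\<^sub>M i\<in>UNIV. borel) (\<lambda>\<omega> i. Off i \<omega>)"
    and ident_On: "\<And>i. distr M borel (On i) = distr M borel (On 0)"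
    and ident_Off: "\<And>i. distr M borel (Off i) = distr M borel (Off 0)"
    and pos_On: "AE \<omega> in M. 0 < On 0 \<omega>"
    and pos_Off: "AE \<omega> in M. 0 < Off 0 \<omega>"
    and p: "1 < p" "p < 2"
    and C: "0 < C"
    and tail_On: "((\<lambda>t. t powr p * prob {\<omega> \<in> space M. On 0 \<omega> > t}) \<longlongrightarrow> C) at_top"
    and square_integrable_Off: "integrable M (\<lambda>\<omega>. (Off 0 \<omega>)\<^sup>2)"

definition on_off_process ::
  "(nat \<Rightarrow> 'a \<Rightarrow> real) \<Rightarrow> (nat \<Rightarrow> 'a \<Rightarrow> real) \<Rightarrow> real \<Rightarrow> 'a \<Rightarrow> real" where
  "on_off_process Off On t \<omega> =
     (if \<exists>k. (\<Sum>i<k. Off i \<omega> + On i \<omega>) + Off k \<omega> \<le> t \<and> t \<le> (\<Sum>i<Suc k. Off i \<omega> + On i \<omega>)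
      then 1 else 0)"

definition A_on_off ::
  "'a measure \<Rightarrow> (nat \<Rightarrow> 'a \<Rightarrow> real) \<Rightarrow> (nat \<Rightarrow> 'a \<Rightarrow> real) \<Rightarrow> real \<Rightarrow> real" where
  "A_on_off M Off On =
     A_dev (stationary_law M (\<lambda>\<omega>. Off 0 \<omega> + On 0 \<omega>))
       (\<lambda>s t (\<omega>, u). LINT x:{s..t}|lborel. on_off_process Off On (u + x) \<omega>)"

end

theory Submission
  imports Defs
begin

text \<open>
  Moving the time origin of a regenerative process by \<open>s\<close> exchanges a stretch of length \<open>s\<close> at the
  beginning of the first cycle for a stretch of length \<open>s\<close> after it, and these have the same law.
  Hence the process is stationary under \<open>stationary_law\<close>, and the squared deviation
  \<open>(A\<^sup>\<Delta>)\<^sup>2\<close> equals \<open>E (I\<^sub>1 - I\<^sub>2)\<^sup>2 / (2 \<Delta>\<^sup>2)\<close> for the traffic \<open>I\<^sub>1, I\<^sub>2\<close> in the two windows.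

  For the packets, \<open>E (I\<^sub>1 - I\<^sub>2)\<^sup>2 / 2 = 2 D(\<Delta>) - D(2 \<Delta>) / 2\<close> with \<open>D(t)\<close> the mean square of
  (number of packets in \<open>(0, t]\<close>) \<open>- t / \<mu>\<close>.  Wald's identities give
  \<open>D(t) / t \<longrightarrow> \<sigma>\<^sup>2 / \<mu>\<^sup>3\<close>, because the overshoot of the random walk over the
  level \<open>t\<close> is \<open>o(\<surd>t)\<close> in mean square.

  For the ON/OFF source, the two windows differ only if the phase changes within \<open>2 \<Delta>\<close>, which
  settles \<open>\<Delta> \<longrightarrow> 0\<close>; the law of large numbers settles \<open>\<Delta> \<longrightarrow> \<infinity>\<close>; and an ON-period longer than
  \<open>2 \<Delta>\<close>, which the heavy tail provides, makes \<open>I\<^sub>1 \<noteq> I\<^sub>2\<close> with positive probability.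
\<close>

section \<open>Stationary regenerative traffic\<close>

text \<open>Length biasing costs one moment, and this shapes both halves. Gaps with two moments
  leave the delay \<open>r\<close> from the origin to the next packet with a guaranteed first moment
  only, so the error of the delayed count, divided by \<open>t\<close>, must be dominated linearly
  in \<open>r\<close>. But a window of length \<Delta> carries at most \<Delta>, hence (I_1 - I_2)^2
  is at most \<Delta> |I_1 - I_2|, and a law of large numbers in mean suffices.

  Differencing keeps the linear growth of D: if D(t) / t tends to L, then 2 D(\<Delta>) - D(2
  \<Delta>) / 2 behaves like 2 L \<Delta> - L \<Delta> = L \<Delta>. The constant L = \<sigma>^2 /
  \<mu>^3 vanishes exactly for constant gaps. In that case adjacent counts differ by at most one and
  the deviation is of order at most 1 / \<Delta>; this is what \<open>nondegenerate\<close>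
  excludes.\<close>

lemma abs_mult_le_sum_squares: "\<bar>a * b\<bar> \<le> a\<^sup>2 + b\<^sup>2" for a b :: real
proof -
  have "2 * (\<bar>a\<bar> * \<bar>b\<bar>) \<le> a\<^sup>2 + b\<^sup>2"
    using sum_squares_bound[of "\<bar>a\<bar>" "\<bar>b\<bar>"] by simp
  moreover have "0 \<le> \<bar>a\<bar> * \<bar>b\<bar>"
    by simp
  ultimately show ?thesis
    unfolding abs_mult by linarith
qed

lemma le_one_plus_square: "x \<le> 1 + x\<^sup>2" for x :: real
  using abs_mult_le_sum_squares[of 1 x] by simp

text \<open>With equal first and second moments, variance minus covariance is E X^2 - E XY, which is
  half of E (X - Y)^2. The second identity is the parallelogram law for X - c and Y - c: it trades
  the joint moment for mean square errors of single windows, the sum X + Y being the traffic of the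
  double window.\<close>

lemma covariance_identity:
  assumes "prob_space P"
    and [measurable]: "X \<in> borel_measurable P" "Y \<in> borel_measurable P"
    and X2: "integrable P (\<lambda>x. (X x)\<^sup>2)" and Y2: "integrable P (\<lambda>x. (Y x)\<^sup>2)"
    and EX: "(\<integral>x. X x \<partial>P) = (\<integral>x. Y x \<partial>P)"
    and EX2: "(\<integral>x. (X x)\<^sup>2 \<partial>P) = (\<integral>x. (Y x)\<^sup>2 \<partial>P)"
  shows "prob_space.variance P X - covariance P X Y = (\<integral>x. (X x - Y x)\<^sup>2 \<partial>P) / 2"
    and "(\<integral>x. (X x - Y x)\<^sup>2 \<partial>P) / 2 =
      2 * (\<integral>x. (X x - c)\<^sup>2 \<partial>P) - (\<integral>x. (X x + Y x - 2 * c)\<^sup>2 \<partial>P) / 2"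
proof -
  interpret prob_space P by fact
  have X1: "integrable P X" and Y1: "integrable P Y"
    using X2 Y2 by (auto intro: square_integrable_imp_integrable)
  have XY: "integrable P (\<lambda>x. X x * Y x)"
  proof (rule Bochner_Integration.integrable_bound[OF Bochner_Integration.integrable_add[OF X2 Y2]])
    show "AE x in P. norm (X x * Y x) \<le> norm ((X x)\<^sup>2 + (Y x)\<^sup>2)"
      by (simp add: abs_mult_le_sum_squares)
  qed simp
  note [simp] = X1 Y1 X2 Y2 XY
  have diff: "(\<integral>x. (X x - Y x)\<^sup>2 \<partial>P) =
      2 * (\<integral>x. (Y x)\<^sup>2 \<partial>P) - 2 * (\<integral>x. X x * Y x \<partial>P)"
  proof -
    have "(\<integral>x. (X x - Y x)\<^sup>2 \<partial>P) = (\<integral>x. (X x)\<^sup>2 + (Y x)\<^sup>2 - 2 * (X x * Y x) \<partial>P)"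
      by (simp add: power2_diff mult.assoc)
    then show ?thesis
      by (simp add: EX2)
  qed
  have "covariance P X Y = (\<integral>x. X x * Y x - expectation Y * X x - expectation Y * Y x + (expectation Y)\<^sup>2 \<partial>P)"
    unfolding covariance_def EX by (intro Bochner_Integration.integral_cong) (auto simp: algebra_simps power2_eq_square)
  also have "\<dots> = (\<integral>x. X x * Y x \<partial>P) - (expectation Y)\<^sup>2"
    by (simp add: prob_space EX power2_eq_square)
  finally show "variance X - covariance P X Y = (\<integral>x. (X x - Y x)\<^sup>2 \<partial>P) / 2"
    using variance_eq[OF X1 X2] by (simp add: diff EX EX2)
  have "(\<integral>x. (X x - c)\<^sup>2 \<partial>P) = (\<integral>x. (X x)\<^sup>2 - 2 * c * X x + c\<^sup>2 \<partial>P)"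
    by (intro Bochner_Integration.integral_cong) (auto simp: power2_diff)
  then have X_c: "(\<integral>x. (X x - c)\<^sup>2 \<partial>P) = (\<integral>x. (Y x)\<^sup>2 \<partial>P) - 2 * (c * expectation Y) + c\<^sup>2"
    by (simp add: prob_space EX EX2)
  have "(\<integral>x. (X x + Y x - 2 * c)\<^sup>2 \<partial>P) =
      (\<integral>x. (X x)\<^sup>2 + (Y x)\<^sup>2 + 2 * (X x * Y x) - 4 * c * X x - 4 * c * Y x + 4 * c\<^sup>2 \<partial>P)"
    by (intro Bochner_Integration.integral_cong) (auto simp: power2_eq_square algebra_simps)
  then have XY_c: "(\<integral>x. (X x + Y x - 2 * c)\<^sup>2 \<partial>P) =
      2 * (\<integral>x. (Y x)\<^sup>2 \<partial>P) + 2 * (\<integral>x. X x * Y x \<partial>P) - 8 * (c * expectation Y) + 4 * c\<^sup>2"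
    by (simp add: prob_space EX EX2)
  show "(\<integral>x. (X x - Y x)\<^sup>2 \<partial>P) / 2 =
      2 * (\<integral>x. (X x - c)\<^sup>2 \<partial>P) - (\<integral>x. (X x + Y x - 2 * c)\<^sup>2 \<partial>P) / 2"
    unfolding diff X_c XY_c by (simp add: field_simps)
qed

text \<open>By Tonelli the region below the graph of \<open>X\<close> has mass E X, which is the
  normalising constant. The right-hand side is the Palm formula: the mean of the integral over one
  cycle, divided by the mean cycle length.\<close>

lemma (in prob_space) nn_integral_stationary_law:
  assumes [measurable]: "X \<in> borel_measurable M" "f \<in> borel_measurable (M \<Otimes>\<^sub>M borel)"
    and X: "AE \<omega> in M. 0 \<le> X \<omega>" "integrable M X"
  shows "(\<integral>\<^sup>+z. f z \<partial>stationary_law M X) =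
    (\<integral>\<^sup>+\<omega>. \<integral>\<^sup>+u. f (\<omega>, u) * indicator {0..X \<omega>} u \<partial>lborel \<partial>M) / ennreal (expectation X)"
proof -
  let ?A = "{(\<omega>, u). \<omega> \<in> space M \<and> 0 \<le> u \<and> u \<le> X \<omega>}"
  have A_eq: "?A = {z \<in> space (M \<Otimes>\<^sub>M lborel). 0 \<le> snd z \<and> snd z \<le> X (fst z)}"
    by (auto simp: space_pair_measure)
  have [measurable]: "?A \<in> sets (M \<Otimes>\<^sub>M lborel)"
    unfolding A_eq by measurable
  have *: "(\<integral>\<^sup>+z. f z * indicator ?A z \<partial>(M \<Otimes>\<^sub>M lborel)) =
      (\<integral>\<^sup>+\<omega>. \<integral>\<^sup>+u. f (\<omega>, u) * indicator {0..X \<omega>} u \<partial>lborel \<partial>M)"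
    if [measurable]: "f \<in> borel_measurable (M \<Otimes>\<^sub>M borel)" for f
    by (subst lborel.nn_integral_fst[symmetric])
       (auto intro!: nn_integral_cong simp: indicator_def)
  have "emeasure (M \<Otimes>\<^sub>M lborel) ?A = (\<integral>\<^sup>+z. 1 * indicator ?A z \<partial>(M \<Otimes>\<^sub>M lborel))"
    unfolding mult_1 by (rule nn_integral_indicator[symmetric]) measurable
  also have "\<dots> = (\<integral>\<^sup>+\<omega>. \<integral>\<^sup>+u. indicator {0..X \<omega>} u \<partial>lborel \<partial>M)"
    by (subst *) simp_all
  also have "\<dots> = (\<integral>\<^sup>+\<omega>. ennreal (X \<omega>) \<partial>M)"
    using X(1) by (intro nn_integral_cong_AE) auto
  also have "\<dots> = ennreal (expectation X)"
    using X by (intro nn_integral_eq_integral) auto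
  finally have "emeasure (M \<Otimes>\<^sub>M lborel) ?A = ennreal (expectation X)" .
  then show ?thesis
    unfolding stationary_law_def
    using \<open>?A \<in> sets (M \<Otimes>\<^sub>M lborel)\<close>
    by (subst nn_integral_uniform_measure) (simp_all add: * del: sets_pair_measure_cong)
qed

text \<open>The interface shared by packets and the ON/OFF source. \<open>W_shift\<close> is the
  only trace of regeneration: a window opening after the first cycle has the law of a window of the
  original process. The point \<open>v = 0\<close> is left out, being null for the integral over
  \<open>v\<close>. \<open>W_finite\<close> allows cancellation in \<open>ennreal\<close>, and
  \<open>W_moment\<close> gives square integrability under the stationary law.\<close>

locale regenerative_traffic = prob_space M for M :: "'a measure" +
  fixes X :: "'a \<Rightarrow> real" and W :: "real \<Rightarrow> real \<Rightarrow> 'a \<Rightarrow> real"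
  assumes X_measurable [measurable]: "X \<in> borel_measurable M"
    and X_nonneg: "AE \<omega> in M. 0 \<le> X \<omega>"
    and X_integrable: "integrable M X"
    and X_pos: "0 < expectation X"
    and W_measurable: "\<And>d. 0 \<le> d \<Longrightarrow> (\<lambda>(\<omega>, v). W v (v + d) \<omega>) \<in> borel_measurable (M \<Otimes>\<^sub>M borel)"
    and W_nonneg: "\<And>s t \<omega>. 0 \<le> W s t \<omega>"
    and W_add: "AE \<omega> in M. \<forall>a b c. 0 \<le> a \<longrightarrow> a \<le> b \<longrightarrow> b \<le> c \<longrightarrow> W a b \<omega> + W b c \<omega> = W a c \<omega>"
    and W_shift: "\<And>v d (g :: real \<Rightarrow> ennreal). 0 < v \<Longrightarrow> 0 \<le> d \<Longrightarrow> g \<in> borel_measurable borel \<Longrightarrow>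
      (\<integral>\<^sup>+\<omega>. g (W (X \<omega> + v) (X \<omega> + v + d) \<omega>) \<partial>M) = (\<integral>\<^sup>+\<omega>. g (W v (v + d) \<omega>) \<partial>M)"
    and W_finite: "\<And>s d. 0 \<le> s \<Longrightarrow> 0 \<le> d \<Longrightarrow>
      (\<integral>\<^sup>+\<omega>. \<integral>\<^sup>+v. ennreal ((W v (v + d) \<omega>)\<^sup>2) * indicator {0..s} v \<partial>lborel \<partial>M) < \<infinity>"
    and W_moment: "\<And>d. 0 \<le> d \<Longrightarrow>
      (\<integral>\<^sup>+\<omega>. \<integral>\<^sup>+v. ennreal ((W v (v + d) \<omega>)\<^sup>2) * indicator {0..X \<omega>} v \<partial>lborel \<partial>M) < \<infinity>"
begin

abbreviation "P \<equiv> stationary_law M X"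
abbreviation "J \<equiv> (\<lambda>s t (\<omega>, u). W (u + s) (u + t) \<omega>)"

lemma nn_integral_P:
  assumes "f \<in> borel_measurable (M \<Otimes>\<^sub>M borel)"
  shows "(\<integral>\<^sup>+z. f z \<partial>P) =
    (\<integral>\<^sup>+\<omega>. \<integral>\<^sup>+u. f (\<omega>, u) * indicator {0..X \<omega>} u \<partial>lborel \<partial>M) / ennreal (expectation X)"
  using assms X_nonneg X_integrable by (intro nn_integral_stationary_law) auto

lemma sets_P [measurable_cong]: "sets P = sets (M \<Otimes>\<^sub>M borel)"
  by (simp add: stationary_law_def cong: sets_pair_measure_cong)

lemma prob_space_P: "prob_space P"
proof
  have "emeasure P (space P) = (\<integral>\<^sup>+z. 1 \<partial>P)"
    by simp
  also have "\<dots> = (\<integral>\<^sup>+\<omega>. ennreal (X \<omega>) \<partial>M) / ennreal (expectation X)"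
    using X_nonneg
    by (subst nn_integral_P) (auto intro!: arg_cong2[where f="(/)"] nn_integral_cong_AE)
  also have "(\<integral>\<^sup>+\<omega>. ennreal (X \<omega>) \<partial>M) = ennreal (expectation X)"
    using X_nonneg X_integrable by (intro nn_integral_eq_integral) auto
  finally show "emeasure P (space P) = 1"
    using X_pos by (simp add: divide_ennreal)
qed

text \<open>The exceptional pairs lie in a strip \<open>N \<times> UNIV\<close> over a null set
  \<open>N\<close>, which is null for the product; so \<open>Q\<close> itself need not be
  measurable.\<close>

lemma AE_P:
  assumes "AE \<omega> in M. \<forall>u. 0 \<le> u \<longrightarrow> u \<le> X \<omega> \<longrightarrow> Q (\<omega>, u)"
  shows "AE z in P. Q z"
  unfolding stationary_law_def
proof (rule AE_uniform_measureI)
  let ?A = "{(\<omega>, u). \<omega> \<in> space M \<and> 0 \<le> u \<and> u \<le> X \<omega>}"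
  have A_eq: "?A = {z \<in> space (M \<Otimes>\<^sub>M lborel). 0 \<le> snd z \<and> snd z \<le> X (fst z)}"
    by (auto simp: space_pair_measure)
  show "?A \<in> sets (M \<Otimes>\<^sub>M lborel)"
    unfolding A_eq by measurable
  obtain N where N: "N \<in> null_sets M" "{\<omega> \<in> space M. \<not> (\<forall>u. 0 \<le> u \<longrightarrow> u \<le> X \<omega> \<longrightarrow> Q (\<omega>, u))} \<subseteq> N"
    using assms by (auto simp: eventually_ae_filter)
  have "N \<times> UNIV \<in> null_sets (M \<Otimes>\<^sub>M lborel)"
    using N(1) by (intro null_setsI, subst lborel.emeasure_pair_measure_Times) auto
  then show "AE z in M \<Otimes>\<^sub>M lborel. z \<in> ?A \<longrightarrow> Q z"
    by (rule AE_I') (use N(2) in \<open>auto simp: space_pair_measure\<close>)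
qed

lemma J_measurable: "s \<le> t \<Longrightarrow> J s t \<in> borel_measurable P"
proof -
  assume "s \<le> t"
  then have [measurable]: "(\<lambda>(\<omega>, v). W v (v + (t - s)) \<omega>) \<in> borel_measurable (M \<Otimes>\<^sub>M borel)"
    by (intro W_measurable) simp
  have "(\<lambda>z. (\<lambda>(\<omega>, v). W v (v + (t - s)) \<omega>) (fst z, snd z + s)) \<in> borel_measurable P"
    by measurable
  then show ?thesis
    by (simp add: case_prod_beta' add.assoc)
qed

text \<open>Both sides are the integral of \<open>F\<close> over \<open>[0, x + s]\<close>, cut once
  at \<open>s\<close> and once at \<open>x\<close>. It is stated with sums because subtraction is
  unsafe in \<open>ennreal\<close>; half-open pieces make the cuts disjoint.\<close>

lemma shifted_cycle:
  fixes F :: "real \<Rightarrow> ennreal" and x s :: real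
  assumes [measurable]: "F \<in> borel_measurable borel" and "0 \<le> x" "0 \<le> s"
  shows "(\<integral>\<^sup>+u. F (u + s) * indicator {0..x} u \<partial>lborel) + (\<integral>\<^sup>+v. F v * indicator {0..s} v \<partial>lborel) =
    (\<integral>\<^sup>+u. F u * indicator {0..x} u \<partial>lborel) + (\<integral>\<^sup>+v. F (x + v) * indicator {0..s} v \<partial>lborel)"
proof -
  have shift: "(\<integral>\<^sup>+v. F (c + v) * indicator {0..d} v \<partial>lborel) =
      (\<integral>\<^sup>+v. F v * indicator {c<..c + d} v \<partial>lborel)" (is "?l = ?r") for c d
  proof -
    have "?l = (\<integral>\<^sup>+v. F (c + v) * indicator {0<..d} v \<partial>lborel)"
      by (intro nn_integral_cong_AE, use AE_lborel_singleton[of 0] in eventually_elim)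
         (auto simp: indicator_def)
    also have "\<dots> = ?r"
      by (subst lborel_distr_plus[of c, symmetric], subst nn_integral_distr)
         (auto intro!: nn_integral_cong simp: indicator_def)
    finally show ?thesis .
  qed
  have zero: "(\<integral>\<^sup>+v. F v * indicator {0..d} v \<partial>lborel) =
      (\<integral>\<^sup>+v. F v * indicator {0<..d} v \<partial>lborel)" for d
    by (intro nn_integral_cong_AE, use AE_lborel_singleton[of 0] in eventually_elim)
       (auto simp: indicator_def)
  have "(\<integral>\<^sup>+v. F v * indicator {s<..s + x} v \<partial>lborel) + (\<integral>\<^sup>+v. F v * indicator {0<..s} v \<partial>lborel) =
      (\<integral>\<^sup>+v. F v * indicator {0<..s + x} v \<partial>lborel)"
    using assms by (subst nn_integral_add[symmetric]) (auto intro!: nn_integral_cong simp: indicator_def)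
  also have "\<dots> = (\<integral>\<^sup>+v. F v * indicator {0<..x} v \<partial>lborel) + (\<integral>\<^sup>+v. F v * indicator {x<..x + s} v \<partial>lborel)"
    using assms by (subst nn_integral_add[symmetric]) (auto intro!: nn_integral_cong simp: indicator_def)
  finally show ?thesis
    by (simp add: shift zero add.commute[of _ s])
qed

text \<open>
  Shifting the observation window by \<open>s\<close> trades the stretch \<open>[0, s]\<close> at the beginning of the
  cycle against the stretch \<open>[X, X + s]\<close> after it; by \<open>W_shift\<close> both have the same expectation.
\<close>

lemma stationary:
  fixes g :: "real \<Rightarrow> ennreal"
  assumes [measurable]: "g \<in> borel_measurable borel" and s: "0 \<le> s" and d: "0 \<le> d"
    and fin: "(\<integral>\<^sup>+\<omega>. \<integral>\<^sup>+v. g (W v (v + d) \<omega>) * indicator {0..s} v \<partial>lborel \<partial>M) < \<infinity>"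
  shows "(\<integral>\<^sup>+z. g (J s (s + d) z) \<partial>P) = (\<integral>\<^sup>+z. g (J 0 d z) \<partial>P)"
proof -
  note W_measurable[OF d, measurable]
  have meas: "(\<lambda>z. g (W (f z) (f z + d) (k z))) \<in> borel_measurable N"
    if [measurable]: "f \<in> borel_measurable N" "k \<in> measurable N M" for f k and N :: "'c measure"
  proof -
    have "(\<lambda>z. g ((\<lambda>(\<omega>, v). W v (v + d) \<omega>) (k z, f z))) \<in> borel_measurable N"
      by measurable
    then show ?thesis by simp
  qed
  note [measurable] = meas
  have indicator_Icc_eq: "indicator {a..b} u = (if a \<le> u \<and> u \<le> b then 1 else 0 :: ennreal)" for a b u :: real
    by (simp add: indicator_def)
  let ?I = "\<lambda>h. (\<integral>\<^sup>+\<omega>. \<integral>\<^sup>+u. h \<omega> u * indicator {0..X \<omega>} u \<partial>lborel \<partial>M)"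
  let ?K = "\<lambda>h. (\<integral>\<^sup>+\<omega>. \<integral>\<^sup>+v. h \<omega> v * indicator {0..s} v \<partial>lborel \<partial>M)"
  let ?F = "\<lambda>\<omega> v. g (W v (v + d) \<omega>)"
  have "?I (\<lambda>\<omega> u. ?F \<omega> (u + s)) + ?K ?F =
     (\<integral>\<^sup>+\<omega>. (\<integral>\<^sup>+u. ?F \<omega> (u + s) * indicator {0..X \<omega>} u \<partial>lborel) +
         (\<integral>\<^sup>+v. ?F \<omega> v * indicator {0..s} v \<partial>lborel) \<partial>M)"
    by (rule nn_integral_add[symmetric]) (simp_all add: indicator_Icc_eq)
  also have "\<dots> =
     (\<integral>\<^sup>+\<omega>. (\<integral>\<^sup>+u. ?F \<omega> u * indicator {0..X \<omega>} u \<partial>lborel) +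
         (\<integral>\<^sup>+v. ?F \<omega> (X \<omega> + v) * indicator {0..s} v \<partial>lborel) \<partial>M)"
  proof (rule nn_integral_cong_AE, use X_nonneg AE_space in eventually_elim)
    case (elim \<omega>)
    then have [measurable]: "?F \<omega> \<in> borel_measurable borel"
      by measurable
    show ?case
      using elim s by (intro shifted_cycle) auto
  qed
  also have "\<dots> = ?I ?F + ?K (\<lambda>\<omega> v. ?F \<omega> (X \<omega> + v))"
    by (rule nn_integral_add) (simp_all add: indicator_Icc_eq)
  also have "?K (\<lambda>\<omega> v. ?F \<omega> (X \<omega> + v)) =
      (\<integral>\<^sup>+v. (\<integral>\<^sup>+\<omega>. ?F \<omega> (X \<omega> + v) * indicator {0..s} v \<partial>M) \<partial>lborel)"
    by (rule pair_sigma_finite.Fubini'[symmetric])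
       (auto intro: pair_sigma_finite.intro sigma_finite_lborel sigma_finite_measure_axioms simp: indicator_Icc_eq)
  also have "\<dots> = (\<integral>\<^sup>+v. (\<integral>\<^sup>+\<omega>. ?F \<omega> v * indicator {0..s} v \<partial>M) \<partial>lborel)"
  proof (intro nn_integral_cong_AE, use AE_lborel_singleton[of 0] in eventually_elim)
    case (elim v)
    have "(\<integral>\<^sup>+\<omega>. ?F \<omega> (X \<omega> + v) \<partial>M) = (\<integral>\<^sup>+\<omega>. ?F \<omega> v \<partial>M)" if "v \<in> {0..s}"
      using elim d that by (intro W_shift) auto
    then show ?case
      by (simp add: indicator_def)
  qed
  also have "\<dots> = ?K ?F"
    by (rule pair_sigma_finite.Fubini')
       (auto intro: pair_sigma_finite.intro sigma_finite_lborel sigma_finite_measure_axioms simp: indicator_Icc_eq)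
  \<comment> \<open>The common term \<open>?K ?F\<close> may be cancelled only because
    \<open>fin\<close> makes it finite.\<close>
  finally have "?I (\<lambda>\<omega> u. ?F \<omega> (u + s)) = ?I ?F"
    using fin by (auto simp: ennreal_add_left_cancel add.commute[of _ "?K ?F"])
  then have "(\<integral>\<^sup>+z. ?F (fst z) (snd z + s) \<partial>P) = (\<integral>\<^sup>+z. ?F (fst z) (snd z) \<partial>P)"
    by (subst (1 2) nn_integral_P) simp_all
  then show ?thesis
    by (simp add: case_prod_beta' add.assoc)
qed

lemma J_square_integrable: "0 \<le> d \<Longrightarrow> integrable P (\<lambda>z. (J 0 d z)\<^sup>2)"
proof -
  assume d: "0 \<le> d"
  have [measurable]: "J 0 d \<in> borel_measurable P"
    using J_measurable d by blast
  have m: "(\<lambda>z. (J 0 d z)\<^sup>2) \<in> borel_measurable P"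
    by measurable
  have "(\<integral>\<^sup>+z. ennreal ((J 0 d z)\<^sup>2) \<partial>P) < \<infinity>"
  proof (subst nn_integral_P)
    show "(\<lambda>z. ennreal ((J 0 d z)\<^sup>2)) \<in> borel_measurable (M \<Otimes>\<^sub>M borel)"
      using m by (simp cong: measurable_cong_sets[OF sets_P refl])
    show "(\<integral>\<^sup>+\<omega>. \<integral>\<^sup>+u. ennreal ((J 0 d (\<omega>, u))\<^sup>2) * indicator {0..X \<omega>} u \<partial>lborel \<partial>M)
       / ennreal (expectation X) < \<infinity>"
      using W_moment[OF d] X_pos by (simp add: less_top[symmetric] ennreal_divide_eq_top_iff)
  qed
  then show ?thesis
    using m by (intro integrableI_bounded) auto
qed

text \<open>Stationarity supplies the equal moments that \<open>covariance_identity\<close> asks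
  for. The rate \<open>q\<close> is free; it is set to the packet intensity \<open>1 / \<mu>\<close>
  later. Since the two windows join up to one of length \<open>2 * \<Delta>\<close>, the second form
  speaks only of windows that start at the origin.\<close>

lemma A_dev_J:
  assumes "0 < \<Delta>"
  shows "A_dev P J \<Delta> = sqrt ((\<integral>z. (J 0 \<Delta> z - J \<Delta> (2 * \<Delta>) z)\<^sup>2 \<partial>P) / 2) / \<Delta>"
    and "(\<integral>z. (J 0 \<Delta> z - J \<Delta> (2 * \<Delta>) z)\<^sup>2 \<partial>P) / 2 =
      2 * (\<integral>z. (J 0 \<Delta> z - q * \<Delta>)\<^sup>2 \<partial>P) - (\<integral>z. (J 0 (2 * \<Delta>) z - q * (2 * \<Delta>))\<^sup>2 \<partial>P) / 2"
proof -
  interpret P: prob_space P by (rule prob_space_P)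
  let ?X = "J 0 \<Delta>" and ?Y = "J \<Delta> (2 * \<Delta>)"
  have mX [measurable]: "?X \<in> borel_measurable P" and mY [measurable]: "?Y \<in> borel_measurable P"
    using J_measurable[of 0 \<Delta>] J_measurable[of \<Delta> "2 * \<Delta>"] assms by simp_all
  have X2: "integrable P (\<lambda>z. (?X z)\<^sup>2)"
    using assms by (intro J_square_integrable) simp
  have nnX: "0 \<le> ?X z" and nnY: "0 \<le> ?Y z" for z
    by (auto simp: W_nonneg split: prod.split)
  let ?q = "\<lambda>\<omega>. \<integral>\<^sup>+v. ennreal ((W v (v + \<Delta>) \<omega>)\<^sup>2) * indicator {0..\<Delta>} v \<partial>lborel"
  have fin2: "(\<integral>\<^sup>+\<omega>. ?q \<omega> \<partial>M) < \<infinity>"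
    using assms by (intro W_finite) auto
  \<comment> \<open>The first moment is controlled by the second through x \<le> 1 + x^2 on an
    interval of finite length. Both are needed, because \<open>stationary\<close> is applied to the
    square and to the identity.\<close>
  have fin1: "(\<integral>\<^sup>+\<omega>. \<integral>\<^sup>+v. ennreal (W v (v + \<Delta>) \<omega>) * indicator {0..\<Delta>} v \<partial>lborel \<partial>M) < \<infinity>"
  proof -
    have [measurable]: "(\<lambda>(\<omega>, v). W v (v + \<Delta>) \<omega>) \<in> borel_measurable (M \<Otimes>\<^sub>M borel)"
      using assms by (intro W_measurable) simp
    have [measurable]: "(\<lambda>z. W (snd z) (snd z + \<Delta>) (fst z)) \<in> borel_measurable (M \<Otimes>\<^sub>M borel)"
      using W_measurable[of \<Delta>] assms by (simp add: case_prod_beta')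
    have "(\<integral>\<^sup>+\<omega>. \<integral>\<^sup>+v. ennreal (W v (v + \<Delta>) \<omega>) * indicator {0..\<Delta>} v \<partial>lborel \<partial>M) \<le>
      (\<integral>\<^sup>+\<omega>. \<integral>\<^sup>+v. indicator {0..\<Delta>} v + ennreal ((W v (v + \<Delta>) \<omega>)\<^sup>2) * indicator {0..\<Delta>} v \<partial>lborel \<partial>M)"
    proof (intro nn_integral_mono)
      fix \<omega> v
      have "ennreal (W v (v + \<Delta>) \<omega>) \<le> ennreal (1 + (W v (v + \<Delta>) \<omega>)\<^sup>2)"
        by (intro ennreal_leI le_one_plus_square)
      also have "\<dots> = 1 + ennreal ((W v (v + \<Delta>) \<omega>)\<^sup>2)"
        by (subst ennreal_plus) auto
      finally show "ennreal (W v (v + \<Delta>) \<omega>) * indicator {0..\<Delta>} v \<le>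
          indicator {0..\<Delta>} v + ennreal ((W v (v + \<Delta>) \<omega>)\<^sup>2) * indicator {0..\<Delta>} v"
        by (auto simp: indicator_def)
    qed
    also have "\<dots> = (\<integral>\<^sup>+\<omega>. ennreal \<Delta> + ?q \<omega> \<partial>M)"
      using assms by (intro nn_integral_cong, subst nn_integral_add) auto
    also have "\<dots> = ennreal \<Delta> + (\<integral>\<^sup>+\<omega>. ?q \<omega> \<partial>M)"
      by (subst nn_integral_add) (auto simp: emeasure_space_1)
    also have "\<dots> < \<infinity>"
      using fin2 by simp
    finally show ?thesis .
  qed
  have stat2: "(\<integral>\<^sup>+z. ennreal ((?Y z)\<^sup>2) \<partial>P) = (\<integral>\<^sup>+z. ennreal ((?X z)\<^sup>2) \<partial>P)"
    using stationary[of "\<lambda>x. ennreal (x\<^sup>2)" \<Delta> \<Delta>] fin2 assms by simp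
  have stat1: "(\<integral>\<^sup>+z. ennreal (?Y z) \<partial>P) = (\<integral>\<^sup>+z. ennreal (?X z) \<partial>P)"
    using stationary[of ennreal \<Delta> \<Delta>] fin1 assms by simp
  have Y2: "integrable P (\<lambda>z. (?Y z)\<^sup>2)"
    using X2 stat2 by (simp add: integrable_iff_bounded)
  have e1: "(\<integral>z. ?X z \<partial>P) = (\<integral>z. ?Y z \<partial>P)"
  proof -
    have "(\<integral>z. ?X z \<partial>P) = enn2real (\<integral>\<^sup>+z. ennreal (?X z) \<partial>P)"
      by (rule integral_eq_nn_integral, measurable) (rule AE_I2, rule nnX)
    moreover have "(\<integral>z. ?Y z \<partial>P) = enn2real (\<integral>\<^sup>+z. ennreal (?Y z) \<partial>P)"
      by (rule integral_eq_nn_integral, measurable) (rule AE_I2, rule nnY)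
    ultimately show ?thesis
      unfolding stat1 by simp
  qed
  have e2: "(\<integral>z. (?X z)\<^sup>2 \<partial>P) = (\<integral>z. (?Y z)\<^sup>2 \<partial>P)"
  proof -
    have "(\<integral>z. (?X z)\<^sup>2 \<partial>P) = enn2real (\<integral>\<^sup>+z. ennreal ((?X z)\<^sup>2) \<partial>P)"
      by (rule integral_eq_nn_integral, rule borel_measurable_power, fact, rule AE_I2, rule zero_le_power2)
    moreover have "(\<integral>z. (?Y z)\<^sup>2 \<partial>P) = enn2real (\<integral>\<^sup>+z. ennreal ((?Y z)\<^sup>2) \<partial>P)"
      by (rule integral_eq_nn_integral, rule borel_measurable_power, fact, rule AE_I2, rule zero_le_power2)
    ultimately show ?thesis
      unfolding stat2 by simp
  qed
  note id = covariance_identity[OF prob_space_P mX mY X2 Y2 e1 e2]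
  show "A_dev P J \<Delta> = sqrt ((\<integral>z. (?X z - ?Y z)\<^sup>2 \<partial>P) / 2) / \<Delta>"
    unfolding A_dev_def id(1) ..
  have [measurable]: "J 0 (2 * \<Delta>) \<in> borel_measurable P"
    using assms by (intro J_measurable) simp
  have "AE z in P. ?X z + ?Y z = J 0 (2 * \<Delta>) z"
  proof (rule AE_P)
    show "AE \<omega> in M. \<forall>u. 0 \<le> u \<longrightarrow> u \<le> X \<omega> \<longrightarrow> ?X (\<omega>, u) + ?Y (\<omega>, u) = J 0 (2 * \<Delta>) (\<omega>, u)"
      using W_add by eventually_elim (use assms in auto)
  qed
  then have "(\<integral>z. (?X z + ?Y z - 2 * (q * \<Delta>))\<^sup>2 \<partial>P) = (\<integral>z. (J 0 (2 * \<Delta>) z - q * (2 * \<Delta>))\<^sup>2 \<partial>P)"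
  proof (intro integral_cong_AE)
    assume "AE z in P. ?X z + ?Y z = J 0 (2 * \<Delta>) z"
    then show "AE z in P. (?X z + ?Y z - 2 * (q * \<Delta>))\<^sup>2 = (J 0 (2 * \<Delta>) z - q * (2 * \<Delta>))\<^sup>2"
      by eventually_elim (simp only: mult.left_commute[of 2 q])
  qed measurable
  then show "(\<integral>z. (?X z - ?Y z)\<^sup>2 \<partial>P) / 2 =
      2 * (\<integral>z. (?X z - q * \<Delta>)\<^sup>2 \<partial>P) - (\<integral>z. (J 0 (2 * \<Delta>) z - q * (2 * \<Delta>))\<^sup>2 \<partial>P) / 2"
    using id(2)[of "q * \<Delta>"] by simp
qed

end

section \<open>Independent identically distributed sequences\<close>

text \<open>Cauchy-Schwarz by the discriminant: E (X - x Y)^2 is nonnegative for every real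
  \<open>x\<close>. The minimiser \<open>b / c\<close> requires \<open>c \<noteq> 0\<close>, hence
  the case split.\<close>

lemma (in prob_space) expectation_mult_squared_le:
  fixes X Y :: "'a \<Rightarrow> real"
  assumes X: "integrable M (\<lambda>\<omega>. (X \<omega>)\<^sup>2)" and Y: "integrable M (\<lambda>\<omega>. (Y \<omega>)\<^sup>2)"
    and XY: "integrable M (\<lambda>\<omega>. X \<omega> * Y \<omega>)"
  shows "(expectation (\<lambda>\<omega>. X \<omega> * Y \<omega>))\<^sup>2 \<le> expectation (\<lambda>\<omega>. (X \<omega>)\<^sup>2) * expectation (\<lambda>\<omega>. (Y \<omega>)\<^sup>2)"
proof -
  define a b c where "a = expectation (\<lambda>\<omega>. (X \<omega>)\<^sup>2)" and "b = expectation (\<lambda>\<omega>. X \<omega> * Y \<omega>)"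
    and "c = expectation (\<lambda>\<omega>. (Y \<omega>)\<^sup>2)"
  have q: "0 \<le> a - 2 * x * b + x\<^sup>2 * c" for x
  proof -
    have "0 \<le> expectation (\<lambda>\<omega>. (X \<omega> - x * Y \<omega>)\<^sup>2)"
      by (intro integral_nonneg_AE) auto
    also have "\<dots> = expectation (\<lambda>\<omega>. (X \<omega>)\<^sup>2 - 2 * x * (X \<omega> * Y \<omega>) + x\<^sup>2 * (Y \<omega>)\<^sup>2)"
      by (intro Bochner_Integration.integral_cong) (auto simp: power2_eq_square algebra_simps)
    also have "\<dots> = a - 2 * x * b + x\<^sup>2 * c"
      unfolding a_def b_def c_def using X Y XY by simp
    finally show ?thesis .
  qed
  have "0 \<le> c"
    unfolding c_def by (intro integral_nonneg_AE) auto
  have "b\<^sup>2 \<le> a * c"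
  proof (cases "c = 0")
    case True
    \<comment> \<open>For \<open>c = 0\<close> the quadratic is affine in \<open>x\<close>; if
      \<open>b\<close> were nonzero, this \<open>x\<close> would give it the value -1.\<close>
    then have "b = 0"
      using q[of "(a + 1) / (2 * b)"] by (cases "b = 0") (auto simp: field_simps)
    then show ?thesis
      using True by simp
  next
    case False
    then have "0 \<le> a - b\<^sup>2 / c"
      using q[of "b / c"] by (simp add: power2_eq_square)
    then show ?thesis
      using False \<open>0 \<le> c\<close> by (simp add: field_simps)
  qed
  then show ?thesis
    by (simp add: a_def b_def c_def)
qed

text \<open>Dominated convergence: for each outcome the indicator is eventually zero. Keeping
  \<open>Y\<close> apart from \<open>Z\<close> lets one statement serve first and second moments
  truncated at the same level.\<close>

lemma (in prob_space) expectation_tail_tendsto_0: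
  fixes Y Z :: "'a \<Rightarrow> real"
  assumes Y: "integrable M Y" and [measurable]: "Z \<in> borel_measurable M"
  shows "((\<lambda>K. expectation (\<lambda>\<omega>. Y \<omega> * indicator {K<..} (Z \<omega>))) \<longlongrightarrow> 0) at_top"
proof -
  have "((\<lambda>K. expectation (\<lambda>\<omega>. Y \<omega> * indicator {K<..} (Z \<omega>))) \<longlongrightarrow> expectation (\<lambda>_. 0)) at_top"
  proof (rule integral_dominated_convergence_at_top[where w="\<lambda>\<omega>. \<bar>Y \<omega>\<bar>"])
    show "AE \<omega> in M. ((\<lambda>K. Y \<omega> * indicator {K<..} (Z \<omega>)) \<longlongrightarrow> 0) at_top"
    proof (intro AE_I2 tendsto_eventually)
      fix \<omega>
      show "\<forall>\<^sub>F K in at_top. Y \<omega> * indicator {K<..} (Z \<omega>) = 0"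
        using eventually_ge_at_top[of "Z \<omega>"] by eventually_elim auto
    qed
  qed (use Y in \<open>auto simp: indicator_def\<close>)
  then show ?thesis
    by simp
qed

text \<open>\<open>Z\<close> is at most its ceiling, which is the number of naturals
  \<open>n\<close> below \<open>Z\<close>; taking expectations bounds E Z by the series of tail
  probabilities.\<close>

lemma (in prob_space) integrable_of_summable_tail:
  fixes Z :: "'a \<Rightarrow> real"
  assumes [measurable]: "Z \<in> borel_measurable M" and nonneg: "AE \<omega> in M. 0 \<le> Z \<omega>"
    and sum: "summable (\<lambda>n. prob {\<omega> \<in> space M. real n < Z \<omega>})"
  shows "integrable M Z"
proof (rule integrableI_nonneg[OF _ nonneg])
  have "(\<integral>\<^sup>+\<omega>. ennreal (Z \<omega>) \<partial>M) \<le> (\<integral>\<^sup>+\<omega>. (\<Sum>n. indicator {\<omega> \<in> space M. real n < Z \<omega>} \<omega>) \<partial>M)"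
  proof (rule nn_integral_mono)
    fix \<omega> assume \<omega>: "\<omega> \<in> space M"
    let ?k = "nat \<lceil>Z \<omega>\<rceil>"
    have "ennreal (Z \<omega>) \<le> ennreal (real ?k)"
      by (intro ennreal_leI real_nat_ceiling_ge)
    also have "\<dots> = (\<Sum>n<?k. 1)"
      by (simp add: ennreal_of_nat_eq_real_of_nat)
    also have "\<dots> = (\<Sum>n<?k. indicator {\<omega> \<in> space M. real n < Z \<omega>} \<omega>)"
    proof (intro sum.cong refl)
      fix n assume "n \<in> {..<?k}"
      then have "real n < Z \<omega>"
        by (simp add: zless_nat_eq_int_zless less_ceiling_iff)
      then show "1 = (indicator {\<omega> \<in> space M. real n < Z \<omega>} \<omega> :: ennreal)"
        using \<omega> by simp
    qed
    also have "\<dots> \<le> (\<Sum>n. indicator {\<omega> \<in> space M. real n < Z \<omega>} \<omega>)"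
      by (rule sum_le_suminf) auto
    finally show "ennreal (Z \<omega>) \<le> (\<Sum>n. indicator {\<omega> \<in> space M. real n < Z \<omega>} \<omega>)" .
  qed
  also have "\<dots> = (\<Sum>n. emeasure M {\<omega> \<in> space M. real n < Z \<omega>})"
    by (subst nn_integral_suminf) auto
  also have "\<dots> = ennreal (\<Sum>n. prob {\<omega> \<in> space M. real n < Z \<omega>})"
    unfolding emeasure_eq_measure using sum by (intro suminf_ennreal2) auto
  also have "\<dots> < \<infinity>"
    by simp
  finally show "(\<integral>\<^sup>+\<omega>. ennreal (Z \<omega>) \<partial>M) < \<infinity>" .
qed measurable

text \<open>No moments are assumed, since the ON-durations, whose second moment is infinite, are an
  instance as well as the packet gaps.\<close>

locale iid_sequence = prob_space M for M :: "'a measure" +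
  fixes R :: "nat \<Rightarrow> 'a \<Rightarrow> real"
  assumes indep: "indep_vars (\<lambda>_. borel) R UNIV"
    and ident: "\<And>j. distr M borel (R j) = distr M borel (R 0)"
begin

lemma R_measurable [measurable]: "R j \<in> borel_measurable M"
  using indep by (simp add: indep_vars_def)

lemma seq_measurable [measurable]: "(\<lambda>\<omega> i. R i \<omega>) \<in> measurable M (\<Pi>\<^sub>M i\<in>UNIV. borel)"
  by (rule measurable_PiM_single') (auto simp: space_PiM)

lemma nn_integral_ident:
  assumes "f \<in> borel_measurable borel"
  shows "(\<integral>\<^sup>+\<omega>. f (R j \<omega>) \<partial>M) = (\<integral>\<^sup>+\<omega>. f (R 0 \<omega>) \<partial>M)"
  using assms nn_integral_distr[OF R_measurable, of f j] nn_integral_distr[OF R_measurable, of f 0]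
  unfolding ident[of j] by simp

lemma integral_ident:
  fixes f :: "real \<Rightarrow> real"
  assumes "f \<in> borel_measurable borel"
  shows "(\<integral>\<omega>. f (R j \<omega>) \<partial>M) = (\<integral>\<omega>. f (R 0 \<omega>) \<partial>M)"
  using assms integral_distr[OF R_measurable, of f j] integral_distr[OF R_measurable, of f 0]
  unfolding ident[of j] by simp

lemma integrable_ident:
  fixes f :: "real \<Rightarrow> real"
  assumes "f \<in> borel_measurable borel" "integrable M (\<lambda>\<omega>. f (R 0 \<omega>))"
  shows "integrable M (\<lambda>\<omega>. f (R j \<omega>))"
  using assms integrable_distr_eq[OF R_measurable, of f j] integrable_distr_eq[OF R_measurable, of f 0]
  unfolding ident[of j] by simp

lemma AE_ident:
  assumes "AE \<omega> in M. Q (R 0 \<omega>)" and "{x \<in> space borel. Q x} \<in> sets borel"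
  shows "AE \<omega> in M. Q (R j \<omega>)"
  using assms AE_distr_iff[OF R_measurable, of Q j] AE_distr_iff[OF R_measurable, of Q 0]
  unfolding ident[of j] by simp

text \<open>The index sets \<open>{..<n}\<close> and \<open>{n}\<close> are disjoint. Expressing the
  past through the restricted sequence is what makes "a function of the first \<open>n\<close>
  variables" precise.\<close>

lemma past_indep:
  assumes g: "g \<in> measurable (\<Pi>\<^sub>M i\<in>{..<n}. borel) N" and f: "f \<in> measurable borel L"
  shows "indep_var N (\<lambda>\<omega>. g (\<lambda>i\<in>{..<n}. R i \<omega>)) L (\<lambda>\<omega>. f (R n \<omega>))"
proof -
  have "indep_var (\<Pi>\<^sub>M i\<in>{..<n}. borel) (\<lambda>\<omega>. \<lambda>i\<in>{..<n}. R i \<omega>) (\<Pi>\<^sub>M i\<in>{n}. borel) (\<lambda>\<omega>. \<lambda>i\<in>{n}. R i \<omega>)"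
    by (rule indep_var_restrict[OF indep]) auto
  moreover have "(\<lambda>x. f (x n)) \<in> measurable (\<Pi>\<^sub>M i\<in>{n}. borel :: real measure) L"
    using f by measurable
  ultimately have "indep_var N (g \<circ> (\<lambda>\<omega>. \<lambda>i\<in>{..<n}. R i \<omega>)) L ((\<lambda>x. f (x n)) \<circ> (\<lambda>\<omega>. \<lambda>i\<in>{n}. R i \<omega>))"
    using g by (intro indep_var_compose)
  then show ?thesis
    by (simp add: comp_def)
qed

lemma nn_integral_past:
  fixes f :: "real \<Rightarrow> ennreal"
  assumes g [measurable]: "g \<in> borel_measurable (\<Pi>\<^sub>M i\<in>{..<n}. borel)" and f [measurable]: "f \<in> borel_measurable borel"
  shows "(\<integral>\<^sup>+\<omega>. g (\<lambda>i\<in>{..<n}. R i \<omega>) * f (R n \<omega>) \<partial>M) =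
    (\<integral>\<^sup>+\<omega>. g (\<lambda>i\<in>{..<n}. R i \<omega>) \<partial>M) * (\<integral>\<^sup>+\<omega>. f (R 0 \<omega>) \<partial>M)"
proof -
  let ?G = "\<lambda>\<omega>. g (\<lambda>i\<in>{..<n}. R i \<omega>)" and ?F = "\<lambda>\<omega>. f (R n \<omega>)"
  note i = past_indep[OF g f, unfolded indep_var_distribution_eq]
  have [measurable]: "?G \<in> borel_measurable M" "?F \<in> borel_measurable M"
    using i by auto
  interpret F: prob_space "distr M borel ?F"
    by (rule prob_space_distr) measurable
  have "(\<integral>\<^sup>+\<omega>. ?G \<omega> * ?F \<omega> \<partial>M) = (\<integral>\<^sup>+z. fst z * snd z \<partial>distr M (borel \<Otimes>\<^sub>M borel) (\<lambda>\<omega>. (?G \<omega>, ?F \<omega>)))"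
    by (subst nn_integral_distr) auto
  also have "\<dots> = (\<integral>\<^sup>+z. fst z * snd z \<partial>(distr M borel ?G \<Otimes>\<^sub>M distr M borel ?F))"
    using i by simp
  also have "\<dots> = (\<integral>\<^sup>+x. \<integral>\<^sup>+y. x * y \<partial>distr M borel ?F \<partial>distr M borel ?G)"
    by (subst F.nn_integral_fst[symmetric]) auto
  also have "\<dots> = (\<integral>\<^sup>+\<omega>. ?G \<omega> \<partial>M) * (\<integral>\<^sup>+\<omega>. ?F \<omega> \<partial>M)"
    by (simp add: nn_integral_cmult nn_integral_multc nn_integral_distr)
  finally show ?thesis
    unfolding nn_integral_ident[OF f, of n] .
qed

text \<open>The law of the whole sequence is a product measure, and prepending an independent
  coordinate reproduces it (\<open>S.PiM_iter\<close>). Hence, given the head, the tail may be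
  replaced by the whole sequence on an independent copy \<open>\<omega>'\<close> of the
  space.\<close>

lemma nn_integral_head_tail:
  assumes F [measurable]: "(\<lambda>(r, x). F r x) \<in> borel_measurable (borel \<Otimes>\<^sub>M (\<Pi>\<^sub>M i\<in>UNIV. borel))"
  shows "(\<integral>\<^sup>+\<omega>. F (R 0 \<omega>) (\<lambda>i. R (Suc i) \<omega>) \<partial>M) = (\<integral>\<^sup>+\<omega>. \<integral>\<^sup>+\<omega>'. F (R 0 \<omega>) (\<lambda>i. R i \<omega>') \<partial>M \<partial>M)"
proof -
  let ?D = "distr M borel (R 0)" and ?B = "\<Pi>\<^sub>M i\<in>(UNIV :: nat set). (borel :: real measure)"
  let ?S = "\<Pi>\<^sub>M i\<in>(UNIV :: nat set). ?D"
  interpret D: prob_space ?D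
    by (rule prob_space_distr) measurable
  interpret S: sequence_space ?D
    by unfold_locales
  have law: "distr M ?B (\<lambda>\<omega> i. R i \<omega>) = ?S"
  proof -
    have "(\<lambda>i. distr M borel (R i)) = (\<lambda>_. ?D)"
      by (rule ext) (rule ident)
    then show ?thesis
      using indep_vars_iff_distr_eq_PiM[where I=UNIV and M'="\<lambda>_. borel" and X=R] indep by (simp add: restrict_def)
  qed
  have [measurable_cong]: "sets ?S = sets ?B"
    by (intro sets_PiM_cong) auto
  have [measurable]: "(\<lambda>x. F (x 0) (\<lambda>i. x (Suc i))) \<in> borel_measurable ?B"
  proof -
    have "(\<lambda>x. (\<lambda>(r, x). F r x) (x 0, \<lambda>i. x (Suc i))) \<in> borel_measurable ?B"
      by (rule measurable_compose[OF _ F], rule measurable_Pair, measurable)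
         (rule measurable_PiM_single', auto simp: space_PiM)
    then show ?thesis by simp
  qed
  have "(\<integral>\<^sup>+\<omega>. F (R 0 \<omega>) (\<lambda>i. R (Suc i) \<omega>) \<partial>M) = (\<integral>\<^sup>+x. F (x 0) (\<lambda>i. x (Suc i)) \<partial>distr M ?B (\<lambda>\<omega> i. R i \<omega>))"
    by (subst nn_integral_distr) auto
  also have "\<dots> = (\<integral>\<^sup>+x. F (x 0) (\<lambda>i. x (Suc i)) \<partial>distr (?D \<Otimes>\<^sub>M ?S) ?S (\<lambda>(s, \<omega>). case_nat s \<omega>))"
    unfolding law S.PiM_iter ..
  also have "\<dots> = (\<integral>\<^sup>+z. F (fst z) (snd z) \<partial>(?D \<Otimes>\<^sub>M ?S))"
    by (subst nn_integral_distr) (auto simp: case_prod_beta')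
  also have "\<dots> = (\<integral>\<^sup>+r. \<integral>\<^sup>+x. F r x \<partial>?S \<partial>?D)"
    using F by (subst S.nn_integral_fst[symmetric]) (auto simp: case_prod_beta')
  also have "\<dots> = (\<integral>\<^sup>+r. \<integral>\<^sup>+\<omega>'. F r (\<lambda>i. R i \<omega>') \<partial>M \<partial>?D)"
    unfolding law[symmetric]
    by (intro nn_integral_cong, subst nn_integral_distr) auto
  also have "\<dots> = (\<integral>\<^sup>+\<omega>. \<integral>\<^sup>+\<omega>'. F (R 0 \<omega>) (\<lambda>i. R i \<omega>') \<partial>M \<partial>M)"
    by (subst nn_integral_distr) auto
  finally show ?thesis .
qed

lemma nn_integral_shift:
  assumes [measurable]: "h \<in> borel_measurable (\<Pi>\<^sub>M i\<in>UNIV. borel)"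
  shows "(\<integral>\<^sup>+\<omega>. h (\<lambda>i. R (Suc i) \<omega>) \<partial>M) = (\<integral>\<^sup>+\<omega>. h (\<lambda>i. R i \<omega>) \<partial>M)"
  using nn_integral_head_tail[of "\<lambda>_. h"] by (simp add: emeasure_space_1)

end

text \<open>A martingale transform: \<open>e k\<close> is determined by the variables before
  \<open>k\<close>, so in the square of \<open>Z (Suc n)\<close> the cross term has the centred
  factor \<open>f (R n)\<close> independent of the rest and vanishes, while \<open>e n\<close>
  equals its own square. Measurability of \<open>E k\<close> is asked for over every longer past,
  because \<open>Z n\<close> is treated as one function of the first \<open>n\<close> coordinates.
  With \<open>E\<close> constantly true this is the variance of a sum; with the event that level
  \<open>t\<close> is not yet passed it yields Wald's second identity.\<close>

lemma (in iid_sequence) second_moment_predictable_sum: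
  fixes f :: "real \<Rightarrow> real" and E :: "nat \<Rightarrow> (nat \<Rightarrow> real) \<Rightarrow> bool"
  assumes f [measurable]: "f \<in> borel_measurable borel"
    and f2: "integrable M (\<lambda>\<omega>. (f (R 0 \<omega>))\<^sup>2)" and f0: "expectation (\<lambda>\<omega>. f (R 0 \<omega>)) = 0"
    and E_pred: "\<And>k n. k \<le> n \<Longrightarrow> Measurable.pred (\<Pi>\<^sub>M i\<in>{..<n}. borel) (E k)"
    and E_past: "\<And>k x y. (\<And>i. i < k \<Longrightarrow> x i = y i) \<Longrightarrow> E k x = E k y"
  defines "e \<equiv> \<lambda>k \<omega>. of_bool (E k (\<lambda>i. R i \<omega>)) :: real"
  defines "Z \<equiv> \<lambda>n \<omega>. \<Sum>k<n. e k \<omega> * f (R k \<omega>)"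
  shows "integrable M (\<lambda>\<omega>. (Z n \<omega>)\<^sup>2)"
    and "expectation (\<lambda>\<omega>. (Z n \<omega>)\<^sup>2) = expectation (\<lambda>\<omega>. (f (R 0 \<omega>))\<^sup>2) * expectation (\<lambda>\<omega>. \<Sum>k<n. e k \<omega>)"
proof -
  have e_past: "of_bool (E k (\<lambda>i\<in>{..<n}. R i \<omega>)) = e k \<omega>" if "k \<le> n" for k n \<omega>
    unfolding e_def using that by (intro arg_cong[where f=of_bool] E_past) auto
  have em: "(\<lambda>x. of_bool (E k x) :: real) \<in> borel_measurable (\<Pi>\<^sub>M i\<in>{..<n}. borel)" if "k \<le> n" for k n
    using E_pred[OF that] by measurable
  have [measurable]: "e k \<in> borel_measurable M" for k
  proof -
    have "(\<lambda>\<omega>. of_bool (E k (\<lambda>i\<in>{..<k}. R i \<omega>)) :: real) \<in> borel_measurable M"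
      by (rule measurable_compose[OF _ em[OF order_refl]]) measurable
    then show ?thesis
      by (simp only: e_past[OF order_refl])
  qed
  have [measurable]: "Z k \<in> borel_measurable M" for k
    unfolding Z_def by measurable
  have e_int: "integrable M (e k)" for k
    by (rule integrable_const_bound[of _ 1], simp add: e_def, measurable)
  have "integrable M (\<lambda>\<omega>. (Z n \<omega>)\<^sup>2) \<and>
      expectation (\<lambda>\<omega>. (Z n \<omega>)\<^sup>2) = expectation (\<lambda>\<omega>. (f (R 0 \<omega>))\<^sup>2) * (\<Sum>k<n. expectation (e k))"
  proof (induction n)
    case (Suc n)
    then have Z2: "integrable M (\<lambda>\<omega>. (Z n \<omega>)\<^sup>2)" by simp
    have Z1: "integrable M (Z n)"
      by (rule square_integrable_imp_integrable[OF _ Z2]) measurable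
    have Ze: "integrable M (\<lambda>\<omega>. Z n \<omega> * e n \<omega>)"
      by (rule Bochner_Integration.integrable_bound[OF Z1], measurable, simp add: e_def)
    have i2: "integrable M (\<lambda>\<omega>. (f (R n \<omega>))\<^sup>2)"
      by (rule integrable_ident[of "\<lambda>x. (f x)\<^sup>2"]) (use f2 in auto)
    have i1: "integrable M (\<lambda>\<omega>. f (R n \<omega>))"
      by (rule square_integrable_imp_integrable[OF _ i2]) measurable
    have e1: "expectation (\<lambda>\<omega>. f (R n \<omega>)) = 0"
      using integral_ident[of f n] f0 by simp
    have e2: "expectation (\<lambda>\<omega>. (f (R n \<omega>))\<^sup>2) = expectation (\<lambda>\<omega>. (f (R 0 \<omega>))\<^sup>2)"
      by (rule integral_ident) measurable
    have Zm: "(\<lambda>x. \<Sum>k<n. of_bool (E k x) * f (x k)) \<in> borel_measurable (\<Pi>\<^sub>M i\<in>{..<n}. borel)"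
      by (intro borel_measurable_sum borel_measurable_times em
          measurable_compose[OF measurable_component_singleton, where L=borel and g=f] f) auto
    have Z_past: "(\<Sum>k<n. of_bool (E k (\<lambda>i\<in>{..<n}. R i \<omega>)) * f ((\<lambda>i\<in>{..<n}. R i \<omega>) k)) = Z n \<omega>" for \<omega>
      unfolding Z_def by (intro sum.cong refl arg_cong2[where f="(*)"] e_past) auto
    have ind1: "indep_var borel (\<lambda>\<omega>. Z n \<omega> * e n \<omega>) borel (\<lambda>\<omega>. f (R n \<omega>))"
      using past_indep[OF borel_measurable_times[OF Zm em[OF order_refl]] f]
      by (simp only: Z_past e_past[OF order_refl])
    have ind2: "indep_var borel (e n) borel (\<lambda>\<omega>. (f (R n \<omega>))\<^sup>2)"
      using past_indep[OF em[OF order_refl] borel_measurable_power[OF f], of n 2]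
      by (simp only: e_past[OF order_refl])
    note 1 = indep_var_integrable[OF ind1 Ze i1] indep_var_lebesgue_integral[OF ind1 Ze i1]
    note 2 = indep_var_integrable[OF ind2 e_int i2] indep_var_lebesgue_integral[OF ind2 e_int i2]
    have eq: "(Z (Suc n) \<omega>)\<^sup>2 = (Z n \<omega>)\<^sup>2 + 2 * (Z n \<omega> * e n \<omega> * f (R n \<omega>)) + e n \<omega> * (f (R n \<omega>))\<^sup>2" for \<omega>
    proof -
      have "e n \<omega> * e n \<omega> = e n \<omega>"
        by (simp add: e_def)
      moreover have "Z (Suc n) \<omega> = Z n \<omega> + e n \<omega> * f (R n \<omega>)"
        by (simp add: Z_def)
      ultimately show ?thesis
        by (simp add: power2_sum power_mult_distrib power2_eq_square[of "e n \<omega>"])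
    qed
    show ?case
      unfolding eq using Suc 1 2 e1 e2 by (simp add: distrib_left)
  qed (simp add: Z_def)
  then show "integrable M (\<lambda>\<omega>. (Z n \<omega>)\<^sup>2)"
    and "expectation (\<lambda>\<omega>. (Z n \<omega>)\<^sup>2) = expectation (\<lambda>\<omega>. (f (R 0 \<omega>))\<^sup>2) * expectation (\<lambda>\<omega>. \<Sum>k<n. e k \<omega>)"
    using e_int by simp_all
qed

text \<open>Truncation at a level \<open>K\<close>, as second moments need not exist.\<close>

lemma (in iid_sequence) weak_law_in_mean:
  assumes int: "integrable M (R 0)" and nonneg: "AE \<omega> in M. 0 \<le> R 0 \<omega>" and \<epsilon>: "0 < \<epsilon>"
  obtains c where "\<And>n. expectation (\<lambda>\<omega>. \<bar>(\<Sum>i<n. R i \<omega>) - n * expectation (R 0)\<bar>) \<le> \<epsilon> * n + c"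
proof -
  let ?V = "\<lambda>K x. x - min x K :: real"
  have "((\<lambda>K. expectation (\<lambda>\<omega>. ?V K (R 0 \<omega>))) \<longlongrightarrow> expectation (\<lambda>_. 0)) at_top"
  proof (rule integral_dominated_convergence_at_top[where w="\<lambda>\<omega>. \<bar>R 0 \<omega>\<bar>"])
    show "AE \<omega> in M. ((\<lambda>K. ?V K (R 0 \<omega>)) \<longlongrightarrow> 0) at_top"
    proof (intro AE_I2 tendsto_eventually)
      fix \<omega>
      show "\<forall>\<^sub>F K in at_top. ?V K (R 0 \<omega>) = 0"
        using eventually_ge_at_top[of "R 0 \<omega>"] by eventually_elim auto
    qed
    show "\<forall>\<^sub>F K in at_top. AE \<omega> in M. norm (?V K (R 0 \<omega>)) \<le> \<bar>R 0 \<omega>\<bar>"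
      using eventually_ge_at_top[of 0] by eventually_elim (use nonneg in \<open>auto elim!: eventually_mono\<close>)
  qed (use int in auto)
  \<comment> \<open>The excess over \<open>K\<close> is charged twice below, once for the sum and
    once for its mean, so a quarter of \<epsilon> each leaves half for the truncated part.\<close>
  then have "\<forall>\<^sub>F K in at_top. expectation (\<lambda>\<omega>. ?V K (R 0 \<omega>)) < \<epsilon> / 4 \<and> 0 \<le> K"
    using \<epsilon> by (intro eventually_conj eventually_ge_at_top order_tendstoD(2)) auto
  then obtain K where K: "expectation (\<lambda>\<omega>. ?V K (R 0 \<omega>)) < \<epsilon> / 4" "0 \<le> K"
    by (auto simp: eventually_at_top_linorder)
  define \<tau> where "\<tau> = expectation (\<lambda>\<omega>. min (R 0 \<omega>) K)"
  define v where "v = expectation (\<lambda>\<omega>. ?V K (R 0 \<omega>))"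
  \<comment> \<open>The weight in |z| \<le> \<alpha> z^2 + 1 / \<alpha>, by which the variance bound
    n K^2 controls the mean of |z|: small enough that \<alpha> K^2 is at most \<epsilon> / 2, while
    1 / \<alpha> does not depend on \<open>n\<close>. The added 1 covers
    \<open>K = 0\<close>.\<close>
  define \<alpha> where "\<alpha> = \<epsilon> / (2 * (K\<^sup>2 + 1))"
  have \<alpha>: "0 < \<alpha>" "\<alpha> * K\<^sup>2 \<le> \<epsilon> / 2"
  proof -
    have K1: "0 < K\<^sup>2 + 1"
      by (intro add_nonneg_pos) auto
    then show "0 < \<alpha>"
      using \<epsilon> by (simp add: \<alpha>_def)
    then have "\<alpha> * K\<^sup>2 \<le> \<alpha> * (K\<^sup>2 + 1)"
      by (intro mult_left_mono) auto
    also have "\<dots> = \<epsilon> / 2"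
    proof -
      have "x / (2 * q) * q = x / 2" if "0 < q" for x q :: real
        using that by simp
      then show ?thesis
        using K1 unfolding \<alpha>_def .
    qed
    finally show "\<alpha> * K\<^sup>2 \<le> \<epsilon> / 2" .
  qed
  have T_bound: "AE \<omega> in M. \<bar>min (R 0 \<omega>) K\<bar> \<le> K"
    using nonneg K(2) by (auto elim!: eventually_mono)
  have iT: "integrable M (\<lambda>\<omega>. min (R 0 \<omega>) K)"
    by (rule integrable_const_bound[where B=K]) (use T_bound in auto)
  have iV: "integrable M (\<lambda>\<omega>. ?V K (R 0 \<omega>))"
    using int iT by simp
  have iV': "integrable M (\<lambda>\<omega>. ?V K (R i \<omega>))" for i
    by (rule integrable_ident[of "?V K"]) (use iV in auto)
  have eV': "expectation (\<lambda>\<omega>. ?V K (R i \<omega>)) = v" for i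
    unfolding v_def by (rule integral_ident) measurable
  have iT2: "integrable M (\<lambda>\<omega>. (min (R 0 \<omega>) K)\<^sup>2)"
    by (rule integrable_const_bound[where B="K\<^sup>2"]) (use T_bound in \<open>auto elim!: eventually_mono simp: power2_le_iff_abs_le K(2)\<close>)
  have mean: "expectation (R 0) = \<tau> + v"
    unfolding \<tau>_def v_def using iT int by simp
  let ?f = "\<lambda>x. min x K - \<tau>"
  have f2: "integrable M (\<lambda>\<omega>. (?f (R 0 \<omega>))\<^sup>2)"
    using iT iT2 by (simp add: power2_diff)
  have f0: "expectation (\<lambda>\<omega>. ?f (R 0 \<omega>)) = 0"
    using iT by (simp add: \<tau>_def prob_space)
  have "expectation (\<lambda>\<omega>. (?f (R 0 \<omega>))\<^sup>2) = expectation (\<lambda>\<omega>. (min (R 0 \<omega>) K)\<^sup>2) - \<tau>\<^sup>2"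
    using variance_eq[OF iT iT2] by (simp add: \<tau>_def)
  also have "\<dots> \<le> expectation (\<lambda>\<omega>. (min (R 0 \<omega>) K)\<^sup>2)"
    by simp
  also have "\<dots> \<le> K\<^sup>2"
    using iT2 by (rule integral_le_const) (use T_bound in \<open>auto elim!: eventually_mono simp: power2_le_iff_abs_le K(2)\<close>)
  finally have var: "expectation (\<lambda>\<omega>. (?f (R 0 \<omega>))\<^sup>2) \<le> K\<^sup>2" .
  have "?f \<in> borel_measurable borel"
    by measurable
  note Z = second_moment_predictable_sum[where E="\<lambda>_ _. True", OF this f2 f0, simplified]
  show thesis
  proof (rule that)
    fix n
    let ?Z = "\<lambda>\<omega>. \<Sum>i<n. ?f (R i \<omega>)"
    have "expectation (\<lambda>\<omega>. \<bar>(\<Sum>i<n. R i \<omega>) - n * expectation (R 0)\<bar>) \<le>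
        expectation (\<lambda>\<omega>. \<alpha> * (?Z \<omega>)\<^sup>2 + 1 / \<alpha> + (\<Sum>i<n. ?V K (R i \<omega>)) + n * v)"
    proof (rule integral_mono)
      show "integrable M (\<lambda>\<omega>. \<bar>(\<Sum>i<n. R i \<omega>) - n * expectation (R 0)\<bar>)"
        using integrable_ident[of "\<lambda>x. x"] int by (intro integrable_abs Bochner_Integration.integrable_diff Bochner_Integration.integrable_sum) auto
      show "integrable M (\<lambda>\<omega>. \<alpha> * (?Z \<omega>)\<^sup>2 + 1 / \<alpha> + (\<Sum>i<n. ?V K (R i \<omega>)) + n * v)"
        by (intro Bochner_Integration.integrable_add integrable_const integrable_mult_right
              Bochner_Integration.integrable_sum iV' Z) measurable
      fix \<omega>
      have "(\<Sum>i<n. R i \<omega>) - n * expectation (R 0) = ?Z \<omega> + (\<Sum>i<n. ?V K (R i \<omega>)) - n * v"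
        unfolding mean by (simp add: sum_subtractf algebra_simps)
      moreover have "\<bar>z\<bar> \<le> \<alpha> * z\<^sup>2 + 1 / \<alpha>" for z
      proof -
        have "2 * (\<alpha> * \<bar>z\<bar>) \<le> (\<alpha> * \<bar>z\<bar>)\<^sup>2 + 1"
          using sum_squares_bound[of "\<alpha> * \<bar>z\<bar>" 1] by simp
        moreover have "0 \<le> \<alpha> * \<bar>z\<bar>"
          using \<alpha> by simp
        ultimately have "\<alpha> * \<bar>z\<bar> \<le> (\<alpha> * \<bar>z\<bar>)\<^sup>2 + 1"
          by linarith
        then have "\<alpha> * \<bar>z\<bar> / \<alpha> \<le> ((\<alpha> * \<bar>z\<bar>)\<^sup>2 + 1) / \<alpha>"
          using \<alpha> by (intro divide_right_mono) auto
        then show ?thesis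
          using \<alpha> by (simp add: power_mult_distrib add_divide_distrib power2_eq_square[of \<alpha>])
      qed
      moreover have "0 \<le> (\<Sum>i<n. ?V K (R i \<omega>))"
        by (intro sum_nonneg) auto
      moreover have "0 \<le> n * v"
        unfolding v_def by (intro mult_nonneg_nonneg integral_nonneg_AE) auto
      ultimately show "\<bar>(\<Sum>i<n. R i \<omega>) - n * expectation (R 0)\<bar> \<le>
          \<alpha> * (?Z \<omega>)\<^sup>2 + 1 / \<alpha> + (\<Sum>i<n. ?V K (R i \<omega>)) + n * v"
        by (smt (verit))
    qed
    also have "\<dots> = \<alpha> * expectation (\<lambda>\<omega>. (?Z \<omega>)\<^sup>2) + 1 / \<alpha> + expectation (\<lambda>\<omega>. \<Sum>i<n. ?V K (R i \<omega>)) + n * v"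
    proof -
      have "integrable M (\<lambda>\<omega>. (?Z \<omega>)\<^sup>2)"
        by (rule Z) measurable
      moreover have "integrable M (\<lambda>\<omega>. \<Sum>i<n. ?V K (R i \<omega>))"
        by (intro Bochner_Integration.integrable_sum iV')
      ultimately show ?thesis
        by (simp add: prob_space)
    qed
    also have "expectation (\<lambda>\<omega>. \<Sum>i<n. ?V K (R i \<omega>)) = n * v"
      by (subst Bochner_Integration.integral_sum[OF iV']) (simp add: eV')
    also have "expectation (\<lambda>\<omega>. (?Z \<omega>)\<^sup>2) = n * expectation (\<lambda>\<omega>. (?f (R 0 \<omega>))\<^sup>2)"
      by (simp add: Z(2) prob_space)
    also have "\<alpha> * (n * expectation (\<lambda>\<omega>. (?f (R 0 \<omega>))\<^sup>2)) \<le> \<alpha> * (n * K\<^sup>2)"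
      using \<alpha> var by (intro mult_left_mono) auto
    also have "\<dots> = n * (\<alpha> * K\<^sup>2)"
      by simp
    also have "\<dots> \<le> n * (\<epsilon> / 2)"
      using \<alpha> by (intro mult_left_mono) auto
    also have "n * (\<epsilon> / 2) + 1 / \<alpha> + n * v + n * v \<le> n * (\<epsilon> / 2) + 1 / \<alpha> + n * (\<epsilon> / 4) + n * (\<epsilon> / 4)"
      using K by (intro add_mono mult_left_mono) (auto simp: v_def)
    also have "\<dots> = \<epsilon> * n + 1 / \<alpha>"
      by (simp add: field_simps)
    finally show "expectation (\<lambda>\<omega>. \<bar>(\<Sum>i<n. R i \<omega>) - n * expectation (R 0)\<bar>) \<le> \<epsilon> * n + 1 / \<alpha>"
      by simp
  qed
qed

section \<open>Renewal sequences\<close>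

text \<open>The renewal at time 0 is counted too, so on good paths this is the first index whose
  partial sum exceeds \<open>t\<close>, the stopping index for Wald's identities. If infinitely many
  partial sums stay below \<open>t\<close>, \<open>card\<close> gives 0; this happens only on a null
  set in the renewal setting.\<close>

definition passages :: "(nat \<Rightarrow> real) \<Rightarrow> real \<Rightarrow> nat" where
  "passages x t = card {l. (\<Sum>j<l. x j) \<le> t}"

lemma passages_measurable [measurable]:
  assumes [measurable]: "\<And>i. (\<lambda>z. x z i) \<in> borel_measurable N" "t \<in> borel_measurable N"
  shows "(\<lambda>z. passages (x z) (t z)) \<in> measurable N (count_space UNIV)"
  unfolding passages_def by measurable

locale renewal_sequence = iid_sequence +
  assumes nonneg: "AE \<omega> in M. 0 \<le> R 0 \<omega>"
    and square_integrable: "integrable M (\<lambda>\<omega>. (R 0 \<omega>)\<^sup>2)"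
    and mean_pos: "0 < expectation (R 0)"
begin

definition \<mu> :: real where "\<mu> = expectation (R 0)"
definition S :: "nat \<Rightarrow> 'a \<Rightarrow> real" where "S n \<omega> = (\<Sum>j<n. R j \<omega>)"
definition \<nu> :: "real \<Rightarrow> 'a \<Rightarrow> nat" where "\<nu> t \<omega> = passages (\<lambda>i. R i \<omega>) t"
text \<open>The Laplace transform of the gap at 1, used as the ratio of a geometric bound.\<close>

definition \<rho> :: real where "\<rho> = expectation (\<lambda>\<omega>. exp (- R 0 \<omega>))"

lemma \<mu>_pos: "0 < \<mu>"
  using mean_pos by (simp add: \<mu>_def)

lemma integrable_R: "integrable M (R j)"
proof -
  have "integrable M (R 0)"
    by (rule square_integrable_imp_integrable[OF R_measurable square_integrable])
  then show ?thesis
    using integrable_ident[of "\<lambda>x. x" j] by simp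
qed

lemma integrable_R2: "integrable M (\<lambda>\<omega>. (R j \<omega>)\<^sup>2)"
  using integrable_ident[of "\<lambda>x. x\<^sup>2" j] square_integrable by simp

lemma S_measurable [measurable]: "S n \<in> borel_measurable M"
  unfolding S_def by measurable

lemma \<nu>_measurable [measurable]: "\<nu> t \<in> measurable M (count_space UNIV)"
  unfolding \<nu>_def by measurable

lemma AE_nonneg: "AE \<omega> in M. \<forall>j. 0 \<le> R j \<omega>"
  unfolding AE_all_countable using AE_ident[OF nonneg] by auto

section \<open>Geometric tail bounds for the partial sums\<close>

lemma \<rho>_nonneg: "0 \<le> \<rho>"
  unfolding \<rho>_def by (intro integral_nonneg_AE) auto

lemma integrable_exp: "integrable M (\<lambda>\<omega>. exp (- R j \<omega>))"
  by (rule integrable_const_bound[of _ 1]) (use AE_nonneg in auto)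

lemma \<rho>_less_1: "\<rho> < 1"
proof -
  have "\<rho> \<le> 1"
    unfolding \<rho>_def using AE_nonneg integrable_exp
    by (intro integral_le_const) auto
  moreover have "\<rho> \<noteq> 1"
  proof
    assume "\<rho> = 1"
    then have "(\<integral>\<omega>. 1 - exp (- R 0 \<omega>) \<partial>M) = 0"
      by (simp add: \<rho>_def integrable_exp prob_space)
    then have "AE \<omega> in M. 1 - exp (- R 0 \<omega>) = 0"
      using AE_nonneg integrable_exp by (subst (asm) integral_nonneg_eq_0_iff_AE) auto
    then have "AE \<omega> in M. R 0 \<omega> = 0"
      by eventually_elim simp
    then have "expectation (R 0) = expectation (\<lambda>_. 0)"
      by (intro integral_cong_AE) auto
    then show False
      using mean_pos by simp
  qed
  ultimately show ?thesis
    by simp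
qed

text \<open>Exponential Markov inequality: the indicator of S_n \<le> t is at most exp (t - S_n),
  and by independence exp (- S_n) has mean \<rho>^n.\<close>

lemma prob_S_le: "prob {\<omega> \<in> space M. S n \<omega> \<le> t} \<le> exp t * \<rho> ^ n"
proof -
  have i: "indep_vars (\<lambda>_. borel) (\<lambda>i \<omega>. exp (- R i \<omega>)) {..<n}"
    by (rule indep_vars_compose2[OF indep_vars_subset[OF indep]]) auto
  have e: "expectation (\<lambda>\<omega>. exp (- R j \<omega>)) = \<rho>" for j
    using integral_ident[of "\<lambda>x. exp (- x)"] by (simp add: \<rho>_def)
  have "expectation (\<lambda>\<omega>. \<Prod>i<n. exp (- R i \<omega>)) = \<rho> ^ n"
    by (subst indep_vars_lebesgue_integral[OF _ i]) (auto simp: e integrable_exp)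
  moreover have int: "integrable M (\<lambda>\<omega>. \<Prod>i<n. exp (- R i \<omega>))"
    by (rule indep_vars_integrable[OF _ i]) (auto simp: integrable_exp)
  moreover have "(\<Prod>i<n. exp (- R i \<omega>)) = exp (- S n \<omega>)" for \<omega>
    by (simp add: S_def exp_sum[symmetric] sum_negf)
  ultimately have *: "expectation (\<lambda>\<omega>. exp (- S n \<omega>)) = \<rho> ^ n" "integrable M (\<lambda>\<omega>. exp (- S n \<omega>))"
    by simp_all
  have "prob {\<omega> \<in> space M. S n \<omega> \<le> t} = expectation (indicator {\<omega> \<in> space M. S n \<omega> \<le> t})"
    by simp
  also have "\<dots> \<le> expectation (\<lambda>\<omega>. exp t * exp (- S n \<omega>))"
  proof (rule integral_mono)
    show "integrable M (\<lambda>\<omega>. exp t * exp (- S n \<omega>))"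
      using * by simp
    show "indicator {\<omega> \<in> space M. S n \<omega> \<le> t} \<omega> \<le> exp t * exp (- S n \<omega>)" for \<omega>
      by (auto simp: indicator_def exp_add[symmetric])
  qed (simp add: less_top[symmetric])
  also have "\<dots> = exp t * \<rho> ^ n"
    using * by simp
  finally show ?thesis .
qed

text \<open>The almost sure event on which partial sums are nondecreasing and \<open>card\<close>
  counts honestly; the pathwise counting arguments take place on it.\<close>

definition regular :: "'a \<Rightarrow> bool" where
  "regular \<omega> \<longleftrightarrow> (\<forall>j. 0 \<le> R j \<omega>) \<and> (\<forall>t. finite {l. S l \<omega> \<le> t})"

lemma emeasure_S_le: "emeasure M {\<omega> \<in> space M. S n \<omega> \<le> t} \<le> ennreal (exp t * \<rho> ^ n)"
  using prob_S_le[of n t] by (simp add: emeasure_eq_measure ennreal_leI)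

text \<open>Borel-Cantelli with the geometric tails. Integer levels suffice for a countable union of
  null sets, and other levels follow by monotonicity.\<close>

lemma AE_regular: "AE \<omega> in M. regular \<omega>"
proof -
  have "AE \<omega> in M. finite {l. S l \<omega> \<le> real t}" for t
  proof -
    have "summable (\<lambda>n. exp (real t) * \<rho> ^ n)"
      using \<rho>_nonneg \<rho>_less_1 by (intro summable_mult summable_geometric) auto
    then have "summable (\<lambda>n. prob {\<omega> \<in> space M. S n \<omega> \<le> real t})"
      by (rule summable_comparison_test'[where N=0]) (use prob_S_le in auto)
    then have "AE \<omega> in M. \<forall>\<^sub>F n in sequentially. \<omega> \<in> space M - {\<omega> \<in> space M. S n \<omega> \<le> real t}"
      by (intro borel_cantelli_AE1) (auto simp: emeasure_eq_measure)
    then show ?thesis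
    proof eventually_elim
      case (elim \<omega>)
      then obtain N where "\<And>n. N \<le> n \<Longrightarrow> \<not> S n \<omega> \<le> real t"
        by (auto simp: eventually_sequentially)
      then have "{l. S l \<omega> \<le> real t} \<subseteq> {..<N}"
        by (auto simp: not_less[symmetric])
      then show ?case
        by (rule finite_subset) simp
    qed
  qed
  then have "AE \<omega> in M. \<forall>t::nat. finite {l. S l \<omega> \<le> real t}"
    unfolding AE_all_countable by blast
  then show ?thesis
    using AE_nonneg
  proof eventually_elim
    case (elim \<omega>)
    have "finite {l. S l \<omega> \<le> t}" for t
    proof (rule finite_subset)
      show "{l. S l \<omega> \<le> t} \<subseteq> {l. S l \<omega> \<le> real (nat \<lceil>t\<rceil>)}"
        using real_nat_ceiling_ge[of t] by (auto intro: order_trans)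
    qed (use elim in auto)
    then show ?case
      using elim by (simp add: regular_def)
  qed
qed

text \<open>The indices with partial sum at most \<open>t\<close> form a finite initial segment, so
  its cardinality is its least upper index. This makes \<open>\<nu> t\<close> a stopping index:
  whether \<open>l\<close> lies below it is decided by the first \<open>l\<close> gaps.\<close>

lemma regular_less_\<nu>:
  assumes "regular \<omega>"
  shows "l < \<nu> t \<omega> \<longleftrightarrow> S l \<omega> \<le> t"
proof -
  let ?A = "{l. S l \<omega> \<le> t}"
  have mono: "S k \<omega> \<le> S l \<omega>" if "k \<le> l" for k l
    using assms that unfolding S_def regular_def by (intro sum_mono2) auto
  have fin: "finite ?A"
    using assms by (simp add: regular_def)
  have "\<exists>n. ?A = {..<n}"
  proof (cases "?A = {}")
    case False
    have "?A = {..<Suc (Max ?A)}"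
    proof
      show "?A \<subseteq> {..<Suc (Max ?A)}"
        using fin by (auto simp: less_Suc_eq_le)
      show "{..<Suc (Max ?A)} \<subseteq> ?A"
        using Max_in[OF fin False] mono by (fastforce simp: less_Suc_eq_le)
    qed
    then show ?thesis by blast
  qed auto
  then obtain n where n: "?A = {..<n}" by blast
  then have "\<nu> t \<omega> = n"
    by (simp add: \<nu>_def passages_def S_def)
  then show ?thesis
    using n by auto
qed

lemma suminf_passages:
  fixes f :: "nat \<Rightarrow> ennreal"
  assumes "regular \<omega>"
  shows "(\<Sum>i. indicator {\<omega>. S i \<omega> \<le> t} \<omega> * f i) = (\<Sum>i<\<nu> t \<omega>. f i)"
  using assms by (subst suminf_finite[of "{..<\<nu> t \<omega>}"]) (auto simp: regular_less_\<nu> indicator_def)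

section \<open>Wald's first identity and the moments of the renewal count\<close>

lemma S_past: "{x \<in> space (\<Pi>\<^sub>M i\<in>{..<n}. borel). (\<Sum>j<n. x j) \<le> (t::real)} \<in> sets (\<Pi>\<^sub>M i\<in>{..<n}. borel)"
  by measurable

text \<open>The random sum becomes a series with factors
  \<open>indicator {\<omega>. S i \<omega> \<le> t}\<close>, each depending on the gaps before
  \<open>i\<close> and hence independent of \<open>R i\<close>. The remaining series of
  probabilities is recognised as the mean of \<open>\<nu> t\<close> by taking \<open>f = 1\<close>.
  In \<open>ennreal\<close> no integrability enters.\<close>

lemma wald:
  assumes [measurable]: "f \<in> borel_measurable borel"
  shows "(\<integral>\<^sup>+\<omega>. (\<Sum>i<\<nu> t \<omega>. f (R i \<omega>)) \<partial>M) = (\<integral>\<^sup>+\<omega>. ennreal (\<nu> t \<omega>) \<partial>M) * (\<integral>\<^sup>+\<omega>. f (R 0 \<omega>) \<partial>M)"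
proof -
  have *: "(\<integral>\<^sup>+\<omega>. (\<Sum>i<\<nu> t \<omega>. f (R i \<omega>)) \<partial>M) =
      (\<Sum>i. \<integral>\<^sup>+\<omega>. indicator {\<omega>. S i \<omega> \<le> t} \<omega> \<partial>M) * (\<integral>\<^sup>+\<omega>. f (R 0 \<omega>) \<partial>M)"
    if [measurable]: "f \<in> borel_measurable borel" for f
  proof -
    have "(\<integral>\<^sup>+\<omega>. (\<Sum>i<\<nu> t \<omega>. f (R i \<omega>)) \<partial>M) =
        (\<integral>\<^sup>+\<omega>. (\<Sum>i. indicator {\<omega>. S i \<omega> \<le> t} \<omega> * f (R i \<omega>)) \<partial>M)"
      by (intro nn_integral_cong_AE, use AE_regular in eventually_elim) (simp add: suminf_passages)
    also have "\<dots> = (\<Sum>i. \<integral>\<^sup>+\<omega>. indicator {\<omega>. S i \<omega> \<le> t} \<omega> * f (R i \<omega>) \<partial>M)"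
      by (rule nn_integral_suminf) measurable
    also have "\<dots> = (\<Sum>i. (\<integral>\<^sup>+\<omega>. indicator {\<omega>. S i \<omega> \<le> t} \<omega> \<partial>M) * (\<integral>\<^sup>+\<omega>. f (R 0 \<omega>) \<partial>M))"
    proof (intro suminf_cong)
      fix i
      show "(\<integral>\<^sup>+\<omega>. indicator {\<omega>. S i \<omega> \<le> t} \<omega> * f (R i \<omega>) \<partial>M) =
          (\<integral>\<^sup>+\<omega>. indicator {\<omega>. S i \<omega> \<le> t} \<omega> \<partial>M) * (\<integral>\<^sup>+\<omega>. f (R 0 \<omega>) \<partial>M)"
        using nn_integral_past[of "\<lambda>x. indicator {x. (\<Sum>j<i. x j) \<le> t} x" i f] S_past[of i t]
        by (simp add: S_def indicator_def)
    qed
    finally show ?thesis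
      by simp
  qed
  have "(\<integral>\<^sup>+\<omega>. ennreal (\<nu> t \<omega>) \<partial>M) = (\<Sum>i. \<integral>\<^sup>+\<omega>. indicator {\<omega>. S i \<omega> \<le> t} \<omega> \<partial>M)"
    using *[of "\<lambda>_. 1"] by (simp add: emeasure_space_1 ennreal_of_nat_eq_real_of_nat)
  then show ?thesis
    by (simp add: *)
qed

text \<open>A square n^2 is the sum of the odd numbers 2 i + 1 for i < n, so the second moment is a
  series of linear weights against geometrically small probabilities.\<close>

lemma integrable_\<nu>2: "integrable M (\<lambda>\<omega>. (real (\<nu> t \<omega>))\<^sup>2)"
proof (rule integrableI_bounded)
  have sq: "(real n)\<^sup>2 = (\<Sum>i<n. 2 * real i + 1)" for n
    by (induction n) (auto simp: power2_eq_square algebra_simps)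
  have "(\<integral>\<^sup>+\<omega>. ennreal ((real (\<nu> t \<omega>))\<^sup>2) \<partial>M) =
      (\<integral>\<^sup>+\<omega>. (\<Sum>i. indicator {\<omega>. S i \<omega> \<le> t} \<omega> * ennreal (2 * real i + 1)) \<partial>M)"
    by (intro nn_integral_cong_AE, use AE_regular in eventually_elim) (simp add: suminf_passages sq sum_ennreal del: ennreal_plus)
  also have "\<dots> = (\<Sum>i. \<integral>\<^sup>+\<omega>. indicator {\<omega> \<in> space M. S i \<omega> \<le> t} \<omega> * ennreal (2 * real i + 1) \<partial>M)"
    by (subst nn_integral_suminf) (auto intro!: suminf_cong nn_integral_cong simp: indicator_def)
  also have "\<dots> = (\<Sum>i. emeasure M {\<omega> \<in> space M. S i \<omega> \<le> t} * ennreal (2 * real i + 1))"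
    by (simp add: nn_integral_multc)
  also have "\<dots> \<le> (\<Sum>i. ennreal (exp t * \<rho> ^ i) * ennreal (2 * real (Suc i)))"
    by (intro suminf_le mult_mono emeasure_S_le ennreal_leI) auto
  also have "\<dots> = (\<Sum>i. ennreal (2 * exp t * (real (Suc i) * \<rho> ^ i)))"
    using \<rho>_nonneg
    by (intro suminf_cong, subst ennreal_mult[symmetric]) (auto simp: algebra_simps simp del: ennreal_plus)
  also have "\<dots> = ennreal (\<Sum>i. 2 * exp t * (real (Suc i) * \<rho> ^ i))"
    using geometric_deriv_sums[of \<rho>] \<rho>_nonneg \<rho>_less_1
    by (intro suminf_ennreal2 summable_mult) (auto simp: sums_iff simp del: of_nat_Suc)
  also have "\<dots> < \<infinity>"
    by simp
  finally show "(\<integral>\<^sup>+\<omega>. ennreal (norm ((real (\<nu> t \<omega>))\<^sup>2)) \<partial>M) < \<infinity>"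
    by simp
qed measurable

lemma integrable_\<nu>: "integrable M (\<lambda>\<omega>. real (\<nu> t \<omega>))"
  using integrable_\<nu>2 by (rule square_integrable_imp_integrable[rotated]) measurable

definition U :: "real \<Rightarrow> real" where "U t = expectation (\<lambda>\<omega>. real (\<nu> t \<omega>))"

lemma wald_real:
  fixes f :: "real \<Rightarrow> real"
  assumes [measurable]: "f \<in> borel_measurable borel" and f: "\<And>x. 0 \<le> x \<Longrightarrow> 0 \<le> f x"
    and int: "integrable M (\<lambda>\<omega>. f (R 0 \<omega>))"
  shows "integrable M (\<lambda>\<omega>. \<Sum>i<\<nu> t \<omega>. f (R i \<omega>))" (is ?int)
    and "expectation (\<lambda>\<omega>. \<Sum>i<\<nu> t \<omega>. f (R i \<omega>)) = U t * expectation (\<lambda>\<omega>. f (R 0 \<omega>))" (is ?eq)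
proof -
  have meas [measurable]: "(\<lambda>\<omega>. \<Sum>i<\<nu> t \<omega>. f (R i \<omega>)) \<in> borel_measurable M"
    by (rule measurable_compose_countable[where f="\<lambda>n \<omega>. \<Sum>i<n. f (R i \<omega>)"]) auto
  have nn: "AE \<omega> in M. 0 \<le> (\<Sum>i<\<nu> t \<omega>. f (R i \<omega>))" "AE \<omega> in M. 0 \<le> f (R 0 \<omega>)"
    using AE_nonneg by (eventually_elim, auto intro!: sum_nonneg f)+
  have U: "(\<integral>\<^sup>+\<omega>. ennreal (\<nu> t \<omega>) \<partial>M) = ennreal (U t)"
    unfolding U_def by (intro nn_integral_eq_integral integrable_\<nu>) auto
  have "(\<integral>\<^sup>+\<omega>. ennreal (\<Sum>i<\<nu> t \<omega>. f (R i \<omega>)) \<partial>M) = (\<integral>\<^sup>+\<omega>. (\<Sum>i<\<nu> t \<omega>. ennreal (f (R i \<omega>))) \<partial>M)"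
    by (intro nn_integral_cong_AE, use AE_nonneg in eventually_elim) (simp add: f)
  also have "\<dots> = ennreal (U t) * (\<integral>\<^sup>+\<omega>. ennreal (f (R 0 \<omega>)) \<partial>M)"
    unfolding U[symmetric] by (rule wald) measurable
  also have "(\<integral>\<^sup>+\<omega>. ennreal (f (R 0 \<omega>)) \<partial>M) = ennreal (expectation (\<lambda>\<omega>. f (R 0 \<omega>)))"
    using int nn by (intro nn_integral_eq_integral) auto
  finally have *: "(\<integral>\<^sup>+\<omega>. ennreal (\<Sum>i<\<nu> t \<omega>. f (R i \<omega>)) \<partial>M) = ennreal (U t * expectation (\<lambda>\<omega>. f (R 0 \<omega>)))"
    using nn by (simp add: ennreal_mult U_def integral_nonneg_AE)
  show ?int
    using * nn by (intro integrableI_nonneg) auto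
  show ?eq
    using * nn by (subst integral_eq_nn_integral) (auto simp: U_def integral_nonneg_AE)
qed

end

context renewal_sequence
begin

section \<open>Overshoot over a level and Wald's second identity\<close>

definition \<sigma>2 :: real where "\<sigma>2 = expectation (\<lambda>\<omega>. (R 0 \<omega> - \<mu>)\<^sup>2)"
definition overshoot :: "real \<Rightarrow> 'a \<Rightarrow> real" where "overshoot t \<omega> = (\<Sum>i<\<nu> t \<omega>. R i \<omega>) - t"
abbreviation mean_overshoot2 :: "real \<Rightarrow> real" where "mean_overshoot2 t \<equiv> expectation (\<lambda>\<omega>. (overshoot t \<omega>)\<^sup>2)"
definition stopped_sum :: "real \<Rightarrow> 'a \<Rightarrow> real" where "stopped_sum t \<omega> = (\<Sum>i<\<nu> t \<omega>. R i \<omega> - \<mu>)"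

lemma overshoot_measurable [measurable]: "overshoot t \<in> borel_measurable M"
  unfolding overshoot_def
  by (rule measurable_compose_countable[where f="\<lambda>n \<omega>. (\<Sum>i<n. R i \<omega>) - t"]) auto

lemma stopped_sum_measurable [measurable]: "stopped_sum t \<in> borel_measurable M"
  unfolding stopped_sum_def
  by (rule measurable_compose_countable[where f="\<lambda>n \<omega>. \<Sum>i<n. R i \<omega> - \<mu>"]) auto

text \<open>The sum of the gaps up to first passage is both \<open>t + overshoot t \<omega>\<close>
  and \<open>\<mu> * \<nu> t \<omega> + stopped_sum t \<omega>\<close>. The stopped martingale
  carries the variance, and the overshoot is the error to be shown negligible.\<close>

lemma passages_deviation_eq: "real (\<nu> t \<omega>) - t / \<mu> = (overshoot t \<omega> - stopped_sum t \<omega>) / \<mu>"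
  using \<mu>_pos by (simp add: overshoot_def stopped_sum_def sum_subtractf field_simps)

text \<open>Before the last gap the level is not yet exceeded, so the overshoot is at most that gap;
  \<open>0 \<le> t\<close> guarantees that there is a last gap.\<close>

lemma overshoot_bounds:
  assumes "regular \<omega>" "0 \<le> t"
  shows "0 \<le> overshoot t \<omega>" "\<exists>i<\<nu> t \<omega>. overshoot t \<omega> \<le> R i \<omega>"
proof -
  have S: "(\<Sum>i<n. R i \<omega>) = S n \<omega>" for n
    by (simp add: S_def)
  have "\<not> S (\<nu> t \<omega>) \<omega> \<le> t"
    using regular_less_\<nu>[OF assms(1), of "\<nu> t \<omega>" t] by simp
  then show "0 \<le> overshoot t \<omega>"
    by (simp add: overshoot_def S)
  have "0 < \<nu> t \<omega>"
    using regular_less_\<nu>[OF assms(1), of 0 t] assms(2) by (simp add: S_def)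
  then obtain n where n: "\<nu> t \<omega> = Suc n"
    by (cases "\<nu> t \<omega>") auto
  then have "S n \<omega> \<le> t"
    using regular_less_\<nu>[OF assms(1), of n t] by simp
  then have "overshoot t \<omega> \<le> R n \<omega>"
    by (simp add: overshoot_def n S[symmetric])
  then show "\<exists>i<\<nu> t \<omega>. overshoot t \<omega> \<le> R i \<omega>"
    using n by auto
qed

text \<open>The crossing gap has a random index and a biased law. Either it is at most
  \<open>K\<close>, or it is one of the gaps above \<open>K\<close> up to first passage; bounding it
  by the sum of all of these brings it within reach of Wald's identity, at the price of a factor
  \<open>U t\<close> on a small tail moment.\<close>

lemma overshoot_le:
  assumes "regular \<omega>" "0 \<le> t" "0 \<le> K"
  shows "overshoot t \<omega> \<le> K + (\<Sum>i<\<nu> t \<omega>. R i \<omega> * indicator {K<..} (R i \<omega>))"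
    and "(overshoot t \<omega>)\<^sup>2 \<le> K\<^sup>2 + (\<Sum>i<\<nu> t \<omega>. (R i \<omega>)\<^sup>2 * indicator {K<..} (R i \<omega>))"
proof -
  obtain i where i: "i < \<nu> t \<omega>" "overshoot t \<omega> \<le> R i \<omega>"
    using overshoot_bounds[OF assms(1,2)] by auto
  have nn: "0 \<le> R j \<omega>" for j
    using assms by (simp add: regular_def)
  have b: "f (R i \<omega>) * indicator {K<..} (R i \<omega>) \<le> (\<Sum>i<\<nu> t \<omega>. f (R i \<omega>) * indicator {K<..} (R i \<omega>))"
    if "\<And>x. 0 \<le> x \<Longrightarrow> 0 \<le> f x" for f :: "real \<Rightarrow> real"
    using i by (intro member_le_sum) (auto simp: that nn)
  have "overshoot t \<omega> \<le> K + R i \<omega> * indicator {K<..} (R i \<omega>)"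
    using i assms by (auto simp: indicator_def)
  then show "overshoot t \<omega> \<le> K + (\<Sum>i<\<nu> t \<omega>. R i \<omega> * indicator {K<..} (R i \<omega>))"
    using b[of "\<lambda>x. x"] by simp
  have "(overshoot t \<omega>)\<^sup>2 \<le> (R i \<omega>)\<^sup>2"
    using i overshoot_bounds(1)[OF assms(1,2)] by (intro power_mono)
  also have "\<dots> \<le> K\<^sup>2 + (R i \<omega>)\<^sup>2 * indicator {K<..} (R i \<omega>)"
    using nn[of i] by (auto simp: indicator_def intro!: power_mono)
  finally show "(overshoot t \<omega>)\<^sup>2 \<le> K\<^sup>2 + (\<Sum>i<\<nu> t \<omega>. (R i \<omega>)\<^sup>2 * indicator {K<..} (R i \<omega>))"
    using b[of "\<lambda>x. x\<^sup>2"] by simp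
qed

definition tail1 :: "real \<Rightarrow> real" where
  "tail1 K = expectation (\<lambda>\<omega>. R 0 \<omega> * indicator {K<..} (R 0 \<omega>))"
definition tail2 :: "real \<Rightarrow> real" where
  "tail2 K = expectation (\<lambda>\<omega>. (R 0 \<omega>)\<^sup>2 * indicator {K<..} (R 0 \<omega>))"

lemma integrable_overshoot2: "0 \<le> t \<Longrightarrow> integrable M (\<lambda>\<omega>. (overshoot t \<omega>)\<^sup>2)"
proof -
  assume t: "0 \<le> t"
  show ?thesis
  proof (rule Bochner_Integration.integrable_bound)
    show "integrable M (\<lambda>\<omega>. \<Sum>i<\<nu> t \<omega>. (R i \<omega>)\<^sup>2)"
      using integrable_R2[of 0] by (intro wald_real(1)) auto
    show "AE \<omega> in M. norm ((overshoot t \<omega>)\<^sup>2) \<le> norm (\<Sum>i<\<nu> t \<omega>. (R i \<omega>)\<^sup>2)"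
      using AE_regular
    proof eventually_elim
      case (elim \<omega>)
      have "(overshoot t \<omega>)\<^sup>2 \<le> 0\<^sup>2 + (\<Sum>i<\<nu> t \<omega>. (R i \<omega>)\<^sup>2 * indicator {0<..} (R i \<omega>))"
        using elim t by (intro overshoot_le) auto
      also have "\<dots> \<le> (\<Sum>i<\<nu> t \<omega>. (R i \<omega>)\<^sup>2)"
        unfolding zero_power2 add_0 by (rule sum_mono) (auto simp: indicator_def)
      finally show ?case
        by (simp add: sum_nonneg)
    qed
  qed measurable
qed

lemma integrable_overshoot: "0 \<le> t \<Longrightarrow> integrable M (overshoot t)"
  by (rule square_integrable_imp_integrable[OF _ integrable_overshoot2]) auto

lemma mean_passages:
  assumes "0 \<le> t"
  shows "\<mu> * U t = t + expectation (overshoot t)"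
proof -
  have "expectation (\<lambda>\<omega>. \<Sum>i<\<nu> t \<omega>. R i \<omega>) = U t * \<mu>"
    unfolding \<mu>_def using integrable_R[of 0] by (intro wald_real(2)[of "\<lambda>x. x"]) auto
  moreover have "expectation (\<lambda>\<omega>. \<Sum>i<\<nu> t \<omega>. R i \<omega>) = expectation (\<lambda>\<omega>. t + overshoot t \<omega>)"
    by (simp add: overshoot_def)
  moreover have "\<dots> = t + expectation (overshoot t)"
    using integrable_overshoot[OF assms] by (simp add: prob_space)
  ultimately show ?thesis
    by simp
qed

lemma U_nonneg: "0 \<le> U t"
  unfolding U_def by (intro integral_nonneg_AE) auto

lemma mean_overshoot_nonneg: "0 \<le> t \<Longrightarrow> 0 \<le> expectation (overshoot t)"
  by (intro integral_nonneg_AE, use AE_regular in eventually_elim) (rule overshoot_bounds)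

lemma mean_overshoot_le:
  assumes t: "0 \<le> t" and K: "0 \<le> K"
  shows "expectation (overshoot t) \<le> K + U t * tail1 K"
    and "mean_overshoot2 t \<le> K\<^sup>2 + U t * tail2 K"
proof -
  have i1: "integrable M (\<lambda>\<omega>. R 0 \<omega> * indicator {K<..} (R 0 \<omega>))"
    by (rule Bochner_Integration.integrable_bound[OF integrable_R[of 0]]) (auto simp: indicator_def)
  have i2: "integrable M (\<lambda>\<omega>. (R 0 \<omega>)\<^sup>2 * indicator {K<..} (R 0 \<omega>))"
    by (rule Bochner_Integration.integrable_bound[OF integrable_R2[of 0]]) (auto simp: indicator_def)
  note w1 = wald_real[of "\<lambda>x. x * indicator {K<..} x" t, OF _ _ i1]
  note w2 = wald_real[of "\<lambda>x. x\<^sup>2 * indicator {K<..} x" t, OF _ _ i2]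
  have "expectation (overshoot t) \<le> expectation (\<lambda>\<omega>. K + (\<Sum>i<\<nu> t \<omega>. R i \<omega> * indicator {K<..} (R i \<omega>)))"
  proof (rule integral_mono_AE)
    show "integrable M (overshoot t)"
      by (rule integrable_overshoot[OF t])
    show "AE \<omega> in M. overshoot t \<omega> \<le> K + (\<Sum>i<\<nu> t \<omega>. R i \<omega> * indicator {K<..} (R i \<omega>))"
      using AE_regular by eventually_elim (rule overshoot_le[OF _ t K])
  qed (use w1(1) in simp)
  also have "\<dots> = K + U t * tail1 K"
    using w1 by (simp add: tail1_def prob_space)
  finally show "expectation (overshoot t) \<le> K + U t * tail1 K" .
  have "mean_overshoot2 t \<le> expectation (\<lambda>\<omega>. K\<^sup>2 + (\<Sum>i<\<nu> t \<omega>. (R i \<omega>)\<^sup>2 * indicator {K<..} (R i \<omega>)))"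
  proof (rule integral_mono_AE)
    show "integrable M (\<lambda>\<omega>. (overshoot t \<omega>)\<^sup>2)"
      by (rule integrable_overshoot2[OF t])
    show "AE \<omega> in M. (overshoot t \<omega>)\<^sup>2 \<le> K\<^sup>2 + (\<Sum>i<\<nu> t \<omega>. (R i \<omega>)\<^sup>2 * indicator {K<..} (R i \<omega>))"
      using AE_regular by eventually_elim (rule overshoot_le[OF _ t K])
  qed (use w2(1) in simp)
  also have "\<dots> = K\<^sup>2 + U t * tail2 K"
    using w2 by (simp add: tail2_def prob_space)
  finally show "mean_overshoot2 t \<le> K\<^sup>2 + U t * tail2 K" .
qed

text \<open>A self-absorbing estimate: once \<open>tail1 K\<close> is below
  \<open>\<mu> / 2\<close>, the overshoot term on the right of Wald's identity is at most half of
  the left-hand side.\<close>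

lemma U_linear_bound: obtains K where "0 \<le> K" "\<And>t. 0 \<le> t \<Longrightarrow> U t \<le> 2 * (t + K) / \<mu>"
proof -
  have "(tail1 \<longlongrightarrow> 0) at_top"
    unfolding tail1_def[abs_def] by (rule expectation_tail_tendsto_0[OF integrable_R R_measurable])
  then have "\<forall>\<^sub>F K in at_top. tail1 K < \<mu> / 2 \<and> 0 \<le> K"
    using \<mu>_pos by (intro eventually_conj order_tendstoD(2)[of tail1 0] eventually_ge_at_top) auto
  then obtain K where K: "tail1 K < \<mu> / 2" "0 \<le> K"
    by (auto simp: eventually_at_top_linorder)
  have "U t \<le> 2 * (t + K) / \<mu>" if t: "0 \<le> t" for t
  proof -
    have "\<mu> * U t \<le> t + (K + U t * tail1 K)"
      using mean_passages[OF t] mean_overshoot_le(1)[OF t K(2)] by simp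
    also have "\<dots> \<le> t + (K + U t * (\<mu> / 2))"
      using K U_nonneg[of t] by (intro add_left_mono mult_left_mono) auto
    finally show ?thesis
      using \<mu>_pos by (simp add: field_simps)
  qed
  with K(2) show thesis
    by (rule that)
qed

lemma overshoot2_asymp: "((\<lambda>t. mean_overshoot2 t / t) \<longlongrightarrow> 0) at_top"
proof (rule order_tendstoI)
  fix a :: real assume "a < 0"
  show "\<forall>\<^sub>F t in at_top. a < mean_overshoot2 t / t"
    using eventually_gt_at_top[of 0]
  proof eventually_elim
    case (elim t)
    have "0 \<le> mean_overshoot2 t"
      by (intro integral_nonneg_AE) auto
    then have "0 \<le> mean_overshoot2 t / t"
      using elim by simp
    with \<open>a < 0\<close> show ?case
      by linarith
  qed
next
  fix a :: real assume a: "0 < a"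
  obtain L where L: "0 \<le> L" "\<And>t. 0 \<le> t \<Longrightarrow> U t \<le> 2 * (t + L) / \<mu>"
    using U_linear_bound by blast
  have "(tail2 \<longlongrightarrow> 0) at_top"
    unfolding tail2_def[abs_def] by (rule expectation_tail_tendsto_0[OF integrable_R2 R_measurable])
  \<comment> \<open>Since \<open>U t\<close> is at most \<open>2 * (t + L) / \<mu>\<close>, this
    tail size makes the bound divided by \<open>t\<close> tend to \<open>a / 2\<close>, strictly
    below \<open>a\<close>.\<close>
  then have "\<forall>\<^sub>F K in at_top. tail2 K < a * \<mu> / 4 \<and> 0 \<le> K"
    using \<mu>_pos a by (intro eventually_conj order_tendstoD(2)[of tail2 0] eventually_ge_at_top) auto
  then obtain K where K: "tail2 K < a * \<mu> / 4" "0 \<le> K"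
    by (auto simp: eventually_at_top_linorder)
  have "((\<lambda>t. K\<^sup>2 / t + 2 * (1 + L / t) / \<mu> * (a * \<mu> / 4)) \<longlongrightarrow> 0 + 2 * (1 + 0) / \<mu> * (a * \<mu> / 4)) at_top"
    using \<mu>_pos by (intro tendsto_intros tendsto_divide_0[OF tendsto_const] filterlim_at_top_imp_at_infinity filterlim_ident) auto
  moreover have "0 + 2 * (1 + 0) / \<mu> * (a * \<mu> / 4) < a"
    using \<mu>_pos a by simp
  ultimately have "\<forall>\<^sub>F t in at_top. K\<^sup>2 / t + 2 * (1 + L / t) / \<mu> * (a * \<mu> / 4) < a"
    by (rule order_tendstoD(2))
  then show "\<forall>\<^sub>F t in at_top. mean_overshoot2 t / t < a"
    using eventually_gt_at_top[of 0]
  proof eventually_elim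
    case (elim t)
    have "mean_overshoot2 t \<le> K\<^sup>2 + U t * tail2 K"
      using elim K by (intro mean_overshoot_le) auto
    also have "U t * tail2 K \<le> U t * (a * \<mu> / 4)"
      using K U_nonneg[of t] by (intro mult_left_mono) auto
    also have "\<dots> \<le> 2 * (t + L) / \<mu> * (a * \<mu> / 4)"
      using elim L(2)[of t] a \<mu>_pos by (intro mult_right_mono) auto
    finally have "mean_overshoot2 t / t \<le> (K\<^sup>2 + 2 * (t + L) / \<mu> * (a * \<mu> / 4)) / t"
      using elim by (intro divide_right_mono) auto
    also have "\<dots> = K\<^sup>2 / t + 2 * (1 + L / t) / \<mu> * (a * \<mu> / 4)"
      using elim \<mu>_pos by (simp add: field_simps)
    finally show ?case
      using elim by simp
  qed
qed

lemma overshoot_asymp: "((\<lambda>t. expectation (overshoot t) / t) \<longlongrightarrow> 0) at_top"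
proof (rule tendsto_sandwich)
  show "\<forall>\<^sub>F t in at_top. 0 \<le> expectation (overshoot t) / t"
    using eventually_gt_at_top[of 0] by eventually_elim (simp add: mean_overshoot_nonneg)
  show "\<forall>\<^sub>F t in at_top. expectation (overshoot t) / t \<le> 1 / t + mean_overshoot2 t / t"
    using eventually_gt_at_top[of 0]
  proof eventually_elim
    case (elim t)
    have "expectation (overshoot t) \<le> expectation (\<lambda>\<omega>. 1 + (overshoot t \<omega>)\<^sup>2)"
    proof (intro integral_mono)
      show "overshoot t \<omega> \<le> 1 + (overshoot t \<omega>)\<^sup>2" for \<omega>
        by (rule le_one_plus_square)
    qed (use elim integrable_overshoot integrable_overshoot2 in auto)
    also have "\<dots> = 1 + mean_overshoot2 t"
      using elim integrable_overshoot2 by (simp add: prob_space)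
    finally show ?case
      using elim by (simp add: add_divide_distrib[symmetric] divide_right_mono)
  qed
  have "((\<lambda>t. 1 / t + mean_overshoot2 t / t) \<longlongrightarrow> 0 + 0) at_top"
    by (intro tendsto_add overshoot2_asymp tendsto_divide_0[OF tendsto_const] filterlim_at_top_imp_at_infinity filterlim_ident)
  then show "((\<lambda>t. 1 / t + mean_overshoot2 t / t) \<longlongrightarrow> 0) at_top"
    by simp
qed simp

text \<open>The elementary renewal theorem, obtained from Wald's identity once the mean overshoot is
  known to be sublinear.\<close>

lemma U_asymp: "((\<lambda>t. U t / t) \<longlongrightarrow> 1 / \<mu>) at_top"
proof -
  have "((\<lambda>t. (1 + expectation (overshoot t) / t) / \<mu>) \<longlongrightarrow> (1 + 0) / \<mu>) at_top"
    using \<mu>_pos by (intro tendsto_intros overshoot_asymp) auto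
  moreover have "\<forall>\<^sub>F t in at_top. (1 + expectation (overshoot t) / t) / \<mu> = U t / t"
    using eventually_gt_at_top[of 0]
  proof eventually_elim
    case (elim t)
    then show ?case
      using mean_passages[of t] \<mu>_pos by (simp add: field_simps)
  qed
  ultimately have "((\<lambda>t. U t / t) \<longlongrightarrow> (1 + 0) / \<mu>) at_top"
    by (rule Lim_transform_eventually)
  then show ?thesis
    by simp
qed

text \<open>On regular paths \<open>Z n\<close> is the centred sum stopped at the smaller of
  \<open>n\<close> and \<open>\<nu> t\<close>. The identity for finite \<open>n\<close> is
  \<open>second_moment_predictable_sum\<close>; letting \<open>n\<close> grow requires a
  square-integrable majorant of all \<open>Z n\<close>.\<close>

lemma wald_second:
  assumes t: "0 \<le> t"
  shows "integrable M (\<lambda>\<omega>. (stopped_sum t \<omega>)\<^sup>2)" and "expectation (\<lambda>\<omega>. (stopped_sum t \<omega>)\<^sup>2) = \<sigma>2 * U t"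
proof -
  define e where "e = (\<lambda>n \<omega>. of_bool (S n \<omega> \<le> t) :: real)"
  define Z where "Z = (\<lambda>n \<omega>. \<Sum>i<n. e i \<omega> * (R i \<omega> - \<mu>))"
  have [measurable]: "e n \<in> borel_measurable M" for n
    unfolding e_def by measurable
  have [measurable]: "Z n \<in> borel_measurable M" for n
    unfolding Z_def by measurable
  have stop: "(\<Sum>i<n. e i \<omega> * f i) = (\<Sum>i<min n (\<nu> t \<omega>). f i)" if "regular \<omega>" for \<omega> n f
    using that by (intro sum.mono_neutral_cong_right) (auto simp: e_def regular_less_\<nu>[OF that, symmetric])
  \<comment> \<open>With |R_i - \<mu>| \<le> R_i + \<mu> every stopped sum is dominated by the full
    sum of R_i + \<mu> up to first passage, which equals the bracket; its square is integrable
    through the overshoot and the count.\<close>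
  let ?w = "\<lambda>\<omega>. (t + overshoot t \<omega> + \<mu> * \<nu> t \<omega>)\<^sup>2"
  have w: "integrable M ?w"
  proof (rule Bochner_Integration.integrable_bound)
    show "integrable M (\<lambda>\<omega>. 3 * t\<^sup>2 + 3 * (overshoot t \<omega>)\<^sup>2 + 3 * \<mu>\<^sup>2 * (real (\<nu> t \<omega>))\<^sup>2)"
      using integrable_\<nu>2[of t] integrable_overshoot2[OF t] by simp
    have "(a + b + c)\<^sup>2 \<le> 3 * a\<^sup>2 + 3 * b\<^sup>2 + 3 * c\<^sup>2" for a b c :: real
      using sum_squares_bound[of a b] sum_squares_bound[of b c] sum_squares_bound[of a c]
      by (simp add: power2_eq_square algebra_simps)
    then have "norm (?w \<omega>) \<le> norm (3 * t\<^sup>2 + 3 * (overshoot t \<omega>)\<^sup>2 + 3 * \<mu>\<^sup>2 * (real (\<nu> t \<omega>))\<^sup>2)" for \<omega>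
      by (metis (no_types, lifting) abs_of_nonneg mult.assoc order_trans power_mult_distrib real_norm_def zero_le_power2)
    then show "AE \<omega> in M. norm (?w \<omega>) \<le> norm (3 * t\<^sup>2 + 3 * (overshoot t \<omega>)\<^sup>2 + 3 * \<mu>\<^sup>2 * (real (\<nu> t \<omega>))\<^sup>2)"
      by blast
  qed measurable
  have ev: "\<forall>\<^sub>F n in sequentially. min n (\<nu> t \<omega>) = \<nu> t \<omega>" for \<omega>
    using eventually_ge_at_top[of "\<nu> t \<omega>"] by eventually_elim simp
  have lim: "AE \<omega> in M. (\<lambda>n. (Z n \<omega>)\<^sup>2) \<longlonglongrightarrow> (stopped_sum t \<omega>)\<^sup>2"
    using AE_regular
  proof eventually_elim
    case (elim \<omega>)
    show ?case
      using ev[of \<omega>]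
      by (intro tendsto_eventually, eventually_elim) (simp add: Z_def stopped_sum_def stop[OF elim])
  qed
  have bound: "AE \<omega> in M. norm ((Z n \<omega>)\<^sup>2) \<le> ?w \<omega>" for n
    using AE_regular
  proof eventually_elim
    case (elim \<omega>)
    have nn: "0 \<le> R i \<omega>" for i
      using elim by (simp add: regular_def)
    have "\<bar>Z n \<omega>\<bar> \<le> (\<Sum>i<min n (\<nu> t \<omega>). \<bar>R i \<omega> - \<mu>\<bar>)"
      unfolding Z_def stop[OF elim] by (rule sum_abs)
    also have "\<dots> \<le> (\<Sum>i<min n (\<nu> t \<omega>). R i \<omega> + \<mu>)"
    proof (rule sum_mono)
      show "\<bar>R i \<omega> - \<mu>\<bar> \<le> R i \<omega> + \<mu>" for i
        using nn[of i] \<mu>_pos by linarith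
    qed
    also have "\<dots> \<le> (\<Sum>i<\<nu> t \<omega>. R i \<omega> + \<mu>)"
    proof (rule sum_mono2)
      show "0 \<le> R i \<omega> + \<mu>" for i
        using nn[of i] \<mu>_pos by linarith
    qed auto
    also have "\<dots> = t + overshoot t \<omega> + \<mu> * \<nu> t \<omega>"
      by (simp add: overshoot_def sum.distrib)
    finally have "\<bar>Z n \<omega>\<bar>\<^sup>2 \<le> ?w \<omega>"
      by (intro power_mono) auto
    then show ?case
      by simp
  qed
  note dc = integrable_dominated_convergence[OF _ _ w lim bound] integral_dominated_convergence[OF _ _ w lim bound]
  show "integrable M (\<lambda>\<omega>. (stopped_sum t \<omega>)\<^sup>2)"
    by (rule dc) measurable
  have 1: "(\<lambda>n. expectation (\<lambda>\<omega>. (Z n \<omega>)\<^sup>2)) \<longlonglongrightarrow> expectation (\<lambda>\<omega>. (stopped_sum t \<omega>)\<^sup>2)"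
    by (rule dc) measurable
  have 2: "(\<lambda>n. expectation (\<lambda>\<omega>. \<Sum>i<n. e i \<omega>)) \<longlonglongrightarrow> U t"
    unfolding U_def
  proof (rule integral_dominated_convergence[where w="\<lambda>\<omega>. real (\<nu> t \<omega>)"])
    have "(\<Sum>i<n. e i \<omega>) = real (min n (\<nu> t \<omega>))" if "regular \<omega>" for \<omega> n
    proof -
      have "(\<Sum>i<n. e i \<omega> * 1) = (\<Sum>i<min n (\<nu> t \<omega>). 1)"
        by (rule stop[OF that])
      then show ?thesis
        by simp
    qed
    note s = this
    show "AE \<omega> in M. (\<lambda>n. \<Sum>i<n. e i \<omega>) \<longlonglongrightarrow> real (\<nu> t \<omega>)"
      using AE_regular
    proof eventually_elim
      case (elim \<omega>)
      show ?case
        using ev[of \<omega>] by (intro tendsto_eventually, eventually_elim) (simp add: s[OF elim])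
    qed
    show "AE \<omega> in M. norm (\<Sum>i<n. e i \<omega>) \<le> real (\<nu> t \<omega>)" for n
      using AE_regular by eventually_elim (simp add: s)
  qed (auto simp: integrable_\<nu>)
  have Z2: "expectation (\<lambda>\<omega>. (Z n \<omega>)\<^sup>2) = \<sigma>2 * expectation (\<lambda>\<omega>. \<Sum>i<n. e i \<omega>)" for n
    unfolding Z_def e_def \<sigma>2_def S_def
  proof (rule second_moment_predictable_sum(2))
    show "integrable M (\<lambda>\<omega>. (R 0 \<omega> - \<mu>)\<^sup>2)"
      using integrable_R[of 0] integrable_R2[of 0] by (simp add: power2_diff)
    show "expectation (\<lambda>\<omega>. R 0 \<omega> - \<mu>) = 0"
      using integrable_R[of 0] by (simp add: prob_space \<mu>_def)
    show "Measurable.pred (\<Pi>\<^sub>M i\<in>{..<n}. borel) (\<lambda>x. (\<Sum>j<k. x j) \<le> t)" if "k \<le> n" for k n :: nat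
    proof -
      have [measurable]: "(\<lambda>x. \<Sum>j<k. x j) \<in> borel_measurable (\<Pi>\<^sub>M i\<in>{..<n}. (borel :: real measure))"
        using that by (intro borel_measurable_sum measurable_component_singleton) auto
      show ?thesis
        by measurable
    qed
    show "((\<Sum>j<k. x j) \<le> t) = ((\<Sum>j<k. y j) \<le> t)" if "\<And>i. i < k \<Longrightarrow> x i = y i" for k and x y :: "nat \<Rightarrow> real"
      using that by (simp cong: sum.cong_simp)
  qed measurable
  have "(\<lambda>n. expectation (\<lambda>\<omega>. (Z n \<omega>)\<^sup>2)) \<longlonglongrightarrow> \<sigma>2 * U t"
    unfolding Z2 using 2 by (rule tendsto_mult_left)
  with 1 show "expectation (\<lambda>\<omega>. (stopped_sum t \<omega>)\<^sup>2) = \<sigma>2 * U t"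
    by (rule LIMSEQ_unique)
qed

section \<open>Mean square error of the renewal count\<close>

definition passage_error :: "real \<Rightarrow> real" where "passage_error t = expectation (\<lambda>\<omega>. (real (\<nu> t \<omega>) - t / \<mu>)\<^sup>2)"

lemma integrable_overshoot_stopped_sum: "0 \<le> t \<Longrightarrow> integrable M (\<lambda>\<omega>. overshoot t \<omega> * stopped_sum t \<omega>)"
proof (rule Bochner_Integration.integrable_bound)
  assume t: "0 \<le> t"
  show "integrable M (\<lambda>\<omega>. (overshoot t \<omega>)\<^sup>2 + (stopped_sum t \<omega>)\<^sup>2)"
    using integrable_overshoot2[OF t] wald_second(1)[OF t] by simp
  show "AE \<omega> in M. norm (overshoot t \<omega> * stopped_sum t \<omega>) \<le> norm ((overshoot t \<omega>)\<^sup>2 + (stopped_sum t \<omega>)\<^sup>2)"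
    by (simp add: abs_mult_le_sum_squares)
qed measurable

lemma passage_error_eq:
  assumes t: "0 \<le> t"
  shows "passage_error t = (mean_overshoot2 t - 2 * expectation (\<lambda>\<omega>. overshoot t \<omega> * stopped_sum t \<omega>) + \<sigma>2 * U t) / \<mu>\<^sup>2"
proof -
  have "passage_error t = expectation (\<lambda>\<omega>. ((overshoot t \<omega>)\<^sup>2 - 2 * (overshoot t \<omega> * stopped_sum t \<omega>) + (stopped_sum t \<omega>)\<^sup>2) / \<mu>\<^sup>2)"
    unfolding passage_error_def passages_deviation_eq by (simp add: power_divide power2_diff algebra_simps)
  then show ?thesis
    using integrable_overshoot2[OF t] wald_second[OF t] integrable_overshoot_stopped_sum[OF t] by simp
qed

text \<open>Cauchy-Schwarz: one factor is o(t) in mean square, the other grows linearly by Wald's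
  second identity.\<close>

lemma mixed_asymp: "((\<lambda>t. expectation (\<lambda>\<omega>. overshoot t \<omega> * stopped_sum t \<omega>) / t) \<longlongrightarrow> 0) at_top"
proof (rule Lim_null_comparison)
  let ?b = "\<lambda>t. mean_overshoot2 t / t"
  show "\<forall>\<^sub>F t in at_top. norm (expectation (\<lambda>\<omega>. overshoot t \<omega> * stopped_sum t \<omega>) / t) \<le> sqrt (?b t * (\<sigma>2 * (U t / t)))"
    using eventually_gt_at_top[of 0]
  proof eventually_elim
    case (elim t)
    then have t: "0 \<le> t" by simp
    have "(expectation (\<lambda>\<omega>. overshoot t \<omega> * stopped_sum t \<omega>) / t)\<^sup>2 \<le> mean_overshoot2 t * (\<sigma>2 * U t) / t\<^sup>2"
      using expectation_mult_squared_le[OF integrable_overshoot2[OF t] wald_second(1)[OF t] integrable_overshoot_stopped_sum[OF t]]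
      by (simp add: wald_second(2)[OF t] power_divide divide_right_mono)
    also have "\<dots> = ?b t * (\<sigma>2 * (U t / t))"
      by (simp add: power2_eq_square[of t])
    finally show ?case
      using real_sqrt_le_mono by fastforce
  qed
  have "((\<lambda>t. sqrt (?b t * (\<sigma>2 * (U t / t)))) \<longlongrightarrow> sqrt (0 * (\<sigma>2 * (1 / \<mu>)))) at_top"
    by (intro tendsto_intros overshoot2_asymp U_asymp)
  then show "((\<lambda>t. sqrt (?b t * (\<sigma>2 * (U t / t)))) \<longlongrightarrow> 0) at_top"
    by simp
qed

lemma passage_error_asymp: "((\<lambda>t. passage_error t / t) \<longlongrightarrow> \<sigma>2 / \<mu> ^ 3) at_top"
proof -
  have "((\<lambda>t. (mean_overshoot2 t / t - 2 * (expectation (\<lambda>\<omega>. overshoot t \<omega> * stopped_sum t \<omega>) / t) + \<sigma>2 * (U t / t)) / \<mu>\<^sup>2)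
      \<longlongrightarrow> (0 - 2 * 0 + \<sigma>2 * (1 / \<mu>)) / \<mu>\<^sup>2) at_top"
    using \<mu>_pos by (intro tendsto_intros overshoot2_asymp mixed_asymp U_asymp) auto
  moreover have "\<forall>\<^sub>F t in at_top.
      (mean_overshoot2 t / t - 2 * (expectation (\<lambda>\<omega>. overshoot t \<omega> * stopped_sum t \<omega>) / t) + \<sigma>2 * (U t / t)) / \<mu>\<^sup>2 = passage_error t / t"
    using eventually_gt_at_top[of 0]
    by eventually_elim (simp add: passage_error_eq add_divide_distrib diff_divide_distrib mult.commute)
  ultimately have "((\<lambda>t. passage_error t / t) \<longlongrightarrow> (0 - 2 * 0 + \<sigma>2 * (1 / \<mu>)) / \<mu>\<^sup>2) at_top"
    by (rule Lim_transform_eventually)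
  moreover have "(0 - 2 * 0 + \<sigma>2 * (1 / \<mu>)) / \<mu>\<^sup>2 = \<sigma>2 / \<mu> ^ 3"
    by (simp add: power2_eq_square power3_eq_cube)
  ultimately show ?thesis
    by (simp only:)
qed

lemma \<sigma>2_nonneg: "0 \<le> \<sigma>2"
  unfolding \<sigma>2_def by (intro integral_nonneg_AE) auto

text \<open>A limit at infinity is not enough, since a delay may leave an arbitrarily short
  remaining time; this bound holds for all \<open>t \<ge> 0\<close> and serves as majorant. The
  overshoot is bounded with truncation level 0, where \<open>tail2 0\<close> is just E R^2.\<close>

lemma passage_error_linear_bound: obtains C where "0 \<le> C" "\<And>t. 0 \<le> t \<Longrightarrow> passage_error t \<le> C * (1 + t)"
proof -
  obtain K where K: "0 \<le> K" "\<And>t. 0 \<le> t \<Longrightarrow> U t \<le> 2 * (t + K) / \<mu>"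
    using U_linear_bound by blast
  define D where "D = 2 / \<mu>\<^sup>2 * (tail2 0 + \<sigma>2)"
  have "0 \<le> tail2 0"
    unfolding tail2_def by (intro integral_nonneg_AE) auto
  then have D: "0 \<le> D"
    using \<sigma>2_nonneg by (simp add: D_def)
  have "passage_error t \<le> D * (2 * (1 + K) / \<mu>) * (1 + t)" if t: "0 \<le> t" for t
  proof -
    have "passage_error t \<le> expectation (\<lambda>\<omega>. 2 / \<mu>\<^sup>2 * ((overshoot t \<omega>)\<^sup>2 + (stopped_sum t \<omega>)\<^sup>2))"
      unfolding passage_error_def passages_deviation_eq
    proof (rule integral_mono_AE)
      show "integrable M (\<lambda>\<omega>. ((overshoot t \<omega> - stopped_sum t \<omega>) / \<mu>)\<^sup>2)"
        using integrable_overshoot2[OF t] wald_second(1)[OF t] integrable_overshoot_stopped_sum[OF t]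
        by (simp add: power_divide power2_diff mult.assoc)
      show "integrable M (\<lambda>\<omega>. 2 / \<mu>\<^sup>2 * ((overshoot t \<omega>)\<^sup>2 + (stopped_sum t \<omega>)\<^sup>2))"
        using integrable_overshoot2[OF t] wald_second(1)[OF t] by simp
      have "((b - y) / \<mu>)\<^sup>2 \<le> 2 / \<mu>\<^sup>2 * (b\<^sup>2 + y\<^sup>2)" for b y :: real
      proof -
        have "(b - y)\<^sup>2 \<le> 2 * (b\<^sup>2 + y\<^sup>2)"
          using sum_squares_bound[of "- b" y] by (simp add: power2_diff)
        then show ?thesis
          by (simp add: power_divide divide_right_mono)
      qed
      then show "AE \<omega> in M. ((overshoot t \<omega> - stopped_sum t \<omega>) / \<mu>)\<^sup>2 \<le> 2 / \<mu>\<^sup>2 * ((overshoot t \<omega>)\<^sup>2 + (stopped_sum t \<omega>)\<^sup>2)"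
        by blast
    qed
    also have "\<dots> = 2 / \<mu>\<^sup>2 * (mean_overshoot2 t + \<sigma>2 * U t)"
      using integrable_overshoot2[OF t] wald_second[OF t] by simp
    also have "\<dots> \<le> 2 / \<mu>\<^sup>2 * (U t * tail2 0 + \<sigma>2 * U t)"
      using mean_overshoot_le(2)[OF t order_refl] by (intro mult_left_mono add_right_mono) auto
    also have "\<dots> = D * U t"
      by (simp add: D_def algebra_simps add_divide_distrib)
    also have "\<dots> \<le> D * (2 * (t + K) / \<mu>)"
      using D K(2)[OF t] by (intro mult_left_mono)
    also have "\<dots> \<le> D * (2 * ((1 + K) * (1 + t)) / \<mu>)"
      using D \<mu>_pos K t by (intro mult_left_mono divide_right_mono) (auto simp: algebra_simps)
    finally show ?thesis
      by (simp add: algebra_simps)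
  qed
  moreover have "0 \<le> D * (2 * (1 + K) / \<mu>)"
    using D K \<mu>_pos by simp
  ultimately show thesis
    by (rule that[rotated])
qed

end

section \<open>Packet traffic\<close>

definition points_in :: "(nat \<Rightarrow> real) \<Rightarrow> real \<Rightarrow> real \<Rightarrow> nat" where
  "points_in x a b = card {l. a < (\<Sum>j<l. x j) \<and> (\<Sum>j<l. x j) \<le> b}"

lemma packet_count_eq: "packet_count R a b \<omega> = real (points_in (\<lambda>i. R i \<omega>) a b)"
  by (simp add: packet_count_def points_in_def)

lemma points_in_measurable [measurable]:
  assumes [measurable]: "\<And>i. (\<lambda>z. x z i) \<in> borel_measurable N" "a \<in> borel_measurable N" "b \<in> borel_measurable N"
  shows "(\<lambda>z. points_in (x z) (a z) (b z)) \<in> measurable N (count_space UNIV)"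
  unfolding points_in_def by measurable

text \<open>The zeroth point sits at 0 and is not beyond \<open>x 0 + v\<close>, so every counted
  index is a successor; removing the first gap re-indexes by one.\<close>

lemma points_in_Suc:
  assumes "0 \<le> v" "0 \<le> x 0"
  shows "points_in x (x 0 + v) (x 0 + w) = points_in (\<lambda>i. x (Suc i)) v w"
proof -
  let ?A = "{l. x 0 + v < (\<Sum>j<l. x j) \<and> (\<Sum>j<l. x j) \<le> x 0 + w}"
  let ?B = "{l. v < (\<Sum>j<l. x (Suc j)) \<and> (\<Sum>j<l. x (Suc j)) \<le> w}"
  have s: "(\<Sum>j<Suc l. x j) = x 0 + (\<Sum>j<l. x (Suc j))" for l
    by (rule sum.lessThan_Suc_shift)
  have "l \<in> ?A \<longleftrightarrow> l \<in> Suc ` ?B" for l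
  proof (cases l)
    case 0
    then show ?thesis
      using assms by auto
  next
    case (Suc k)
    show ?thesis
      unfolding mem_Collect_eq Suc s by auto
  qed
  then have "?A = Suc ` ?B"
    by blast
  then show ?thesis
    by (simp add: points_in_def card_image)
qed

text \<open>From a position inside the first cycle the next packet is the one at \<open>x 0\<close>,
  and it acts as the time-0 renewal of the shifted sequence. Strictness of \<open>u < x 0\<close>
  matters: the window is open on the left and must still contain that packet.\<close>

lemma points_in_first_cycle:
  assumes "\<And>i. 0 \<le> x i" "0 \<le> u" "u < x 0"
  shows "points_in x u b = passages (\<lambda>i. x (Suc i)) (b - x 0)"
proof -
  let ?A = "{l. u < (\<Sum>j<l. x j) \<and> (\<Sum>j<l. x j) \<le> b}"
  let ?B = "{l. (\<Sum>j<l. x (Suc j)) \<le> b - x 0}"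
  have s: "(\<Sum>j<Suc l. x j) = x 0 + (\<Sum>j<l. x (Suc j))" for l
    by (rule sum.lessThan_Suc_shift)
  have "l \<in> ?A \<longleftrightarrow> l \<in> Suc ` ?B" for l
  proof (cases l)
    case 0
    then show ?thesis
      using assms(2) by auto
  next
    case (Suc k)
    have "0 \<le> (\<Sum>j<k. x (Suc j))"
      using assms(1) by (intro sum_nonneg)
    then show ?thesis
      unfolding mem_Collect_eq Suc s using assms(3) by auto
  qed
  then have "?A = Suc ` ?B"
    by blast
  then show ?thesis
    by (simp add: points_in_def passages_def card_image)
qed

section \<open>Packet counts as regenerative traffic\<close>

context renewal_sequence
begin

lemma points_in_le:
  assumes "regular \<omega>" "b \<le> c"
  shows "points_in (\<lambda>i. R i \<omega>) a b \<le> \<nu> c \<omega>"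
  unfolding points_in_def \<nu>_def passages_def
  using assms unfolding regular_def S_def by (intro card_mono) auto

lemma points_in_add:
  assumes "regular \<omega>" "a \<le> b" "b \<le> c"
  shows "points_in (\<lambda>i. R i \<omega>) a b + points_in (\<lambda>i. R i \<omega>) b c = points_in (\<lambda>i. R i \<omega>) a c"
proof -
  let ?A = "\<lambda>a b. {l. a < S l \<omega> \<and> S l \<omega> \<le> b}"
  have fin: "finite (?A a b)" for a b
    using assms(1) by (auto simp: regular_def intro: finite_subset[of _ "{l. S l \<omega> \<le> b}"])
  have "?A a c = ?A a b \<union> ?A b c"
    using assms by auto
  moreover have "card (?A a b \<union> ?A b c) = card (?A a b) + card (?A b c)"
    using fin by (intro card_Un_disjoint) auto
  ultimately show ?thesis
    by (simp add: points_in_def S_def)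
qed

lemma nn_integral_\<nu>2: "(\<integral>\<^sup>+\<omega>. ennreal ((real (\<nu> t \<omega>))\<^sup>2) \<partial>M) < \<infinity>"
  using integrable_\<nu>2[of t] by (simp add: integrable_iff_bounded)

lemma nn_integral_packet_count_finite:
  "(\<integral>\<^sup>+\<omega>. \<integral>\<^sup>+v. ennreal ((packet_count R v (v + d) \<omega>)\<^sup>2) * indicator {0..s} v \<partial>lborel \<partial>M) < \<infinity>"
  if "0 \<le> s"
proof -
  have "(\<integral>\<^sup>+\<omega>. \<integral>\<^sup>+v. ennreal ((packet_count R v (v + d) \<omega>)\<^sup>2) * indicator {0..s} v \<partial>lborel \<partial>M) \<le>
      (\<integral>\<^sup>+\<omega>. ennreal ((real (\<nu> (s + d) \<omega>))\<^sup>2) * ennreal s \<partial>M)"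
  proof (intro nn_integral_mono_AE, use AE_regular in eventually_elim)
    case (elim \<omega>)
    have "(\<integral>\<^sup>+v. ennreal ((packet_count R v (v + d) \<omega>)\<^sup>2) * indicator {0..s} v \<partial>lborel) \<le>
        (\<integral>\<^sup>+v. ennreal ((real (\<nu> (s + d) \<omega>))\<^sup>2) * indicator {0..s} v \<partial>lborel)"
      using points_in_le[OF elim]
      by (intro nn_integral_mono) (auto simp: indicator_def packet_count_eq intro!: ennreal_leI power_mono)
    also have "\<dots> = ennreal ((real (\<nu> (s + d) \<omega>))\<^sup>2) * ennreal s"
      using that by (simp add: nn_integral_cmult)
    finally show ?case .
  qed
  also have "\<dots> < \<infinity>"
    using nn_integral_\<nu>2[of "s + d"] by (simp add: nn_integral_multc ennreal_mult_less_top)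
  finally show ?thesis .
qed

text \<open>Combines \<open>points_in_first_cycle\<close> with the splitting of head and tail: after
  the delay \<open>R 0 \<omega> - u\<close> an independent renewal sequence starts. The end
  \<open>u = R 0 \<omega>\<close>, where the pathwise formula may fail, is a null set for
  \<open>u\<close>.\<close>

lemma nn_integral_first_cycle:
  assumes [measurable]: "(\<lambda>(n, u). f n u) \<in> borel_measurable (count_space UNIV \<Otimes>\<^sub>M borel)"
  shows "(\<integral>\<^sup>+\<omega>. \<integral>\<^sup>+u. f (points_in (\<lambda>i. R i \<omega>) u (u + t)) (R 0 \<omega> - u) * indicator {0..R 0 \<omega>} u \<partial>lborel \<partial>M) =
    (\<integral>\<^sup>+\<omega>. \<integral>\<^sup>+u. (\<integral>\<^sup>+\<omega>'. f (\<nu> (t - (R 0 \<omega> - u)) \<omega>') (R 0 \<omega> - u) \<partial>M) * indicator {0..R 0 \<omega>} u \<partial>lborel \<partial>M)"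
    (is "?L = ?R")
proof -
  have f_meas [measurable]: "(\<lambda>z. f (n z) (u z)) \<in> borel_measurable N"
    if [measurable]: "n \<in> measurable N (count_space UNIV)" "u \<in> borel_measurable N" for n u and N :: "'d measure"
  proof -
    have "(\<lambda>z. (\<lambda>(n, u). f n u) (n z, u z)) \<in> borel_measurable N"
      by measurable
    then show ?thesis by simp
  qed
  have Icc: "indicator {0..b} u = (if 0 \<le> u \<and> u \<le> b then 1 else 0 :: ennreal)" for b u :: real
    by (simp add: indicator_def)
  let ?F = "\<lambda>r x. \<integral>\<^sup>+u. f (passages x (u + t - r)) (r - u) * indicator {0..r} u \<partial>lborel"
  have "?L = (\<integral>\<^sup>+\<omega>. ?F (R 0 \<omega>) (\<lambda>i. R (Suc i) \<omega>) \<partial>M)"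
  proof (intro nn_integral_cong_AE, use AE_nonneg in eventually_elim)
    case (elim \<omega>)
    show ?case
    proof (intro nn_integral_cong_AE, use AE_lborel_singleton[of "R 0 \<omega>"] in eventually_elim)
      case u: (elim u)
      then show ?case
        using elim points_in_first_cycle[of "\<lambda>i. R i \<omega>" u "u + t"]
        by (auto simp: indicator_def)
    qed
  qed
  also have "\<dots> = (\<integral>\<^sup>+\<omega>. \<integral>\<^sup>+\<omega>'. ?F (R 0 \<omega>) (\<lambda>i. R i \<omega>') \<partial>M \<partial>M)"
  proof (rule nn_integral_head_tail)
    show "(\<lambda>(r, x). ?F r x) \<in> borel_measurable (borel \<Otimes>\<^sub>M (\<Pi>\<^sub>M i\<in>UNIV. borel))"
      unfolding Icc by measurable
  qed
  also have "\<dots> = ?R"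
  proof (intro nn_integral_cong)
    fix \<omega>
    have "(\<integral>\<^sup>+\<omega>'. ?F (R 0 \<omega>) (\<lambda>i. R i \<omega>') \<partial>M) =
        (\<integral>\<^sup>+u. \<integral>\<^sup>+\<omega>'. f (\<nu> (u + t - R 0 \<omega>) \<omega>') (R 0 \<omega> - u) * indicator {0..R 0 \<omega>} u \<partial>M \<partial>lborel)"
      unfolding \<nu>_def
      by (rule pair_sigma_finite.Fubini'[symmetric])
         (auto intro: pair_sigma_finite.intro sigma_finite_lborel sigma_finite_measure_axioms simp: Icc)
    then show "(\<integral>\<^sup>+\<omega>'. ?F (R 0 \<omega>) (\<lambda>i. R i \<omega>') \<partial>M) =
        (\<integral>\<^sup>+u. (\<integral>\<^sup>+\<omega>'. f (\<nu> (t - (R 0 \<omega> - u)) \<omega>') (R 0 \<omega> - u) \<partial>M) * indicator {0..R 0 \<omega>} u \<partial>lborel)"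
      by (simp add: nn_integral_multc diff_diff_eq2 add.commute)
  qed
  finally show ?thesis .
qed

sublocale traffic: regenerative_traffic M "R 0" "packet_count R"
proof
  show "AE \<omega> in M. 0 \<le> R 0 \<omega>" "integrable M (R 0)" "0 < expectation (R 0)"
    using nonneg integrable_R mean_pos by auto
  show "(\<lambda>(\<omega>, v). packet_count R v (v + d) \<omega>) \<in> borel_measurable (M \<Otimes>\<^sub>M borel)" for d
    unfolding packet_count_eq by measurable
  show "0 \<le> packet_count R s t \<omega>" for s t \<omega>
    by (simp add: packet_count_def)
  show "AE \<omega> in M. \<forall>a b c. 0 \<le> a \<longrightarrow> a \<le> b \<longrightarrow> b \<le> c \<longrightarrow>
      packet_count R a b \<omega> + packet_count R b c \<omega> = packet_count R a c \<omega>"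
    using AE_regular by eventually_elim (auto simp: packet_count_eq points_in_add simp flip: of_nat_add)
  show "(\<integral>\<^sup>+\<omega>. \<integral>\<^sup>+v. ennreal ((packet_count R v (v + d) \<omega>)\<^sup>2) * indicator {0..s} v \<partial>lborel \<partial>M) < \<infinity>"
    if "0 \<le> s" for s d
    using that by (rule nn_integral_packet_count_finite)
  show "(\<integral>\<^sup>+\<omega>. g (packet_count R (R 0 \<omega> + v) (R 0 \<omega> + v + d) \<omega>) \<partial>M) =
      (\<integral>\<^sup>+\<omega>. g (packet_count R v (v + d) \<omega>) \<partial>M)"
    if "0 < v" "0 \<le> d" and [measurable]: "g \<in> borel_measurable borel" for v d and g :: "real \<Rightarrow> ennreal"
  proof -
    have "(\<integral>\<^sup>+\<omega>. g (packet_count R (R 0 \<omega> + v) (R 0 \<omega> + v + d) \<omega>) \<partial>M) =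
        (\<integral>\<^sup>+\<omega>. g (points_in (\<lambda>i. R (Suc i) \<omega>) v (v + d)) \<partial>M)"
    proof (intro nn_integral_cong_AE, use nonneg in eventually_elim)
      case (elim \<omega>)
      then show ?case
        using points_in_Suc[of v "\<lambda>i. R i \<omega>" "v + d"] that by (simp add: packet_count_eq add.assoc)
    qed
    also have "\<dots> = (\<integral>\<^sup>+\<omega>. g (points_in (\<lambda>i. R i \<omega>) v (v + d)) \<partial>M)"
      by (rule nn_integral_shift) measurable
    finally show ?thesis
      by (simp add: packet_count_eq)
  qed
  \<comment> \<open>The count after the first gap comes from an independent copy and is at most its
    count up to \<open>d\<close>. So the double integral factors into a second moment of the count
    and the mean gap, and no mixed moment of gap and count appears.\<close>
  show "(\<integral>\<^sup>+\<omega>. \<integral>\<^sup>+v. ennreal ((packet_count R v (v + d) \<omega>)\<^sup>2) * indicator {0..R 0 \<omega>} v \<partial>lborel \<partial>M) < \<infinity>"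
    for d
  proof -
    let ?n = "\<integral>\<^sup>+\<omega>'. ennreal ((real (\<nu> d \<omega>'))\<^sup>2) \<partial>M"
    have "(\<integral>\<^sup>+\<omega>. \<integral>\<^sup>+v. ennreal ((packet_count R v (v + d) \<omega>)\<^sup>2) * indicator {0..R 0 \<omega>} v \<partial>lborel \<partial>M) =
      (\<integral>\<^sup>+\<omega>. \<integral>\<^sup>+u. (\<integral>\<^sup>+\<omega>'. ennreal ((real (\<nu> (d - (R 0 \<omega> - u)) \<omega>'))\<^sup>2) \<partial>M) * indicator {0..R 0 \<omega>} u \<partial>lborel \<partial>M)"
      unfolding packet_count_eq by (rule nn_integral_first_cycle[where f="\<lambda>n u. ennreal ((real n)\<^sup>2)"]) measurable
    also have "\<dots> \<le> (\<integral>\<^sup>+\<omega>. \<integral>\<^sup>+u. ?n * indicator {0..R 0 \<omega>} u \<partial>lborel \<partial>M)"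
    proof (intro nn_integral_mono)
      fix \<omega> u
      have "(\<integral>\<^sup>+\<omega>'. ennreal ((real (\<nu> (d - (R 0 \<omega> - u)) \<omega>'))\<^sup>2) \<partial>M) \<le> ?n"
        if "u \<le> R 0 \<omega>"
      proof (intro nn_integral_mono_AE, use AE_regular in eventually_elim)
        case (elim \<omega>')
        have "\<nu> (d - (R 0 \<omega> - u)) \<omega>' \<le> \<nu> d \<omega>'"
          unfolding \<nu>_def passages_def
          using elim that unfolding regular_def S_def by (intro card_mono) auto
        then show ?case
          by (intro ennreal_leI power_mono) auto
      qed
      then show "(\<integral>\<^sup>+\<omega>'. ennreal ((real (\<nu> (d - (R 0 \<omega> - u)) \<omega>'))\<^sup>2) \<partial>M) * indicator {0..R 0 \<omega>} u \<le>
          ?n * indicator {0..R 0 \<omega>} u"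
        by (auto simp: indicator_def)
    qed
    also have "\<dots> = (\<integral>\<^sup>+\<omega>. ?n * ennreal (R 0 \<omega>) \<partial>M)"
      by (intro nn_integral_cong_AE, use nonneg in eventually_elim) (simp add: nn_integral_cmult)
    also have "\<dots> = ?n * ennreal (expectation (R 0))"
      using nonneg integrable_R by (simp add: nn_integral_cmult nn_integral_eq_integral)
    also have "\<dots> < \<infinity>"
      using nn_integral_\<nu>2[of d] by (simp add: ennreal_mult_less_top)
    finally show ?thesis .
  qed
qed measurable

section \<open>Renewal counts with a delay\<close>

definition delayed_error :: "real \<Rightarrow> real \<Rightarrow> real" where
  "delayed_error t r = expectation (\<lambda>\<omega>. (real (\<nu> (t - r) \<omega>) - t / \<mu>)\<^sup>2)"

lemma integrable_\<nu>_diff2: "integrable M (\<lambda>\<omega>. (real (\<nu> s \<omega>) - c)\<^sup>2)"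
  using integrable_\<nu>2[of s] integrable_\<nu>[of s] by (simp add: power2_diff)

lemma delayed_error_measurable [measurable]: "delayed_error t \<in> borel_measurable borel"
  unfolding delayed_error_def \<nu>_def by measurable

lemma delayed_error_nonneg: "0 \<le> delayed_error t r"
  unfolding delayed_error_def by (intro integral_nonneg_AE) auto

lemma delayed_error_late:
  assumes "t < r"
  shows "delayed_error t r = (t / \<mu>)\<^sup>2"
proof -
  have "delayed_error t r = expectation (\<lambda>\<omega>. (t / \<mu>)\<^sup>2)"
    unfolding delayed_error_def
  proof (intro integral_cong_AE, measurable, use AE_regular in eventually_elim)
    case (elim \<omega>)
    then have "0 \<le> S 0 \<omega>"
      by (simp add: S_def)
    then have "\<nu> (t - r) \<omega> = 0"
      using regular_less_\<nu>[OF elim, of 0 "t - r"] assms by (simp add: S_def)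
    then show ?case
      by simp
  qed
  then show ?thesis
    by (simp add: prob_space)
qed

text \<open>A delay \<open>r\<close> moves the centre by \<open>r / \<mu>\<close>: the deviation is
  that of an undelayed count over \<open>t - r\<close>, minus \<open>r / \<mu>\<close>. The exact
  expansion serves the limit for fixed \<open>r\<close>, the inequality serves the majorant.\<close>

lemma delayed_error_early:
  assumes "r \<le> t"
  shows "delayed_error t r = passage_error (t - r) - 2 * (r / \<mu>) * (expectation (overshoot (t - r)) / \<mu>) + (r / \<mu>)\<^sup>2"
    and "delayed_error t r \<le> 2 * passage_error (t - r) + 2 * (r / \<mu>)\<^sup>2"
proof -
  define s where "s = t - r"
  let ?d = "\<lambda>\<omega>. real (\<nu> s \<omega>) - s / \<mu>"
  have s: "0 \<le> s"
    using assms by (simp add: s_def)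
  have d: "integrable M ?d" "integrable M (\<lambda>\<omega>. (?d \<omega>)\<^sup>2)"
    using integrable_\<nu> integrable_\<nu>_diff2 by auto
  have Ed: "expectation ?d = expectation (overshoot s) / \<mu>"
    using mean_passages[OF s] integrable_\<nu>[of s] \<mu>_pos by (simp add: prob_space U_def[symmetric] field_simps)
  have eq: "real (\<nu> s \<omega>) - t / \<mu> = ?d \<omega> - r / \<mu>" for \<omega>
    by (simp add: s_def diff_divide_distrib)
  have "delayed_error t r = expectation (\<lambda>\<omega>. (?d \<omega>)\<^sup>2 - 2 * (r / \<mu>) * ?d \<omega> + (r / \<mu>)\<^sup>2)"
    unfolding delayed_error_def s_def[symmetric] eq by (intro Bochner_Integration.integral_cong) (auto simp: power2_diff)
  also have "\<dots> = passage_error s - 2 * (r / \<mu>) * expectation ?d + (r / \<mu>)\<^sup>2"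
    unfolding passage_error_def using d by (simp add: prob_space)
  finally show "delayed_error t r = passage_error (t - r) - 2 * (r / \<mu>) * (expectation (overshoot (t - r)) / \<mu>) + (r / \<mu>)\<^sup>2"
    unfolding Ed unfolding s_def .
  have "delayed_error t r \<le> expectation (\<lambda>\<omega>. 2 * (?d \<omega>)\<^sup>2 + 2 * (r / \<mu>)\<^sup>2)"
    unfolding delayed_error_def s_def[symmetric]
  proof (rule integral_mono)
    have "(x - y)\<^sup>2 \<le> 2 * x\<^sup>2 + 2 * y\<^sup>2" for x y :: real
      using sum_squares_bound[of "- x" y] by (simp add: power2_diff)
    then show "(real (\<nu> s \<omega>) - t / \<mu>)\<^sup>2 \<le> 2 * (?d \<omega>)\<^sup>2 + 2 * (r / \<mu>)\<^sup>2" for \<omega>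
      unfolding eq .
  qed (use d integrable_\<nu>_diff2 in auto)
  also have "\<dots> = 2 * passage_error s + 2 * (r / \<mu>)\<^sup>2"
    unfolding passage_error_def using d by (simp add: prob_space)
  finally show "delayed_error t r \<le> 2 * passage_error (t - r) + 2 * (r / \<mu>)\<^sup>2"
    by (simp add: s_def)
qed

text \<open>For fixed \<open>r\<close> the correction consists of a bounded square and a cross term
  proportional to the mean overshoot, both o(t).\<close>

lemma delayed_error_asymp: "((\<lambda>t. delayed_error t r / t) \<longlongrightarrow> \<sigma>2 / \<mu> ^ 3) at_top"
proof -
  have shift: "filterlim (\<lambda>t::real. t - r) at_top at_top"
  proof -
    have "filterlim (\<lambda>t::real. - r + t) at_top at_top"
      by (intro filterlim_tendsto_add_at_top[OF tendsto_const] filterlim_ident)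
    then show ?thesis
      by simp
  qed
  have inv: "((\<lambda>t::real. c / t) \<longlongrightarrow> 0) at_top" for c
    by (intro tendsto_divide_0[OF tendsto_const] filterlim_at_top_imp_at_infinity filterlim_ident)
  have "((\<lambda>t. passage_error (t - r) / (t - r) * (1 - r / t) - 2 * (r / \<mu>\<^sup>2) * (expectation (overshoot (t - r)) / (t - r) * (1 - r / t)) + (r / \<mu>)\<^sup>2 / t)
      \<longlongrightarrow> \<sigma>2 / \<mu> ^ 3 * (1 - 0) - 2 * (r / \<mu>\<^sup>2) * (0 * (1 - 0)) + 0) at_top"
    by (intro tendsto_intros inv filterlim_compose[OF passage_error_asymp shift] filterlim_compose[OF overshoot_asymp shift])
  moreover have "\<forall>\<^sub>F t in at_top. passage_error (t - r) / (t - r) * (1 - r / t) -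
      2 * (r / \<mu>\<^sup>2) * (expectation (overshoot (t - r)) / (t - r) * (1 - r / t)) + (r / \<mu>)\<^sup>2 / t = delayed_error t r / t"
    using eventually_gt_at_top[of "max 0 r"]
  proof eventually_elim
    case (elim t)
    then have "(1 - r / t) = (t - r) / t" "t - r \<noteq> 0"
      by (auto simp: field_simps)
    moreover have "delayed_error t r / t = passage_error (t - r) / t - 2 * (r / \<mu>\<^sup>2) * (expectation (overshoot (t - r)) / t) + (r / \<mu>)\<^sup>2 / t"
      using elim by (simp add: delayed_error_early(1) add_divide_distrib diff_divide_distrib power2_eq_square)
    ultimately show ?case
      by simp
  qed
  ultimately have "((\<lambda>t. delayed_error t r / t) \<longlongrightarrow> \<sigma>2 / \<mu> ^ 3 * (1 - 0) - 2 * (r / \<mu>\<^sup>2) * (0 * (1 - 0)) + 0) at_top"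
    by (rule Lim_transform_eventually)
  then show ?thesis
    by simp
qed

text \<open>Only growth linear in \<open>r\<close> is affordable, the stationary delay having just a
  finite mean at hand. For r \<le> t the quadratic term r^2 / t is at most r. For r > t no renewal
  has occurred, the error is exactly (t / \<mu>)^2, and division by t leaves less than r /
  \<mu>^2.\<close>

lemma delayed_error_bound:
  assumes "0 \<le> C" "\<And>t. 0 \<le> t \<Longrightarrow> passage_error t \<le> C * (1 + t)" "0 \<le> r" "1 \<le> t"
  shows "delayed_error t r / t \<le> 4 * C + 2 * r / \<mu>\<^sup>2"
proof (cases "r \<le> t")
  case True
  have "delayed_error t r \<le> 2 * passage_error (t - r) + 2 * (r / \<mu>)\<^sup>2"
    using True by (rule delayed_error_early)
  also have "2 * passage_error (t - r) \<le> 2 * (C * (1 + (t - r)))"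
    using assms True by (intro mult_left_mono) auto
  also have "\<dots> \<le> 4 * C * t"
    using assms mult_left_mono[of "1 + (t - r)" "2 * t" C] by simp
  also have "2 * (r / \<mu>)\<^sup>2 \<le> 2 * r / \<mu>\<^sup>2 * t"
    using assms True \<mu>_pos by (simp add: power_divide power2_eq_square divide_right_mono mult_left_mono)
  finally show ?thesis
    using assms by (simp add: field_simps)
next
  case False
  have "delayed_error t r / t = t / \<mu>\<^sup>2"
    using False assms by (simp add: delayed_error_late power2_eq_square)
  also have "\<dots> \<le> 2 * r / \<mu>\<^sup>2"
    using False assms by (intro divide_right_mono) auto
  finally show ?thesis
    using assms by simp
qed

text \<open>
  Given the first cycle, the count in \<open>(u, u + t]\<close> is that of a fresh renewal process started
  with the remaining delay \<open>R 0 - u\<close>.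
\<close>

lemma mean_square_count:
  "(\<integral>z. (traffic.J 0 t z - 1 / \<mu> * t)\<^sup>2 \<partial>traffic.P) = (\<integral>(\<omega>, u). delayed_error t (R 0 \<omega> - u) \<partial>traffic.P)"
proof -
  have "(\<integral>\<^sup>+z. ennreal ((traffic.J 0 t z - 1 / \<mu> * t)\<^sup>2) \<partial>traffic.P) =
      (\<integral>\<^sup>+\<omega>. \<integral>\<^sup>+u. ennreal ((real (points_in (\<lambda>i. R i \<omega>) u (u + t)) - t / \<mu>)\<^sup>2) * indicator {0..R 0 \<omega>} u \<partial>lborel \<partial>M)
        / ennreal (expectation (R 0))"
    by (subst traffic.nn_integral_P) (simp_all add: packet_count_eq)
  also have "\<dots> = (\<integral>\<^sup>+\<omega>. \<integral>\<^sup>+u. (\<integral>\<^sup>+\<omega>'. ennreal ((real (\<nu> (t - (R 0 \<omega> - u)) \<omega>') - t / \<mu>)\<^sup>2) \<partial>M) * indicator {0..R 0 \<omega>} u \<partial>lborel \<partial>M)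
        / ennreal (expectation (R 0))"
    by (subst nn_integral_first_cycle[where f="\<lambda>n u. ennreal ((real n - t / \<mu>)\<^sup>2)"]) simp_all
  also have "\<dots> = (\<integral>\<^sup>+\<omega>. \<integral>\<^sup>+u. ennreal (delayed_error t (R 0 \<omega> - u)) * indicator {0..R 0 \<omega>} u \<partial>lborel \<partial>M)
        / ennreal (expectation (R 0))"
    unfolding delayed_error_def by (subst nn_integral_eq_integral[OF integrable_\<nu>_diff2]) auto
  also have "\<dots> = (\<integral>\<^sup>+z. ennreal (case z of (\<omega>, u) \<Rightarrow> delayed_error t (R 0 \<omega> - u)) \<partial>traffic.P)"
    by (subst traffic.nn_integral_P) simp_all
  finally have *: "(\<integral>\<^sup>+z. ennreal ((traffic.J 0 t z - 1 / \<mu> * t)\<^sup>2) \<partial>traffic.P) =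
      (\<integral>\<^sup>+z. ennreal (case z of (\<omega>, u) \<Rightarrow> delayed_error t (R 0 \<omega> - u)) \<partial>traffic.P)" .
  have m1: "(\<lambda>z. (traffic.J 0 t z - 1 / \<mu> * t)\<^sup>2) \<in> borel_measurable traffic.P"
    unfolding packet_count_eq by measurable
  have m2: "(\<lambda>(\<omega>, u). delayed_error t (R 0 \<omega> - u)) \<in> borel_measurable traffic.P"
    by measurable
  show ?thesis
    unfolding integral_eq_nn_integral[OF m1 AE_I2[OF zero_le_power2]] *
    by (rule integral_eq_nn_integral[OF m2, symmetric]) (auto simp: delayed_error_nonneg)
qed

definition count_error :: "real \<Rightarrow> real" where "count_error t = (\<integral>z. (traffic.J 0 t z - 1 / \<mu> * t)\<^sup>2 \<partial>traffic.P)"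

lemma count_error_asymp: "((\<lambda>t. count_error t / t) \<longlongrightarrow> \<sigma>2 / \<mu> ^ 3) at_top"
proof -
  interpret P: prob_space traffic.P
    by (rule traffic.prob_space_P)
  let ?r = "\<lambda>z. R 0 (fst z) - snd z"
  obtain C where C: "0 \<le> C" "\<And>t. 0 \<le> t \<Longrightarrow> passage_error t \<le> C * (1 + t)"
    using passage_error_linear_bound by blast
  \<comment> \<open>The delay is at most the gap straddling the origin, whose length-biased mean is
    E R^2 / E R; the second moment of the gaps is what makes it finite.\<close>
  have delay: "integrable traffic.P ?r"
  proof (rule integrableI_bounded)
    show "?r \<in> borel_measurable traffic.P"
      by measurable
    have "(\<integral>\<^sup>+z. ennreal (norm (?r z)) \<partial>traffic.P) \<le>
        (\<integral>\<^sup>+\<omega>. \<integral>\<^sup>+u. ennreal (R 0 \<omega>) * indicator {0..R 0 \<omega>} u \<partial>lborel \<partial>M) / ennreal (expectation (R 0))"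
      by (subst traffic.nn_integral_P)
         (auto intro!: divide_right_mono_ennreal nn_integral_mono ennreal_leI simp: indicator_def)
    also have "\<dots> = (\<integral>\<^sup>+\<omega>. ennreal ((R 0 \<omega>)\<^sup>2) \<partial>M) / ennreal (expectation (R 0))"
      using nonneg
      by (intro arg_cong2[where f="(/)"] nn_integral_cong_AE refl, eventually_elim)
         (simp add: nn_integral_cmult power2_eq_square ennreal_mult)
    also have "\<dots> < \<infinity>"
      using square_integrable mean_pos
      by (simp add: integrable_iff_bounded less_top[symmetric] ennreal_divide_eq_top_iff)
    finally show "(\<integral>\<^sup>+z. ennreal (norm (?r z)) \<partial>traffic.P) < \<infinity>" .
  qed
  have "((\<lambda>t. \<integral>z. delayed_error t (?r z) / t \<partial>traffic.P) \<longlongrightarrow> (\<integral>z. \<sigma>2 / \<mu> ^ 3 \<partial>traffic.P)) at_top"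
  proof (rule integral_dominated_convergence_at_top[where w="\<lambda>z. 4 * C + 2 * ?r z / \<mu>\<^sup>2"])
    show "integrable traffic.P (\<lambda>z. 4 * C + 2 * ?r z / \<mu>\<^sup>2)"
      by (intro Bochner_Integration.integrable_add P.integrable_const integrable_divide integrable_mult_right delay)
    show "AE z in traffic.P. ((\<lambda>t. delayed_error t (?r z) / t) \<longlongrightarrow> \<sigma>2 / \<mu> ^ 3) at_top"
      by (intro AE_I2 delayed_error_asymp)
    show "\<forall>\<^sub>F t in at_top. AE z in traffic.P. norm (delayed_error t (?r z) / t) \<le> 4 * C + 2 * ?r z / \<mu>\<^sup>2"
      using eventually_ge_at_top[of 1]
    proof eventually_elim
      case (elim t)
      show ?case
      proof (rule traffic.AE_P, rule AE_I2, intro allI impI)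
        fix \<omega> u assume "0 \<le> u" "u \<le> R 0 \<omega>"
        then show "norm (delayed_error t (R 0 (fst (\<omega>, u)) - snd (\<omega>, u)) / t) \<le> 4 * C + 2 * (R 0 (fst (\<omega>, u)) - snd (\<omega>, u)) / \<mu>\<^sup>2"
          using delayed_error_bound[OF C, of "R 0 \<omega> - u" t] elim delayed_error_nonneg[of t "R 0 \<omega> - u"] by simp
      qed
    qed
  qed measurable
  then show ?thesis
    unfolding count_error_def mean_square_count by (simp add: P.prob_space case_prod_beta')
qed

text \<open>Windows of length \<Delta> and 2 \<Delta> have errors with the same linear rate, so the
  combination in \<open>traffic.A_dev_J\<close> leaves exactly one copy of \<sigma>^2 /
  \<mu>^3.\<close>

lemma A_discrete_asymp: "((\<lambda>\<Delta>. A_discrete M R \<Delta> * sqrt \<Delta>) \<longlongrightarrow> sqrt (\<sigma>2 / \<mu> ^ 3)) at_top"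
proof -
  have d2: "((\<lambda>\<Delta>. count_error (2 * \<Delta>) / (2 * \<Delta>)) \<longlongrightarrow> \<sigma>2 / \<mu> ^ 3) at_top"
    by (rule filterlim_compose[OF count_error_asymp])
       (rule filterlim_tendsto_pos_mult_at_top[OF tendsto_const _ filterlim_ident], simp)
  have "((\<lambda>\<Delta>. sqrt (2 * (count_error \<Delta> / \<Delta>) - count_error (2 * \<Delta>) / (2 * \<Delta>))) \<longlongrightarrow> sqrt (2 * (\<sigma>2 / \<mu> ^ 3) - \<sigma>2 / \<mu> ^ 3)) at_top"
    by (intro tendsto_intros count_error_asymp d2)
  moreover have "\<forall>\<^sub>F \<Delta> in at_top. sqrt (2 * (count_error \<Delta> / \<Delta>) - count_error (2 * \<Delta>) / (2 * \<Delta>)) = A_discrete M R \<Delta> * sqrt \<Delta>"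
    using eventually_gt_at_top[of 0]
  proof eventually_elim
    case (elim \<Delta>)
    have "A_discrete M R \<Delta> = sqrt (2 * count_error \<Delta> - count_error (2 * \<Delta>) / 2) / \<Delta>"
      unfolding A_discrete_def traffic.A_dev_J(1)[OF elim] traffic.A_dev_J(2)[OF elim, of "1 / \<mu>"] count_error_def ..
    moreover have "sqrt \<Delta> / \<Delta> = inverse (sqrt \<Delta>)"
      using elim by (intro sqrt_divide_self_eq) simp
    ultimately have "A_discrete M R \<Delta> * sqrt \<Delta> = sqrt (2 * count_error \<Delta> - count_error (2 * \<Delta>) / 2) / sqrt \<Delta>"
      by (metis divide_inverse times_divide_eq_left times_divide_eq_right)
    also have "\<dots> = sqrt ((2 * count_error \<Delta> - count_error (2 * \<Delta>) / 2) / \<Delta>)"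
      by (simp add: real_sqrt_divide)
    finally show ?case
      using elim by (simp add: diff_divide_distrib)
  qed
  ultimately have "((\<lambda>\<Delta>. A_discrete M R \<Delta> * sqrt \<Delta>) \<longlongrightarrow> sqrt (2 * (\<sigma>2 / \<mu> ^ 3) - \<sigma>2 / \<mu> ^ 3)) at_top"
    by (rule Lim_transform_eventually)
  then show ?thesis
    by simp
qed

end

text \<open>Nondegeneracy enters twice: it rules out gaps that vanish almost surely, so the mean is
  positive, and it makes the variance, hence the limit constant, nonzero. A positive limit of the
  ratio is what \<Theta> needs.\<close>

lemma A_discrete_order:
  assumes "packet_gaps M R" and nondegenerate: "\<not> (\<exists>c. AE \<omega> in M. R 0 \<omega> = c)"
  shows "A_discrete M R \<in> \<Theta>[at_top](\<lambda>\<Delta>. \<Delta> powr (-1/2))" and "(A_discrete M R \<longlongrightarrow> 0) at_top"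
proof -
  interpret packet_gaps M R by fact
  have [measurable]: "R 0 \<in> borel_measurable M"
    using indep by (simp add: indep_vars_def)
  have int: "integrable M (R 0)"
    by (rule square_integrable_imp_integrable[OF _ square_integrable]) measurable
  have "0 \<le> expectation (R 0)"
    using nonneg by (rule integral_nonneg_AE)
  moreover have "expectation (R 0) \<noteq> 0"
    using nondegenerate integral_nonneg_eq_0_iff_AE[OF int nonneg] by auto
  ultimately interpret renewal_sequence M R
    by unfold_locales (use indep ident nonneg square_integrable in auto)
  have "\<sigma>2 \<noteq> 0"
  proof
    assume "\<sigma>2 = 0"
    moreover have "integrable M (\<lambda>\<omega>. (R 0 \<omega> - \<mu>)\<^sup>2)"
      using int square_integrable by (simp add: power2_diff)
    ultimately have "AE \<omega> in M. (R 0 \<omega> - \<mu>)\<^sup>2 = 0"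
      unfolding \<sigma>2_def by (subst (asm) integral_nonneg_eq_0_iff_AE) auto
    then have "AE \<omega> in M. R 0 \<omega> = \<mu>"
      by eventually_elim simp
    with nondegenerate show False
      by blast
  qed
  then have pos: "sqrt (\<sigma>2 / \<mu> ^ 3) \<noteq> 0"
    using \<mu>_pos by simp
  have "((\<lambda>\<Delta>. A_discrete M R \<Delta> / \<Delta> powr (-1/2)) \<longlongrightarrow> sqrt (\<sigma>2 / \<mu> ^ 3)) at_top"
  proof (rule Lim_transform_eventually[OF A_discrete_asymp])
    show "\<forall>\<^sub>F \<Delta> in at_top. A_discrete M R \<Delta> * sqrt \<Delta> = A_discrete M R \<Delta> / \<Delta> powr (-1/2)"
      using eventually_gt_at_top[of 0]
      by eventually_elim (simp add: powr_minus powr_half_sqrt field_simps)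
  qed
  with pos show "A_discrete M R \<in> \<Theta>[at_top](\<lambda>\<Delta>. \<Delta> powr (-1/2))"
    by (rule bigthetaI_tendsto)
  have "((\<lambda>\<Delta>. A_discrete M R \<Delta> * sqrt \<Delta> / sqrt \<Delta>) \<longlongrightarrow> 0) at_top"
    by (intro tendsto_divide_0[OF A_discrete_asymp] filterlim_at_top_imp_at_infinity sqrt_at_top)
  then show "(A_discrete M R \<longlongrightarrow> 0) at_top"
  proof (rule Lim_transform_eventually)
    show "\<forall>\<^sub>F \<Delta> in at_top. A_discrete M R \<Delta> * sqrt \<Delta> / sqrt \<Delta> = A_discrete M R \<Delta>"
      using eventually_gt_at_top[of 0] by eventually_elim simp
  qed
qed

section \<open>ON/OFF traffic\<close>

definition on_set :: "(nat \<Rightarrow> real) \<Rightarrow> (nat \<Rightarrow> real) \<Rightarrow> real set" where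
  "on_set a b = (\<Union>k. {(\<Sum>i<k. a i + b i) + a k..\<Sum>i<Suc k. a i + b i})"

definition on_time :: "(nat \<Rightarrow> real) \<Rightarrow> (nat \<Rightarrow> real) \<Rightarrow> real \<Rightarrow> real \<Rightarrow> real" where
  "on_time a b s t = measure lborel (on_set a b \<inter> {s..t})"

lemma on_off_process_eq: "on_off_process Off On t \<omega> = indicator (on_set (\<lambda>i. Off i \<omega>) (\<lambda>i. On i \<omega>)) t"
  by (auto simp: on_off_process_def on_set_def indicator_def)

lemma on_set_borel [measurable]: "on_set a b \<in> sets borel"
  unfolding on_set_def by measurable

lemma emeasure_on_set_less_top: "emeasure lborel (on_set a b \<inter> {s..t}) < \<infinity>"
proof -
  have "emeasure lborel (on_set a b \<inter> {s..t}) \<le> emeasure lborel {s..t}"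
    by (intro emeasure_mono) auto
  also have "\<dots> < \<infinity>"
    by (cases "s \<le> t") auto
  finally show ?thesis .
qed

text \<open>The set being measured varies with \<open>z\<close>; as the integral of a jointly
  measurable indicator its measure comes within reach of Tonelli-type measurability.\<close>

lemma on_time_measurable [measurable]:
  assumes [measurable]: "\<And>i. (\<lambda>z. a z i) \<in> borel_measurable N" "\<And>i. (\<lambda>z. b z i) \<in> borel_measurable N"
    "s \<in> borel_measurable N" "t \<in> borel_measurable N"
  shows "(\<lambda>z. on_time (a z) (b z) (s z) (t z)) \<in> borel_measurable N"
proof -
  have eq: "on_time (a z) (b z) (s z) (t z) =
     enn2real (\<integral>\<^sup>+x. (if (\<exists>k. (\<Sum>i<k. a z i + b z i) + a z k \<le> x \<and> x \<le> (\<Sum>i<Suc k. a z i + b z i)) \<and> s z \<le> x \<and> x \<le> t z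
        then 1 else 0) \<partial>lborel)" for z
  proof -
    have "emeasure lborel (on_set (a z) (b z) \<inter> {s z..t z}) = (\<integral>\<^sup>+x. indicator (on_set (a z) (b z) \<inter> {s z..t z}) x \<partial>lborel)"
      by simp
    also have "\<dots> = (\<integral>\<^sup>+x. (if (\<exists>k. (\<Sum>i<k. a z i + b z i) + a z k \<le> x \<and> x \<le> (\<Sum>i<Suc k. a z i + b z i)) \<and> s z \<le> x \<and> x \<le> t z
        then 1 else 0) \<partial>lborel)"
      by (intro nn_integral_cong) (auto simp: on_set_def indicator_def)
    finally show ?thesis
      by (simp add: on_time_def measure_def)
  qed
  show ?thesis
    unfolding eq by measurable
qed

lemma on_time_nonneg: "0 \<le> on_time a b s t"
  by (simp add: on_time_def)

lemma on_time_le: "s \<le> t \<Longrightarrow> on_time a b s t \<le> t - s"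
proof -
  assume "s \<le> t"
  have "on_time a b s t \<le> measure lborel {s..t}"
    unfolding on_time_def using \<open>s \<le> t\<close>
    by (intro measure_mono_fmeasurable) (auto simp: fmeasurable_def)
  then show ?thesis
    using \<open>s \<le> t\<close> by simp
qed

text \<open>Here \<open>c\<close> is a switching time with OFF before and ON after it. Knowing the
  phase in the open window is enough, as the end points are null; this hides the overlaps of the
  closed ON-intervals with their neighbours.\<close>

lemma on_time_AE_cong:
  assumes "\<And>x. s < x \<Longrightarrow> x < t \<Longrightarrow> x \<in> on_set a b \<longleftrightarrow> c \<le> x"
    and "s \<le> t"
  shows "c \<le> s \<Longrightarrow> on_time a b s t = t - s" and "t \<le> c \<Longrightarrow> on_time a b s t = 0"
proof -
  have ae: "AE x in lborel. x \<noteq> s \<and> x \<noteq> t"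
    using AE_lborel_singleton[of s] AE_lborel_singleton[of t] by eventually_elim auto
  show "on_time a b s t = t - s" if "c \<le> s"
  proof -
    have "on_time a b s t = measure lborel {s..t}"
      unfolding on_time_def
      by (rule measure_eq_AE, use ae in eventually_elim) (use assms that in auto)
    then show ?thesis
      using assms by simp
  qed
  show "on_time a b s t = 0" if "t \<le> c"
  proof -
    have "on_time a b s t = measure lborel ({} :: real set)"
      unfolding on_time_def
    proof (rule measure_eq_AE)
      show "AE x in lborel. x \<in> on_set a b \<inter> {s..t} \<longleftrightarrow> x \<in> {}"
        using ae by eventually_elim (use assms that in force)
    qed auto
    then show ?thesis
      by simp
  qed
qed

lemma on_time_add:
  assumes "r \<le> s" "s \<le> t"
  shows "on_time a b r s + on_time a b s t = on_time a b r t"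
proof -
  have fin: "on_set a b \<inter> {s..t} \<in> fmeasurable lborel" "on_set a b \<inter> {r..<s} \<in> fmeasurable lborel"
  proof -
    have "emeasure lborel (on_set a b \<inter> {r..<s}) \<le> emeasure lborel (on_set a b \<inter> {r..s})"
      by (intro emeasure_mono) auto
    then have "emeasure lborel (on_set a b \<inter> {r..<s}) < \<infinity>"
      using emeasure_on_set_less_top by (rule order.strict_trans1)
    then show "on_set a b \<inter> {s..t} \<in> fmeasurable lborel" "on_set a b \<inter> {r..<s} \<in> fmeasurable lborel"
      using emeasure_on_set_less_top[of a b s t] by (auto simp: fmeasurable_def)
  qed
  have "on_set a b \<inter> {r..t} = (on_set a b \<inter> {r..<s}) \<union> (on_set a b \<inter> {s..t})"
    using assms by auto
  then have "on_time a b r t = measure lborel (on_set a b \<inter> {r..<s}) + on_time a b s t"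
    unfolding on_time_def
    by (simp only:, intro measure_Union) (use fin in \<open>auto simp: fmeasurable_def\<close>)
  moreover have "measure lborel (on_set a b \<inter> {r..<s}) = on_time a b r s"
    unfolding on_time_def
    by (rule measure_eq_AE, use AE_lborel_singleton[of s] in eventually_elim) auto
  ultimately show ?thesis
    by simp
qed

text \<open>Translation invariance of Lebesgue measure. The phases of the path and of its shifted
  version need not agree at the junction itself, which ends the first closed ON-interval; therefore
  \<open>mem\<close> asks for \<open>0 < y\<close>, and the point 0 is discarded as null.\<close>

lemma on_time_shift:
  assumes "0 \<le> v"
  shows "on_time a b (a 0 + b 0 + v) (a 0 + b 0 + w) = on_time (\<lambda>i. a (Suc i)) (\<lambda>i. b (Suc i)) v w"
proof -
  let ?c = "a 0 + b 0"
  let ?A = "on_set a b \<inter> {?c + v..?c + w}"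
  have s: "(\<Sum>i<Suc k. a i + b i) = ?c + (\<Sum>i<k. a (Suc i) + b (Suc i))" for k
    by (rule sum.lessThan_Suc_shift)
  have mem: "?c + y \<in> on_set a b \<longleftrightarrow> y \<in> on_set (\<lambda>i. a (Suc i)) (\<lambda>i. b (Suc i))" if "0 < y" for y
  proof
    assume "?c + y \<in> on_set a b"
    then obtain k where k: "(\<Sum>i<k. a i + b i) + a k \<le> ?c + y" "?c + y \<le> (\<Sum>i<Suc k. a i + b i)"
      by (auto simp: on_set_def)
    show "y \<in> on_set (\<lambda>i. a (Suc i)) (\<lambda>i. b (Suc i))"
    proof (cases k)
      case 0
      then show ?thesis
        using k that by simp
    next
      case (Suc j)
      then show ?thesis
        using k unfolding Suc s on_set_def by (intro UN_I[of j]) auto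
    qed
  next
    assume "y \<in> on_set (\<lambda>i. a (Suc i)) (\<lambda>i. b (Suc i))"
    then obtain j where "(\<Sum>i<j. a (Suc i) + b (Suc i)) + a (Suc j) \<le> y" "y \<le> (\<Sum>i<Suc j. a (Suc i) + b (Suc i))"
      by (auto simp: on_set_def)
    then have "(\<Sum>i<Suc j. a i + b i) + a (Suc j) \<le> ?c + y" "?c + y \<le> (\<Sum>i<Suc (Suc j). a i + b i)"
      unfolding s by auto
    then show "?c + y \<in> on_set a b"
      unfolding on_set_def by (intro UN_I[of "Suc j"]) auto
  qed
  have "on_time a b (?c + v) (?c + w) = measure (distr lborel borel ((+) ?c)) ?A"
    by (simp add: on_time_def lborel_distr_plus)
  also have "\<dots> = measure lborel ((+) ?c -` ?A)"
    by (subst measure_distr) auto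
  also have "\<dots> = on_time (\<lambda>i. a (Suc i)) (\<lambda>i. b (Suc i)) v w"
    unfolding on_time_def
  proof (rule measure_eq_AE, use AE_lborel_singleton[of 0] in eventually_elim)
    case (elim y)
    show "y \<in> (+) ?c -` ?A \<longleftrightarrow> y \<in> on_set (\<lambda>i. a (Suc i)) (\<lambda>i. b (Suc i)) \<inter> {v..w}"
    proof (cases "v \<le> y")
      case True
      then show ?thesis
        using mem[of y] elim assms by auto
    qed auto
  next
    show "(+) ?c -` ?A \<in> sets lborel"
      using measurable_sets[of "(+) ?c" borel borel ?A] by simp
  qed measurable
  finally show ?thesis .
qed

lemma on_set_first_cycle:
  assumes pos: "\<And>i. 0 < a i" "\<And>i. 0 < b i" and y: "y < a 0 + b 0"
  shows "y \<in> on_set a b \<longleftrightarrow> a 0 \<le> y"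
proof
  assume "y \<in> on_set a b"
  then obtain k where k: "(\<Sum>i<k. a i + b i) + a k \<le> y"
    by (auto simp: on_set_def)
  show "a 0 \<le> y"
  proof (cases k)
    case (Suc j)
    have "(\<Sum>i<k. a i + b i) = a 0 + b 0 + (\<Sum>i<j. a (Suc i) + b (Suc i))"
      unfolding Suc by (rule sum.lessThan_Suc_shift)
    moreover have "0 \<le> (\<Sum>i<j. a (Suc i) + b (Suc i))"
      using pos by (intro sum_nonneg add_nonneg_nonneg less_imp_le)
    ultimately show ?thesis
      using k y pos(1)[of k] by linarith
  qed (use k in simp)
next
  assume "a 0 \<le> y"
  then show "y \<in> on_set a b"
    using y unfolding on_set_def by (intro UN_I[of 0]) auto
qed

lemma on_time_first_cycle:
  assumes pos: "\<And>i. 0 < a i" "\<And>i. 0 < b i" and "s \<le> t"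
  shows "t \<le> a 0 \<Longrightarrow> on_time a b s t = 0"
    and "a 0 \<le> s \<Longrightarrow> t \<le> a 0 + b 0 \<Longrightarrow> on_time a b s t = t - s"
proof -
  show "on_time a b s t = 0" if "t \<le> a 0"
  proof (rule on_time_AE_cong(2)[where c="a 0"])
    show "x \<in> on_set a b \<longleftrightarrow> a 0 \<le> x" if "s < x" "x < t" for x
      using that \<open>t \<le> a 0\<close> pos(2)[of 0] by (intro on_set_first_cycle pos) simp
  qed fact+
  show "on_time a b s t = t - s" if "a 0 \<le> s" "t \<le> a 0 + b 0"
  proof (rule on_time_AE_cong(1)[where c="a 0"])
    show "x \<in> on_set a b \<longleftrightarrow> a 0 \<le> x" if "s < x" "x < t" for x
      using that \<open>t \<le> a 0 + b 0\<close> by (intro on_set_first_cycle pos) simp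
  qed fact+
qed

lemma on_time_cycles:
  assumes "\<And>i. 0 < a i" "\<And>i. 0 < b i"
  shows "on_time a b 0 (\<Sum>i<n. a i + b i) = (\<Sum>i<n. b i)"
  using assms
proof (induction n arbitrary: a b)
  case 0
  then show ?case
    using on_time_le[of 0 0 a b] on_time_nonneg[of a b 0 0] by simp
next
  case (Suc n)
  let ?a = "\<lambda>i. a (Suc i)" and ?b = "\<lambda>i. b (Suc i)"
  let ?T = "\<Sum>i<n. ?a i + ?b i"
  have pos: "0 < a 0" "0 < b 0" "0 \<le> ?T"
    by (intro Suc.prems sum_nonneg add_nonneg_nonneg less_imp_le)+
  have "on_time a b 0 (a 0 + b 0 + ?T) =
      (on_time a b 0 (a 0) + on_time a b (a 0) (a 0 + b 0)) + on_time a b (a 0 + b 0) (a 0 + b 0 + ?T)"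
    using pos by (simp add: on_time_add)
  also have "on_time a b 0 (a 0) = 0"
    using pos by (intro on_time_first_cycle Suc.prems) auto
  also have "on_time a b (a 0) (a 0 + b 0) = a 0 + b 0 - a 0"
    using pos by (intro on_time_first_cycle Suc.prems) auto
  also have "on_time a b (a 0 + b 0) (a 0 + b 0 + ?T) = on_time ?a ?b 0 ?T"
    using on_time_shift[of 0 a b ?T] by simp
  also have "\<dots> = (\<Sum>i<n. ?b i)"
    using Suc.prems by (intro Suc.IH)
  finally show ?case
    unfolding sum.lessThan_Suc_shift by simp
qed

text \<open>The ON-time is 1-Lipschitz in the end of the window, and at the end of a cycle it is
  exactly the sum of the ON-durations. The index \<open>n\<close> is arbitrary and may be chosen
  independently of the path.\<close>

lemma on_time_approx:
  assumes "\<And>i. 0 < a i" "\<And>i. 0 < b i" "0 \<le> t"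
  shows "\<bar>on_time a b 0 t - (\<Sum>i<n. b i)\<bar> \<le> \<bar>t - (\<Sum>i<n. a i + b i)\<bar>"
proof -
  let ?T = "\<Sum>i<n. a i + b i"
  have T: "0 \<le> ?T"
    using assms by (intro sum_nonneg add_nonneg_nonneg less_imp_le)
  show ?thesis
    unfolding on_time_cycles[of a b n, OF assms(1,2), symmetric]
  proof (cases "t \<le> ?T")
    case True
    then show "\<bar>on_time a b 0 t - on_time a b 0 ?T\<bar> \<le> \<bar>t - ?T\<bar>"
      using on_time_add[of 0 t ?T a b] on_time_le[of t ?T a b] on_time_nonneg[of a b t ?T] assms by linarith
  next
    case False
    then show "\<bar>on_time a b 0 t - on_time a b 0 ?T\<bar> \<le> \<bar>t - ?T\<bar>"
      using on_time_add[of 0 ?T t a b] on_time_le[of ?T t a b] on_time_nonneg[of a b ?T t] T by linarith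
  qed
qed

section \<open>The ON/OFF source as regenerative traffic\<close>

context on_off_durations
begin

sublocale On: iid_sequence M On
  by unfold_locales (use indep_On ident_On in auto)

sublocale Off: iid_sequence M Off
  by unfold_locales (use indep_Off ident_Off in auto)

lemma AE_pos: "AE \<omega> in M. \<forall>i. 0 < Off i \<omega> \<and> 0 < On i \<omega>"
  unfolding AE_all_countable
proof
  fix i
  have "AE \<omega> in M. 0 < Off i \<omega>"
    by (rule Off.AE_ident[OF pos_Off]) simp
  moreover have "AE \<omega> in M. 0 < On i \<omega>"
    by (rule On.AE_ident[OF pos_On]) simp
  ultimately show "AE \<omega> in M. 0 < Off i \<omega> \<and> 0 < On i \<omega>"
    by eventually_elim simp
qed

text \<open>The tail is eventually below (C + 1) n^(-p), which is summable because p > 1.\<close>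

lemma integrable_On: "integrable M (On 0)"
proof (rule integrable_of_summable_tail)
  show "AE \<omega> in M. 0 \<le> On 0 \<omega>"
    using pos_On by eventually_elim simp
  show "summable (\<lambda>n. prob {\<omega> \<in> space M. real n < On 0 \<omega>})"
  proof (rule summable_comparison_test_ev)
    have "\<forall>\<^sub>F t in at_top. t powr p * prob {\<omega> \<in> space M. t < On 0 \<omega>} < C + 1"
      using tail_On by (rule order_tendstoD(2)) simp
    then have "\<forall>\<^sub>F n in sequentially. real n powr p * prob {\<omega> \<in> space M. real n < On 0 \<omega>} < C + 1"
      by (rule eventually_compose_filterlim) (rule filterlim_real_sequentially)
    then show "\<forall>\<^sub>F n in sequentially. norm (prob {\<omega> \<in> space M. real n < On 0 \<omega>}) \<le> (C + 1) * real n powr (- p)"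
      using eventually_gt_at_top[of 0]
      by eventually_elim (simp add: powr_minus field_simps)
    show "summable (\<lambda>n. (C + 1) * real n powr (- p))"
      using p by (intro summable_mult) (simp add: summable_real_powr_iff)
  qed
qed simp

text \<open>Far out the tail is positive because its normalised limit \<open>C\<close> is, and tails
  decrease, so it is positive at every level.\<close>

lemma prob_On_gt_pos: "0 < prob {\<omega> \<in> space M. t < On 0 \<omega>}"
proof (rule ccontr)
  assume "\<not> ?thesis"
  then have z: "prob {\<omega> \<in> space M. t < On 0 \<omega>} = 0"
    by (simp add: not_less measure_le_0_iff)
  have "\<forall>\<^sub>F s in at_top. 0 < s powr p * prob {\<omega> \<in> space M. s < On 0 \<omega>} \<and> t \<le> s"
    using C by (intro eventually_conj order_tendstoD(1)[OF tail_On] eventually_ge_at_top)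
  then obtain s where s: "0 < s powr p * prob {\<omega> \<in> space M. s < On 0 \<omega>}" "t \<le> s"
    by (auto simp: eventually_at_top_linorder)
  have "prob {\<omega> \<in> space M. s < On 0 \<omega>} \<le> prob {\<omega> \<in> space M. t < On 0 \<omega>}"
    using s by (intro finite_measure_mono) auto
  then have "prob {\<omega> \<in> space M. s < On 0 \<omega>} = 0"
    using z by (simp add: measure_le_0_iff)
  with s show False
    by simp
qed

lemma integrable_Off: "integrable M (Off 0)"
  by (rule square_integrable_imp_integrable[OF _ square_integrable_Off]) simp

definition X :: "'a \<Rightarrow> real" where "X \<omega> = Off 0 \<omega> + On 0 \<omega>"
definition m :: real where "m = expectation X"
definition W :: "real \<Rightarrow> real \<Rightarrow> 'a \<Rightarrow> real" where
  "W s t \<omega> = on_time (\<lambda>i. Off i \<omega>) (\<lambda>i. On i \<omega>) s t"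

lemma X_borel [measurable]: "X \<in> borel_measurable M"
  unfolding X_def by measurable

lemma integrable_X: "integrable M X"
  unfolding X_def using integrable_On integrable_Off by simp

lemma AE_X_nonneg: "AE \<omega> in M. 0 \<le> X \<omega>"
  using AE_pos by eventually_elim (simp add: X_def add_nonneg_nonneg less_imp_le)

lemma m_pos: "0 < m"
proof -
  have "m \<noteq> 0"
  proof
    assume "m = 0"
    then have "AE \<omega> in M. X \<omega> = 0"
      unfolding m_def using integral_nonneg_eq_0_iff_AE[OF integrable_X AE_X_nonneg] by simp
    then have "AE \<omega> in M. False"
      using AE_pos by eventually_elim (metis X_def add_pos_pos less_irrefl)
    then show False
      by simp
  qed
  moreover have "0 \<le> m"
    unfolding m_def using AE_X_nonneg by (rule integral_nonneg_AE)
  ultimately show ?thesis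
    by simp
qed

lemma W_borel [measurable]: "W s t \<in> borel_measurable M"
  unfolding W_def by measurable

lemma nn_integral_joint:
  assumes [measurable]: "(\<lambda>(x, y). h x y) \<in> borel_measurable ((\<Pi>\<^sub>M i\<in>UNIV. borel) \<Otimes>\<^sub>M (\<Pi>\<^sub>M i\<in>UNIV. borel))"
  shows "(\<integral>\<^sup>+\<omega>. h (\<lambda>i. On i \<omega>) (\<lambda>i. Off i \<omega>) \<partial>M) =
    (\<integral>\<^sup>+\<omega>. \<integral>\<^sup>+\<omega>'. h (\<lambda>i. On i \<omega>) (\<lambda>i. Off i \<omega>') \<partial>M \<partial>M)"
proof -
  let ?B = "\<Pi>\<^sub>M i\<in>(UNIV :: nat set). (borel :: real measure)"
  let ?On = "distr M ?B (\<lambda>\<omega> i. On i \<omega>)" and ?Off = "distr M ?B (\<lambda>\<omega> i. Off i \<omega>)"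
  interpret Off: prob_space ?Off
    by (rule prob_space_distr) measurable
  have law: "?On \<Otimes>\<^sub>M ?Off = distr M (?B \<Otimes>\<^sub>M ?B) (\<lambda>\<omega>. (\<lambda>i. On i \<omega>, \<lambda>i. Off i \<omega>))"
    using indep_On_Off unfolding indep_var_distribution_eq by simp
  have "(\<integral>\<^sup>+\<omega>. h (\<lambda>i. On i \<omega>) (\<lambda>i. Off i \<omega>) \<partial>M) =
      (\<integral>\<^sup>+z. (\<lambda>(x, y). h x y) z \<partial>distr M (?B \<Otimes>\<^sub>M ?B) (\<lambda>\<omega>. (\<lambda>i. On i \<omega>, \<lambda>i. Off i \<omega>)))"
    by (subst nn_integral_distr) auto
  also have "\<dots> = (\<integral>\<^sup>+x. \<integral>\<^sup>+y. h x y \<partial>?Off \<partial>?On)"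
    unfolding law[symmetric] by (subst Off.nn_integral_fst[symmetric]) auto
  also have "\<dots> = (\<integral>\<^sup>+\<omega>. \<integral>\<^sup>+y. h (\<lambda>i. On i \<omega>) y \<partial>?Off \<partial>M)"
    by (subst nn_integral_distr) auto
  also have "\<dots> = (\<integral>\<^sup>+\<omega>. \<integral>\<^sup>+\<omega>'. h (\<lambda>i. On i \<omega>) (\<lambda>i. Off i \<omega>') \<partial>M \<partial>M)"
    by (intro nn_integral_cong, subst nn_integral_distr) auto
  finally show ?thesis .
qed

text \<open>Independence places the two sequences on separate copies of the space, where each can be
  shifted while the other is held fixed; then they are put together again.\<close>

lemma nn_integral_joint_shift:
  assumes h [measurable]: "(\<lambda>(x, y). h x y) \<in> borel_measurable ((\<Pi>\<^sub>M i\<in>UNIV. borel) \<Otimes>\<^sub>M (\<Pi>\<^sub>M i\<in>UNIV. borel))"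
  shows "(\<integral>\<^sup>+\<omega>. h (\<lambda>i. On (Suc i) \<omega>) (\<lambda>i. Off (Suc i) \<omega>) \<partial>M) = (\<integral>\<^sup>+\<omega>. h (\<lambda>i. On i \<omega>) (\<lambda>i. Off i \<omega>) \<partial>M)"
proof -
  let ?B = "\<Pi>\<^sub>M i\<in>(UNIV :: nat set). (borel :: real measure)"
  have sh [measurable]: "(\<lambda>x i. x (Suc i)) \<in> measurable ?B ?B"
    by (rule measurable_PiM_single') (auto simp: space_PiM)
  have h' [measurable]: "(\<lambda>z. h (f z) (k z)) \<in> borel_measurable N"
    if [measurable]: "f \<in> measurable N ?B" "k \<in> measurable N ?B" for f k and N :: "'c measure"
  proof -
    have "(\<lambda>z. (\<lambda>(x, y). h x y) (f z, k z)) \<in> borel_measurable N"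
      by measurable
    then show ?thesis by simp
  qed
  have m2: "(\<lambda>(x, y). h (\<lambda>i. x (Suc i)) (\<lambda>i. y (Suc i))) \<in> borel_measurable (?B \<Otimes>\<^sub>M ?B)"
    unfolding case_prod_beta'
    by (rule h'; rule measurable_compose[OF _ sh]) measurable
  have "(\<integral>\<^sup>+\<omega>. h (\<lambda>i. On (Suc i) \<omega>) (\<lambda>i. Off (Suc i) \<omega>) \<partial>M) =
      (\<integral>\<^sup>+\<omega>. \<integral>\<^sup>+\<omega>'. h (\<lambda>i. On (Suc i) \<omega>) (\<lambda>i. Off (Suc i) \<omega>') \<partial>M \<partial>M)"
    using nn_integral_joint[OF m2] .
  also have "\<dots> = (\<integral>\<^sup>+\<omega>. \<integral>\<^sup>+\<omega>'. h (\<lambda>i. On (Suc i) \<omega>) (\<lambda>i. Off i \<omega>') \<partial>M \<partial>M)"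
    by (intro nn_integral_cong Off.nn_integral_shift) (auto simp: space_PiM)
  also have "\<dots> = (\<integral>\<^sup>+\<omega>. \<integral>\<^sup>+\<omega>'. h (\<lambda>i. On i \<omega>) (\<lambda>i. Off i \<omega>') \<partial>M \<partial>M)"
    by (rule On.nn_integral_shift) measurable
  also have "\<dots> = (\<integral>\<^sup>+\<omega>. h (\<lambda>i. On i \<omega>) (\<lambda>i. Off i \<omega>) \<partial>M)"
    by (rule nn_integral_joint[symmetric]) measurable
  finally show ?thesis .
qed

lemma W_nonneg: "0 \<le> W s t \<omega>" and W_le: "s \<le> t \<Longrightarrow> W s t \<omega> \<le> t - s"
  and W_add: "r \<le> s \<Longrightarrow> s \<le> t \<Longrightarrow> W r s \<omega> + W s t \<omega> = W r t \<omega>"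
  by (simp_all add: W_def on_time_nonneg on_time_le on_time_add)

sublocale traffic: regenerative_traffic M X W
proof
  show "AE \<omega> in M. 0 \<le> X \<omega>" "integrable M X" "0 < expectation X"
    using AE_X_nonneg integrable_X m_pos by (auto simp: m_def)
  show "(\<lambda>(\<omega>, v). W v (v + d) \<omega>) \<in> borel_measurable (M \<Otimes>\<^sub>M borel)" for d
    unfolding W_def by measurable
  show "AE \<omega> in M. \<forall>a b c. 0 \<le> a \<longrightarrow> a \<le> b \<longrightarrow> b \<le> c \<longrightarrow> W a b \<omega> + W b c \<omega> = W a c \<omega>"
    by (simp add: W_add)
  have sq: "ennreal ((W v (v + d) \<omega>)\<^sup>2) \<le> ennreal (d\<^sup>2)" if "0 \<le> d" for v d \<omega>
    using W_nonneg[of v "v + d" \<omega>] W_le[of v "v + d" \<omega>] that by (intro ennreal_leI power_mono) auto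
  show "(\<integral>\<^sup>+\<omega>. \<integral>\<^sup>+v. ennreal ((W v (v + d) \<omega>)\<^sup>2) * indicator {0..s} v \<partial>lborel \<partial>M) < \<infinity>"
    if "0 \<le> s" "0 \<le> d" for s d
  proof -
    have "(\<integral>\<^sup>+\<omega>. \<integral>\<^sup>+v. ennreal ((W v (v + d) \<omega>)\<^sup>2) * indicator {0..s} v \<partial>lborel \<partial>M) \<le>
        (\<integral>\<^sup>+\<omega>. \<integral>\<^sup>+v. ennreal (d\<^sup>2) * indicator {0..s} v \<partial>lborel \<partial>M)"
      using that by (intro nn_integral_mono mult_right_mono sq) auto
    also have "\<dots> < \<infinity>"
      using that by (simp add: nn_integral_cmult emeasure_space_1 ennreal_mult_less_top)
    finally show ?thesis .
  qed
  show "(\<integral>\<^sup>+\<omega>. \<integral>\<^sup>+v. ennreal ((W v (v + d) \<omega>)\<^sup>2) * indicator {0..X \<omega>} v \<partial>lborel \<partial>M) < \<infinity>"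
    if "0 \<le> d" for d
  proof -
    have "(\<integral>\<^sup>+\<omega>. \<integral>\<^sup>+v. ennreal ((W v (v + d) \<omega>)\<^sup>2) * indicator {0..X \<omega>} v \<partial>lborel \<partial>M) \<le>
        (\<integral>\<^sup>+\<omega>. \<integral>\<^sup>+v. ennreal (d\<^sup>2) * indicator {0..X \<omega>} v \<partial>lborel \<partial>M)"
      using that by (intro nn_integral_mono mult_right_mono sq) auto
    also have "\<dots> = (\<integral>\<^sup>+\<omega>. ennreal (d\<^sup>2) * ennreal (X \<omega>) \<partial>M)"
      by (intro nn_integral_cong_AE, use AE_X_nonneg in eventually_elim) (simp add: nn_integral_cmult)
    also have "\<dots> = ennreal (d\<^sup>2) * ennreal m"
      unfolding m_def using AE_X_nonneg integrable_X by (simp add: nn_integral_cmult nn_integral_eq_integral)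
    also have "\<dots> < \<infinity>"
      by (simp add: ennreal_mult_less_top)
    finally show ?thesis .
  qed
  show "(\<integral>\<^sup>+\<omega>. g (W (X \<omega> + v) (X \<omega> + v + d) \<omega>) \<partial>M) = (\<integral>\<^sup>+\<omega>. g (W v (v + d) \<omega>) \<partial>M)"
    if "0 < v" "0 \<le> d" and [measurable]: "g \<in> borel_measurable borel" for v d and g :: "real \<Rightarrow> ennreal"
  proof -
    have "(\<integral>\<^sup>+\<omega>. g (W (X \<omega> + v) (X \<omega> + v + d) \<omega>) \<partial>M) =
        (\<integral>\<^sup>+\<omega>. g (on_time (\<lambda>i. Off (Suc i) \<omega>) (\<lambda>i. On (Suc i) \<omega>) v (v + d)) \<partial>M)"
      unfolding W_def X_def
      using that on_time_shift[of v "\<lambda>i. Off i _" "\<lambda>i. On i _" "v + d"] by (simp add: add.assoc)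
    also have "\<dots> = (\<integral>\<^sup>+\<omega>. g (W v (v + d) \<omega>) \<partial>M)"
      unfolding W_def
      by (rule nn_integral_joint_shift[where h="\<lambda>x y. g (on_time y x v (v + d))"]) measurable
    finally show ?thesis .
  qed
qed (simp_all add: W_nonneg)

lemma A_on_off_eq: "A_on_off M Off On = A_dev traffic.P traffic.J"
proof -
  have "(LINT x:{s..t}|lborel. on_off_process Off On (u + x) \<omega>) = W (u + s) (u + t) \<omega>" for s t u \<omega>
  proof -
    let ?S = "on_set (\<lambda>i. Off i \<omega>) (\<lambda>i. On i \<omega>)"
    have "W (u + s) (u + t) \<omega> = (\<integral>x. indicator (?S \<inter> {u + s..u + t}) x \<partial>lborel)"
      by (simp add: W_def on_time_def)
    also have "\<dots> = (\<integral>x. indicator (?S \<inter> {u + s..u + t}) (u + x) \<partial>lborel)"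
      using lborel_integral_real_affine[of 1 "indicator (?S \<inter> {u + s..u + t}) :: real \<Rightarrow> real" u] by simp
    also have "\<dots> = (LINT x:{s..t}|lborel. on_off_process Off On (u + x) \<omega>)"
      unfolding set_lebesgue_integral_def on_off_process_eq
      by (intro Bochner_Integration.integral_cong) (auto simp: indicator_def)
    finally show ?thesis ..
  qed
  then show ?thesis
    unfolding A_on_off_def X_def[abs_def, symmetric] by simp
qed

text \<open>The Palm formula as an estimate: \<open>k\<close> bounds what a single cycle contributes
  to the integral, and the mean cycle length is divided out.\<close>

lemma expectation_P_le:
  fixes f :: "'a \<times> real \<Rightarrow> real"
  assumes [measurable]: "f \<in> borel_measurable (M \<Otimes>\<^sub>M borel)" and f: "\<And>z. 0 \<le> f z"
    and k: "integrable M k"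
    and b: "AE \<omega> in M. (\<integral>\<^sup>+u. ennreal (f (\<omega>, u)) * indicator {0..X \<omega>} u \<partial>lborel) \<le> ennreal (k \<omega>) \<and> 0 \<le> k \<omega>"
  shows "(\<integral>z. f z \<partial>traffic.P) \<le> expectation k / m"
proof -
  have k0: "AE \<omega> in M. 0 \<le> k \<omega>"
    using b by eventually_elim simp
  have "(\<integral>\<^sup>+z. ennreal (f z) \<partial>traffic.P) \<le> (\<integral>\<^sup>+\<omega>. ennreal (k \<omega>) \<partial>M) / ennreal (expectation X)"
    using b by (subst traffic.nn_integral_P) (auto intro!: divide_right_mono_ennreal nn_integral_mono_AE)
  also have "\<dots> = ennreal (expectation k / m)"
    using k k0 m_pos by (simp add: nn_integral_eq_integral m_def[symmetric] divide_ennreal integral_nonneg_AE)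
  finally have "(\<integral>\<^sup>+z. ennreal (f z) \<partial>traffic.P) \<le> ennreal (expectation k / m)" .
  then have "enn2real (\<integral>\<^sup>+z. ennreal (f z) \<partial>traffic.P) \<le> expectation k / m"
    using k0 m_pos by (intro enn2real_leI) (auto intro!: divide_nonneg_pos integral_nonneg_AE)
  moreover have "(\<integral>z. f z \<partial>traffic.P) = enn2real (\<integral>\<^sup>+z. ennreal (f z) \<partial>traffic.P)"
    using f by (intro integral_eq_nn_integral) (auto cong: measurable_cong_sets[OF traffic.sets_P refl])
  ultimately show ?thesis
    by simp
qed

section \<open>Short windows and strict positivity\<close>

lemma J_borel: "traffic.J s t \<in> borel_measurable (M \<Otimes>\<^sub>M borel)"
  unfolding W_def by measurable

lemma J_nonneg: "0 \<le> traffic.J s t z" and J_le: "s \<le> t \<Longrightarrow> traffic.J s t z \<le> t - s"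
  using W_nonneg[of "snd z + s" "snd z + t" "fst z"] W_le[of "snd z + s" "snd z + t" "fst z"]
  by (simp_all add: case_prod_beta')

lemma J_diff_le:
  assumes "0 < t"
  shows "\<bar>traffic.J 0 t z - traffic.J t (2 * t) z\<bar> \<le> t"
    and "(traffic.J 0 t z - traffic.J t (2 * t) z)\<^sup>2 \<le> t\<^sup>2"
proof -
  show le: "\<bar>traffic.J 0 t z - traffic.J t (2 * t) z\<bar> \<le> t"
    using J_nonneg[of 0 t z] J_nonneg[of t "2 * t" z] J_le[of 0 t z] J_le[of t "2 * t" z] assms by linarith
  have "0 \<le> t"
    using assms by simp
  from power2_le_iff_abs_le[OF this] le
  show "(traffic.J 0 t z - traffic.J t (2 * t) z)\<^sup>2 \<le> t\<^sup>2"
    by (rule iffD2)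
qed

text \<open>The two windows carry the same traffic unless the phase changes in \<open>[u, u + 2 \<Delta>]\<close>.\<close>

lemma A_on_off_small:
  assumes \<Delta>: "0 < \<Delta>"
  shows "A_on_off M Off On \<Delta> \<le> sqrt (2 * \<Delta> / m)" and "0 \<le> A_on_off M Off On \<Delta>"
proof -
  let ?f = "\<lambda>z. (traffic.J 0 \<Delta> z - traffic.J \<Delta> (2 * \<Delta>) z)\<^sup>2"
  have A: "A_on_off M Off On \<Delta> = sqrt ((\<integral>z. ?f z \<partial>traffic.P) / 2) / \<Delta>"
    unfolding A_on_off_eq by (rule traffic.A_dev_J(1)[OF \<Delta>])
  show "0 \<le> A_on_off M Off On \<Delta>"
    unfolding A using \<Delta> by (intro divide_nonneg_pos real_sqrt_ge_zero integral_nonneg_AE) auto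
  have "(\<integral>z. ?f z \<partial>traffic.P) \<le> expectation (\<lambda>_. 4 * \<Delta> ^ 3) / m"
  proof (rule expectation_P_le)
    show "?f \<in> borel_measurable (M \<Otimes>\<^sub>M borel)"
      by (intro borel_measurable_power borel_measurable_diff J_borel)
    show "AE \<omega> in M. (\<integral>\<^sup>+u. ennreal (?f (\<omega>, u)) * indicator {0..X \<omega>} u \<partial>lborel) \<le> ennreal (4 * \<Delta> ^ 3) \<and> 0 \<le> 4 * \<Delta> ^ 3"
      using AE_pos
    proof eventually_elim
      case (elim \<omega>)
      let ?a = "Off 0 \<omega>"
      \<comment> \<open>The starting points from which a phase change of the first cycle, at
        \<open>Off 0 \<omega>\<close> or at the cycle end, lies within reach of the two windows.
        Total length at most 4 \<Delta> and integrand at most \<Delta>^2 give the cycle bound 4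
        \<Delta>^3, and hence 2 \<Delta> / m after division by 2 \<Delta>^2 m.\<close>
      let ?bad = "{?a - 2 * \<Delta>..?a} \<union> {X \<omega> - 2 * \<Delta>..X \<omega>}"
      have good: "?f (\<omega>, u) = 0" if "0 \<le> u" "u \<le> X \<omega>" "u \<notin> ?bad" for u
      proof (cases "u < ?a - 2 * \<Delta>")
        case True
        then have "W u (u + \<Delta>) \<omega> = 0" "W (u + \<Delta>) (u + 2 * \<Delta>) \<omega> = 0"
          unfolding W_def by (intro on_time_first_cycle(1); use elim \<Delta> in simp)+
        then show ?thesis
          by simp
      next
        case False
        then have "?a < u" "u < X \<omega> - 2 * \<Delta>"
          using that by auto
        then have "W u (u + \<Delta>) \<omega> = u + \<Delta> - u" "W (u + \<Delta>) (u + 2 * \<Delta>) \<omega> = u + 2 * \<Delta> - (u + \<Delta>)"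
          unfolding W_def by (intro on_time_first_cycle(2); use elim \<Delta> in \<open>simp add: X_def\<close>)+
        then show ?thesis
          by simp
      qed
      have le: "?f z \<le> \<Delta>\<^sup>2" for z
        using \<Delta> by (rule J_diff_le)
      have "(\<integral>\<^sup>+u. ennreal (?f (\<omega>, u)) * indicator {0..X \<omega>} u \<partial>lborel) \<le>
          (\<integral>\<^sup>+u. ennreal (\<Delta>\<^sup>2) * indicator ?bad u \<partial>lborel)"
      proof (intro nn_integral_mono)
        fix u
        show "ennreal (?f (\<omega>, u)) * indicator {0..X \<omega>} u \<le> ennreal (\<Delta>\<^sup>2) * indicator ?bad u"
        proof (cases "u \<in> {0..X \<omega>} \<and> u \<notin> ?bad")
          case True
          then have "?f (\<omega>, u) = 0"
            by (intro good) auto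
          then show ?thesis
            by (simp only: ennreal_0 mult_zero_left zero_le)
        next
          case False
          then show ?thesis
            using ennreal_leI[OF le[of "(\<omega>, u)"]] by (auto simp: indicator_def simp del: prod.case)
        qed
      qed
      also have "\<dots> = ennreal (\<Delta>\<^sup>2) * emeasure lborel ?bad"
        by (rule nn_integral_cmult_indicator) measurable
      also have "\<dots> \<le> ennreal (\<Delta>\<^sup>2) * (ennreal (2 * \<Delta>) + ennreal (2 * \<Delta>))"
        using \<Delta> by (intro mult_left_mono order_trans[OF emeasure_subadditive]) auto
      also have "\<dots> = ennreal (4 * \<Delta> ^ 3)"
        using \<Delta> by (simp add: ennreal_mult[symmetric] power2_eq_square power3_eq_cube flip: ennreal_plus)
      finally show ?case
        using \<Delta> by simp
    qed
  qed auto
  then have "(\<integral>z. ?f z \<partial>traffic.P) / 2 \<le> \<Delta>\<^sup>2 * (2 * \<Delta> / m)"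
    by (simp add: prob_space power2_eq_square power3_eq_cube)
  then have "sqrt ((\<integral>z. ?f z \<partial>traffic.P) / 2) \<le> sqrt (\<Delta>\<^sup>2 * (2 * \<Delta> / m))"
    by (rule real_sqrt_le_mono)
  also have "\<dots> = \<Delta> * sqrt (2 * \<Delta> / m)"
    using \<Delta> by (simp only: real_sqrt_mult real_sqrt_abs abs_of_pos)
  finally show "A_on_off M Off On \<Delta> \<le> sqrt (2 * \<Delta> / m)"
    unfolding A using \<Delta> by (simp add: pos_divide_le_eq mult.commute)
qed

lemma A_on_off_at_right_0: "(A_on_off M Off On \<longlongrightarrow> 0) (at_right 0)"
proof (rule tendsto_sandwich)
  show "\<forall>\<^sub>F \<Delta> in at_right 0. 0 \<le> A_on_off M Off On \<Delta>"
    using eventually_at_right_less[of 0] by eventually_elim (rule A_on_off_small)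
  show "\<forall>\<^sub>F \<Delta> in at_right 0. A_on_off M Off On \<Delta> \<le> sqrt (2 * \<Delta> / m)"
    using eventually_at_right_less[of 0] by eventually_elim (rule A_on_off_small)
  have "((\<lambda>\<Delta>. sqrt (2 * \<Delta> / m)) \<longlongrightarrow> sqrt (2 * 0 / m)) (at_right 0)"
    using m_pos by (intro tendsto_intros) auto
  then show "((\<lambda>\<Delta>. sqrt (2 * \<Delta> / m)) \<longlongrightarrow> 0) (at_right 0)"
    by simp
qed simp

text \<open>
  If an ON-period longer than \<open>2 \<Delta>\<close> ends in the second window, then the source is ON throughout
  the first window but not throughout the second.
\<close>

lemma A_on_off_pos:
  assumes \<Delta>: "0 < \<Delta>"
  shows "0 < A_on_off M Off On \<Delta>"
proof (rule ccontr)
  interpret P: prob_space traffic.P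
    by (rule traffic.prob_space_P)
  let ?f = "\<lambda>z. (traffic.J 0 \<Delta> z - traffic.J \<Delta> (2 * \<Delta>) z)\<^sup>2"
  let ?N = "{z \<in> space traffic.P. ?f z \<noteq> 0}"
  have A: "A_on_off M Off On \<Delta> = sqrt ((\<integral>z. ?f z \<partial>traffic.P) / 2) / \<Delta>"
    unfolding A_on_off_eq by (rule traffic.A_dev_J(1)[OF \<Delta>])
  have fm: "?f \<in> borel_measurable traffic.P"
    unfolding measurable_cong_sets[OF traffic.sets_P refl]
    by (intro borel_measurable_power borel_measurable_diff J_borel)
  have le: "?f z \<le> \<Delta>\<^sup>2" for z
    using \<Delta> by (rule J_diff_le)
  have int: "integrable traffic.P ?f"
    by (rule P.integrable_const_bound[where B="\<Delta>\<^sup>2", OF _ fm]) (use le in \<open>auto simp del: prod.case\<close>)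
  assume "\<not> 0 < A_on_off M Off On \<Delta>"
  then have "(\<integral>z. ?f z \<partial>traffic.P) \<le> 0"
    unfolding A using \<Delta> by (simp add: zero_less_divide_iff not_less)
  moreover have "0 \<le> (\<integral>z. ?f z \<partial>traffic.P)"
    by (intro integral_nonneg_AE) auto
  ultimately have "(\<integral>z. ?f z \<partial>traffic.P) = 0"
    by (rule antisym)
  then have "AE z in traffic.P. ?f z = 0"
    by (rule iffD1[OF integral_nonneg_eq_0_iff_AE[OF int AE_I2[OF zero_le_power2]]])
  moreover have N: "?N \<in> sets traffic.P"
    using fm by measurable
  ultimately have "(\<integral>\<^sup>+z. indicator ?N z \<partial>traffic.P) = 0"
    unfolding nn_integral_indicator[OF N] by (simp only: AE_iff_measurable[OF N refl])
  moreover have "(\<integral>\<^sup>+z. indicator ?N z \<partial>traffic.P) =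
      (\<integral>\<^sup>+\<omega>. \<integral>\<^sup>+u. indicator ?N (\<omega>, u) * indicator {0..X \<omega>} u \<partial>lborel \<partial>M) / ennreal (expectation X)"
  proof (rule traffic.nn_integral_P)
    show "indicator ?N \<in> borel_measurable (M \<Otimes>\<^sub>M borel)"
      using N unfolding traffic.sets_P by (rule borel_measurable_indicator)
  qed
  ultimately have z: "(\<integral>\<^sup>+\<omega>. \<integral>\<^sup>+u. indicator ?N (\<omega>, u) * indicator {0..X \<omega>} u \<partial>lborel \<partial>M) = 0"
    by (simp add: ennreal_divide_eq_0_iff)
  let ?L = "{\<omega> \<in> space M. 2 * \<Delta> < On 0 \<omega>}"
  \<comment> \<open>Given a long ON-period, the good starting points fill the open interval from
    \<open>X \<omega> - 2 * \<Delta>\<close> to \<open>X \<omega> - \<Delta>\<close>, of length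
    \<Delta>; the cycle integral is therefore at least \<Delta> on \<open>?L\<close>.\<close>
  have "(\<integral>\<^sup>+\<omega>. ennreal \<Delta> * indicator ?L \<omega> \<partial>M) \<le>
      (\<integral>\<^sup>+\<omega>. \<integral>\<^sup>+u. indicator ?N (\<omega>, u) * indicator {0..X \<omega>} u \<partial>lborel \<partial>M)"
  proof (intro nn_integral_mono_AE, use AE_pos AE_space in eventually_elim)
    case (elim \<omega>)
    show ?case
    proof (cases "\<omega> \<in> ?L")
      case True
      have neq: "?f (\<omega>, u) \<noteq> 0" if u: "X \<omega> - 2 * \<Delta> < u" "u < X \<omega> - \<Delta>" for u
      proof -
        \<comment> \<open>The length of the part of the next OFF-period, from its beginning at
          \<open>X \<omega>\<close>, that fits into the second window. It is positive, so the second
          window misses at least this much traffic, while the first is ON throughout.\<close>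
        let ?e = "min (Off 1 \<omega>) (u + 2 * \<Delta> - X \<omega>)"
        have a: "Off 0 \<omega> < u"
          using u True by (simp add: X_def)
        have e: "0 < ?e"
          using u elim by simp
        have "W u (u + \<Delta>) \<omega> = u + \<Delta> - u"
          unfolding W_def using elim \<Delta> a u by (intro on_time_first_cycle) (auto simp: X_def)
        moreover have "W (X \<omega>) (X \<omega> + ?e) \<omega> = 0"
        proof -
          have "W (X \<omega>) (X \<omega> + ?e) \<omega> = on_time (\<lambda>i. Off (Suc i) \<omega>) (\<lambda>i. On (Suc i) \<omega>) 0 ?e"
            unfolding W_def using on_time_shift[of 0 "\<lambda>i. Off i \<omega>" "\<lambda>i. On i \<omega>" ?e]
            by (simp add: X_def[symmetric])
          also have "\<dots> = 0"
            using elim e by (intro on_time_first_cycle(1)) (simp_all add: less_imp_le)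
          finally show ?thesis .
        qed
        moreover have "W (u + \<Delta>) (X \<omega>) \<omega> + W (X \<omega>) (X \<omega> + ?e) \<omega> + W (X \<omega> + ?e) (u + 2 * \<Delta>) \<omega> = W (u + \<Delta>) (u + 2 * \<Delta>) \<omega>"
          using u e by (simp add: W_add)
        moreover have "W (u + \<Delta>) (X \<omega>) \<omega> \<le> X \<omega> - (u + \<Delta>)" "W (X \<omega> + ?e) (u + 2 * \<Delta>) \<omega> \<le> u + 2 * \<Delta> - (X \<omega> + ?e)"
          using u e by (auto intro!: W_le)
        ultimately have "W (u + \<Delta>) (u + 2 * \<Delta>) \<omega> < W u (u + \<Delta>) \<omega>"
          using e by linarith
        then show ?thesis
          by simp
      qed
      have "ennreal \<Delta> * indicator ?L \<omega> = (\<integral>\<^sup>+u. indicator {X \<omega> - 2 * \<Delta><..<X \<omega> - \<Delta>} u \<partial>lborel)"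
        using True \<Delta> by simp
      also have "\<dots> \<le> (\<integral>\<^sup>+u. indicator ?N (\<omega>, u) * indicator {0..X \<omega>} u \<partial>lborel)"
      proof (intro nn_integral_mono)
        fix u
        have "(\<omega>, u) \<in> space traffic.P"
          using elim sets_eq_imp_space_eq[OF traffic.sets_P] by (simp add: space_pair_measure)
        moreover have "u \<in> {0..X \<omega>}" if "u \<in> {X \<omega> - 2 * \<Delta><..<X \<omega> - \<Delta>}"
          using that True elim \<Delta> by (simp add: X_def) (smt (verit))
        ultimately show "indicator {X \<omega> - 2 * \<Delta><..<X \<omega> - \<Delta>} u \<le>
            (indicator ?N (\<omega>, u) * indicator {0..X \<omega>} u :: ennreal)"
          using neq[of u] by (auto simp: indicator_def simp del: prod.case)
      qed
      finally show ?thesis .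
    qed simp
  qed
  also note z
  finally have "ennreal \<Delta> * emeasure M ?L = 0"
    by (simp add: nn_integral_cmult_indicator)
  then have "prob ?L = 0"
    using \<Delta> by (simp add: emeasure_eq_measure)
  then show False
    using prob_On_gt_pos[of "2 * \<Delta>"] by simp
qed

section \<open>Long-run ON fraction and the law of large numbers in mean\<close>

definition q :: real where "q = expectation (On 0) / m"

lemma q_bounds: "0 \<le> q" "q \<le> 1"
proof -
  have "0 \<le> expectation (On 0)" "0 \<le> expectation (Off 0)"
    by (intro integral_nonneg_AE, use AE_pos in eventually_elim, simp add: less_imp_le)+
  moreover have "m = expectation (Off 0) + expectation (On 0)"
    unfolding m_def X_def using integrable_On integrable_Off by simp
  ultimately show "0 \<le> q" "q \<le> 1"
    using m_pos by (simp_all add: q_def)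
qed

lemma W_minus_le:
  assumes "0 \<le> t"
  shows "\<bar>W s (s + t) \<omega> - q * t\<bar> \<le> t"
proof -
  have "0 \<le> q * t" "q * t \<le> t"
    using mult_right_mono[of q 1 t] q_bounds assms by simp_all
  then show ?thesis
    using W_nonneg[of s "s + t" \<omega>] W_le[of s "s + t" \<omega>] assms by (simp add: abs_le_iff)
qed

text \<open>
  Comparing with the end of the \<open>n\<close>-th cycle for the deterministic \<open>n = \<lfloor>t / m\<rfloor>\<close>
  avoids the counting process: by \<open>on_time_approx\<close> the error is the distance of that end from \<open>t\<close>.
\<close>

lemma mean_on_time:
  assumes \<epsilon>: "0 < \<epsilon>"
  obtains c where "\<And>t. 0 \<le> t \<Longrightarrow> expectation (\<lambda>\<omega>. \<bar>W 0 t \<omega> - q * t\<bar>) \<le> \<epsilon> * t + c"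
proof -
  \<comment> \<open>The fluctuation of the ON-sum is charged twice, for its own mean and inside the
    cycle end, that of the OFF-sum once. Three such shares times n \<le> t / m give \<epsilon> t;
    the rounding to whole cycles costs at most 2 m in total.\<close>
  let ?e = "\<epsilon> * m / 3"
  have e: "0 < ?e"
    using \<epsilon> m_pos by simp
  let ?On = "\<lambda>n \<omega>. \<bar>(\<Sum>i<n. On i \<omega>) - real n * expectation (On 0)\<bar>"
  let ?Off = "\<lambda>n \<omega>. \<bar>(\<Sum>i<n. Off i \<omega>) - real n * expectation (Off 0)\<bar>"
  have nn: "AE \<omega> in M. 0 \<le> On 0 \<omega>" "AE \<omega> in M. 0 \<le> Off 0 \<omega>"
    using AE_pos by (eventually_elim, simp add: less_imp_le)+
  obtain c1 where c1: "\<And>n. expectation (?On n) \<le> ?e * n + c1"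
    using On.weak_law_in_mean[OF integrable_On nn(1) e] by blast
  obtain c2 where c2: "\<And>n. expectation (?Off n) \<le> ?e * n + c2"
    using Off.weak_law_in_mean[OF integrable_Off nn(2) e] by blast
  have int: "integrable M (?On n)" "integrable M (?Off n)" for n
    using On.integrable_ident[of "\<lambda>x. x"] integrable_On Off.integrable_ident[of "\<lambda>x. x"] integrable_Off
    by (intro integrable_abs Bochner_Integration.integrable_diff Bochner_Integration.integrable_sum; simp)+
  have m: "m = expectation (Off 0) + expectation (On 0)"
    unfolding m_def X_def using integrable_On integrable_Off by simp
  show thesis
  proof (rule that)
    fix t :: real assume t: "0 \<le> t"
    define n where "n = nat \<lfloor>t / m\<rfloor>"
    have n: "real n = of_int \<lfloor>t / m\<rfloor>"
      using t m_pos by (simp add: n_def)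
    have n_le: "real n \<le> t / m" and n_gt: "t / m - 1 \<le> real n"
      unfolding n by linarith+
    have n_m: "\<bar>t - n * m\<bar> \<le> m"
    proof -
      have "n * m \<le> t"
        using n_le m_pos by (simp add: field_simps)
      moreover have "t - m \<le> n * m"
        using n_gt m_pos by (simp add: field_simps)
      ultimately show ?thesis
        using m_pos by linarith
    qed
    have "expectation (\<lambda>\<omega>. \<bar>W 0 t \<omega> - q * t\<bar>) \<le> expectation (\<lambda>\<omega>. 2 * ?On n \<omega> + ?Off n \<omega> + 2 * m)"
    proof (rule integral_mono_AE)
      show "integrable M (\<lambda>\<omega>. \<bar>W 0 t \<omega> - q * t\<bar>)"
        by (rule integrable_const_bound[where B=t]) (use W_minus_le[OF t, of 0] in auto)
      show "integrable M (\<lambda>\<omega>. 2 * ?On n \<omega> + ?Off n \<omega> + 2 * m)"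
        using int by simp
      show "AE \<omega> in M. \<bar>W 0 t \<omega> - q * t\<bar> \<le> 2 * ?On n \<omega> + ?Off n \<omega> + 2 * m"
        using AE_pos
      proof eventually_elim
        case (elim \<omega>)
        let ?O = "\<Sum>i<n. On i \<omega>" and ?F = "\<Sum>i<n. Off i \<omega>"
        have "\<bar>W 0 t \<omega> - ?O\<bar> \<le> \<bar>t - (?F + ?O)\<bar>"
          unfolding W_def using on_time_approx[of "\<lambda>i. Off i \<omega>" "\<lambda>i. On i \<omega>" t n] elim t
          by (simp add: sum.distrib)
        moreover have "\<bar>n * expectation (On 0) - q * t\<bar> \<le> m"
        proof -
          have "expectation (On 0) = q * m"
            using m_pos by (simp add: q_def)
          then have "n * expectation (On 0) - q * t = - (q * (t - n * m))"
            by (simp add: algebra_simps)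
          then have "\<bar>n * expectation (On 0) - q * t\<bar> = q * \<bar>t - n * m\<bar>"
            using q_bounds by (simp add: abs_mult)
          also have "\<dots> \<le> 1 * m"
            using q_bounds n_m by (intro mult_mono) auto
          finally show ?thesis
            by simp
        qed
        moreover have "n * m = n * expectation (Off 0) + n * expectation (On 0)"
          unfolding m by (simp add: distrib_left)
        moreover have "\<bar>w - c\<bar> \<le> 2 * \<bar>k - a\<bar> + \<bar>l - b\<bar> + 2 * r"
          if "\<bar>w - k\<bar> \<le> \<bar>s - (l + k)\<bar>" "\<bar>a - c\<bar> \<le> r" "d = b + a" "\<bar>s - d\<bar> \<le> r" for w c k a l b r s d :: real
        proof -
          have "\<bar>s - (l + k)\<bar> \<le> \<bar>s - d\<bar> + \<bar>l - b\<bar> + \<bar>k - a\<bar>"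
            unfolding that(3) by linarith
          moreover have "\<bar>w - c\<bar> \<le> \<bar>w - k\<bar> + \<bar>k - a\<bar> + \<bar>a - c\<bar>"
            by linarith
          ultimately show ?thesis
            using that by (smt (verit))
        qed
        ultimately show ?case
          using n_m by blast
      qed
    qed
    also have "\<dots> = 2 * expectation (?On n) + expectation (?Off n) + 2 * m"
      using int by (simp add: prob_space)
    also have "\<dots> \<le> 2 * (?e * n + c1) + (?e * n + c2) + 2 * m"
      by (intro add_mono mult_left_mono c1 c2 order_refl) simp
    also have "\<dots> = \<epsilon> * m * n + (2 * c1 + c2 + 2 * m)"
      by (simp add: algebra_simps)
    also have "\<epsilon> * m * n \<le> \<epsilon> * m * (t / m)"
      using n_le \<epsilon> m_pos by (intro mult_left_mono) auto
    also have "\<dots> = \<epsilon> * t"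
      using m_pos by simp
    finally show "expectation (\<lambda>\<omega>. \<bar>W 0 t \<omega> - q * t\<bar>) \<le> \<epsilon> * t + (2 * c1 + c2 + 2 * m)"
      by simp
  qed
qed

text \<open>Passing from a window at a cycle start to a stationary one shifts it by \<open>u\<close>
  and weights by the cycle length, whose square is not integrable. Cycles up to \<open>K\<close>
  shift the window by at most \<open>K\<close>, which changes its traffic by at most
  \<open>K\<close>; on longer cycles the deviation is bounded trivially by \<open>t\<close>, and
  their length-biased mass is small.\<close>

lemma mean_J:
  assumes \<epsilon>: "0 < \<epsilon>"
  obtains c where "\<And>t. 0 \<le> t \<Longrightarrow> (\<integral>z. \<bar>traffic.J 0 t z - q * t\<bar> \<partial>traffic.P) \<le> \<epsilon> * t + c"
proof -
  have "\<forall>\<^sub>F K in at_top. expectation (\<lambda>\<omega>. X \<omega> * indicator {K<..} (X \<omega>)) < \<epsilon> * m / 2 \<and> 0 \<le> K"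
    using \<epsilon> m_pos
    by (intro eventually_conj eventually_ge_at_top
        order_tendstoD(2)[OF expectation_tail_tendsto_0[OF integrable_X X_borel]]) auto
  then obtain K where K: "expectation (\<lambda>\<omega>. X \<omega> * indicator {K<..} (X \<omega>)) < \<epsilon> * m / 2" "0 \<le> K"
    by (auto simp: eventually_at_top_linorder)
  \<comment> \<open>Short cycles multiply the error rate by up to \<open>K\<close>, and this choice
    keeps the product below \<open>\<epsilon> * m / 2\<close>. Long cycles use the other half, and
    division by \<open>m\<close> gives \<epsilon>. The added 1 covers \<open>K = 0\<close>.\<close>
  let ?e = "\<epsilon> * m / (2 * (K + 1))"
  have "0 < ?e"
    using \<epsilon> m_pos K by simp
  then obtain c where c: "\<And>t. 0 \<le> t \<Longrightarrow> expectation (\<lambda>\<omega>. \<bar>W 0 t \<omega> - q * t\<bar>) \<le> ?e * t + c"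
    using mean_on_time by blast
  have iX: "integrable M (\<lambda>\<omega>. X \<omega> * indicator {K<..} (X \<omega>))"
    by (rule Bochner_Integration.integrable_bound[OF integrable_X]) (auto simp: indicator_def)
  show thesis
  proof (rule that)
    fix t :: real assume t: "0 \<le> t"
    let ?Z = "\<lambda>\<omega>. \<bar>W 0 t \<omega> - q * t\<bar>"
    let ?k = "\<lambda>\<omega>. K * (K + ?Z \<omega>) + t * (X \<omega> * indicator {K<..} (X \<omega>))"
    have iZ: "integrable M ?Z"
      by (rule integrable_const_bound[where B=t]) (use W_minus_le[OF t, of 0] in auto)
    have ik: "integrable M ?k"
      using iZ iX by simp
    have "(\<integral>z. \<bar>traffic.J 0 t z - q * t\<bar> \<partial>traffic.P) \<le> expectation ?k / m"
    proof (rule expectation_P_le[OF _ _ ik])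
      show "(\<lambda>z. \<bar>traffic.J 0 t z - q * t\<bar>) \<in> borel_measurable (M \<Otimes>\<^sub>M borel)"
        by (intro borel_measurable_abs borel_measurable_diff J_borel) simp
      show "AE \<omega> in M. (\<integral>\<^sup>+u. ennreal \<bar>traffic.J 0 t (\<omega>, u) - q * t\<bar> * indicator {0..X \<omega>} u \<partial>lborel) \<le> ennreal (?k \<omega>) \<and> 0 \<le> ?k \<omega>"
        using AE_X_nonneg
      proof eventually_elim
        case (elim \<omega>)
        have bound: "\<bar>traffic.J 0 t (\<omega>, u) - q * t\<bar> \<le> b"
          if u: "u \<in> {0..X \<omega>}" and b: "b = (if X \<omega> \<le> K then K + ?Z \<omega> else t)" for u b
        proof (cases "X \<omega> \<le> K")
          case True
          \<comment> \<open>The window from 0 to \<open>u + t\<close> is cut at \<open>u\<close> and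
            at \<open>t\<close>: the two windows of length \<open>t\<close> differ by the two end
            pieces of length \<open>u\<close>, each carrying between 0 and \<open>u\<close>.\<close>
          have "W 0 u \<omega> + W u (u + t) \<omega> = W 0 t \<omega> + W t (t + u) \<omega>"
            using W_add[of 0 u "u + t" \<omega>] W_add[of 0 t "t + u" \<omega>] u t by (simp add: add.commute)
          moreover have "0 \<le> W 0 u \<omega>" "W 0 u \<omega> \<le> u" "0 \<le> W t (t + u) \<omega>" "W t (t + u) \<omega> \<le> u"
            using W_nonneg W_le[of 0 u \<omega>] W_le[of t "t + u" \<omega>] u by auto
          ultimately have "\<bar>W u (u + t) \<omega> - W 0 t \<omega>\<bar> \<le> u"
            by linarith
          then have "\<bar>W u (u + t) \<omega> - q * t\<bar> \<le> u + ?Z \<omega>"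
            by linarith
          then show ?thesis
            using True u b by simp
        next
          case False
          then show ?thesis
            using b W_minus_le[OF t, of u \<omega>] by simp
        qed
        let ?b = "if X \<omega> \<le> K then K + ?Z \<omega> else t"
        have b0: "0 \<le> ?b"
          using K t by simp
        have "(\<integral>\<^sup>+u. ennreal \<bar>traffic.J 0 t (\<omega>, u) - q * t\<bar> * indicator {0..X \<omega>} u \<partial>lborel) \<le>
            (\<integral>\<^sup>+u. ennreal ?b * indicator {0..X \<omega>} u \<partial>lborel)"
        proof (intro nn_integral_mono)
          fix u
          show "ennreal \<bar>traffic.J 0 t (\<omega>, u) - q * t\<bar> * indicator {0..X \<omega>} u \<le> ennreal ?b * indicator {0..X \<omega>} u"
          proof (cases "u \<in> {0..X \<omega>}")
            case True
            then show ?thesis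
              using ennreal_leI[OF bound[OF True refl]] by (simp only: indicator_simps mult_1_right)
          qed simp
        qed
        also have "\<dots> = ennreal ?b * ennreal (X \<omega>)"
          using elim by (subst nn_integral_cmult_indicator) auto
        also have "\<dots> = ennreal (?b * X \<omega>)"
          using b0 elim by (simp only: ennreal_mult)
        also have "\<dots> \<le> ennreal (?k \<omega>)"
        proof (rule ennreal_leI, cases "X \<omega> \<le> K")
          case True
          then have "(K + ?Z \<omega>) * X \<omega> \<le> (K + ?Z \<omega>) * K"
            using K by (intro mult_left_mono) auto
          then show "?b * X \<omega> \<le> ?k \<omega>"
            using True by (simp add: mult.commute)
        next
          case False
          have "0 \<le> K * (K + ?Z \<omega>)"
            using K by simp
          then show "?b * X \<omega> \<le> ?k \<omega>"
            using False by simp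
        qed
        finally show ?case
          using K t elim by simp
      qed
    qed simp
    also have "expectation ?k = K * (K + expectation ?Z) + t * expectation (\<lambda>\<omega>. X \<omega> * indicator {K<..} (X \<omega>))"
      using iZ iX by (simp add: prob_space)
    also have "\<dots> \<le> K * (K + (?e * t + c)) + t * (\<epsilon> * m / 2)"
      using K t c[OF t] by (intro add_mono mult_left_mono) auto
    also have "\<dots> \<le> (\<epsilon> * m / 2) * t + K * (K + c) + t * (\<epsilon> * m / 2)"
    proof -
      have "K * ?e = \<epsilon> * m / 2 * (K / (K + 1))"
        using K by simp
      also have "\<dots> \<le> \<epsilon> * m / 2 * 1"
        using K \<epsilon> m_pos by (intro mult_left_mono) auto
      finally have le: "K * ?e * t \<le> \<epsilon> * m / 2 * t"
        using t by (intro mult_right_mono) auto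
      have expand: "K * (K + (e * t + c)) = K * e * t + K * (K + c)" for e
        by (simp add: algebra_simps)
      show ?thesis
        unfolding expand by (intro add_mono order_refl le)
    qed
    also have "(\<epsilon> * m / 2 * t + K * (K + c) + t * (\<epsilon> * m / 2)) / m = \<epsilon> * t + K * (K + c) / m"
      using m_pos by (simp add: field_simps)
    finally show "(\<integral>z. \<bar>traffic.J 0 t z - q * t\<bar> \<partial>traffic.P) \<le> \<epsilon> * t + K * (K + c) / m"
      using m_pos by (simp add: divide_right_mono)
  qed
qed

text \<open>One factor |I_1 - I_2| is at most \<open>t\<close>, so first absolute moments control
  the square. The other is split as 2 (I_1 - q t) - (I_1 + I_2 - 2 q t), so that only windows
  starting at the origin occur.\<close>

lemma A_on_off_square_le:
  assumes t: "0 < t"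
  shows "(A_on_off M Off On t)\<^sup>2 \<le>
    (2 * (\<integral>z. \<bar>traffic.J 0 t z - q * t\<bar> \<partial>traffic.P) + (\<integral>z. \<bar>traffic.J 0 (2 * t) z - q * (2 * t)\<bar> \<partial>traffic.P)) / (2 * t)"
proof -
  interpret P: prob_space traffic.P
    by (rule traffic.prob_space_P)
  let ?f = "\<lambda>z. (traffic.J 0 t z - traffic.J t (2 * t) z)\<^sup>2"
  let ?g = "\<lambda>s z. \<bar>traffic.J 0 s z - q * s\<bar>"
  let ?G = "\<lambda>s. \<integral>z. ?g s z \<partial>traffic.P"
  have J_P: "traffic.J a b \<in> borel_measurable traffic.P" for a b
    unfolding measurable_cong_sets[OF traffic.sets_P refl] by (rule J_borel)
  have ig: "integrable traffic.P (?g s)" if "0 \<le> s" for s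
  proof (rule P.integrable_const_bound[where B=s])
    show "AE z in traffic.P. norm (?g s z) \<le> s"
      using W_minus_le[OF that] by (auto split: prod.split)
    show "?g s \<in> borel_measurable traffic.P"
      by (intro borel_measurable_abs borel_measurable_diff J_P) simp
  qed
  have le: "\<bar>traffic.J 0 t z - traffic.J t (2 * t) z\<bar> \<le> t" for z
    using t by (rule J_diff_le)
  have f_le: "?f z \<le> t * (2 * ?g t z + ?g (2 * t) z)" for z
  proof -
    have add: "traffic.J 0 t z + traffic.J t (2 * t) z = traffic.J 0 (2 * t) z"
      using t by (simp add: W_add case_prod_beta')
    have triangle: "\<bar>x - y\<bar> \<le> 2 * \<bar>x - c\<bar> + \<bar>w - 2 * c\<bar>" if "x + y = w" for x y w c :: real
      using that by (smt (verit))
    have "\<bar>traffic.J 0 t z - traffic.J t (2 * t) z\<bar> \<le> 2 * ?g t z + ?g (2 * t) z"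
      unfolding mult.left_commute[of q 2] by (rule triangle[OF add])
    then have "\<bar>traffic.J 0 t z - traffic.J t (2 * t) z\<bar> * \<bar>traffic.J 0 t z - traffic.J t (2 * t) z\<bar> \<le>
        t * (2 * ?g t z + ?g (2 * t) z)"
      using le[of z] t by (intro mult_mono) auto
    then show ?thesis
      by (simp only: power2_eq_square abs_mult_self_eq)
  qed
  have "(\<integral>z. ?f z \<partial>traffic.P) \<le> (\<integral>z. t * (2 * ?g t z + ?g (2 * t) z) \<partial>traffic.P)"
  proof (rule integral_mono)
    show "integrable traffic.P ?f"
    proof (rule P.integrable_const_bound[where B="t\<^sup>2"])
      show "?f \<in> borel_measurable traffic.P"
        by (intro borel_measurable_power borel_measurable_diff J_P)
      have "?f z \<le> t\<^sup>2" for z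
        using t by (rule J_diff_le)
      then show "AE z in traffic.P. norm (?f z) \<le> t\<^sup>2"
        by (simp del: prod.case)
    qed
    show "integrable traffic.P (\<lambda>z. t * (2 * ?g t z + ?g (2 * t) z))"
      using t by (intro integrable_mult_right Bochner_Integration.integrable_add ig) auto
  qed (rule f_le)
  also have "\<dots> = t * (2 * ?G t + ?G (2 * t))"
    using ig[of t] ig[of "2 * t"] t by (subst integral_mult_right_zero, subst Bochner_Integration.integral_add) auto
  finally have le': "(\<integral>z. ?f z \<partial>traffic.P) \<le> t * (2 * ?G t + ?G (2 * t))" .
  have "0 \<le> (\<integral>z. ?f z \<partial>traffic.P)"
    by (intro integral_nonneg_AE) auto
  then have "(A_on_off M Off On t)\<^sup>2 = (\<integral>z. ?f z \<partial>traffic.P) / 2 / t\<^sup>2"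
    unfolding A_on_off_eq traffic.A_dev_J(1)[OF t] by (simp only: power_divide) (subst real_sqrt_pow2; simp)
  also have "\<dots> \<le> t * (2 * ?G t + ?G (2 * t)) / 2 / t\<^sup>2"
    using le' t by (intro divide_right_mono) auto
  also have "\<dots> = (2 * ?G t + ?G (2 * t)) / (2 * t)"
    using t by (simp only: power2_eq_square) (simp add: divide_simps)
  finally show ?thesis .
qed

lemma A_on_off_at_top: "(A_on_off M Off On \<longlongrightarrow> 0) at_top"
proof (rule order_tendstoI)
  fix a :: real assume "a < 0"
  show "\<forall>\<^sub>F t in at_top. a < A_on_off M Off On t"
    using eventually_gt_at_top[of 0]
    by eventually_elim (use A_on_off_pos \<open>a < 0\<close> in \<open>auto intro: less_trans\<close>)
next
  fix a :: real assume a: "0 < a"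
  then have "0 < a\<^sup>2 / 4" by simp
  \<comment> \<open>With this rate the bound on the squared deviation is a^2 / 2 + 3 c / (2 t),
    leaving the other half of a^2 for the term that vanishes.\<close>
  then obtain c where c: "\<And>t. 0 \<le> t \<Longrightarrow> (\<integral>z. \<bar>traffic.J 0 t z - q * t\<bar> \<partial>traffic.P) \<le> a\<^sup>2 / 4 * t + c"
    using mean_J by blast
  have "((\<lambda>t::real. 3 * c / 2 / t) \<longlongrightarrow> 0) at_top"
    by (intro tendsto_divide_0[OF tendsto_const] filterlim_at_top_imp_at_infinity filterlim_ident)
  then have "\<forall>\<^sub>F t in at_top. 3 * c / 2 / t < a\<^sup>2 / 2"
    using a by (intro order_tendstoD(2)) auto
  then show "\<forall>\<^sub>F t in at_top. A_on_off M Off On t < a"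
    using eventually_gt_at_top[of 0]
  proof eventually_elim
    case (elim t)
    have "(A_on_off M Off On t)\<^sup>2 \<le> (2 * (a\<^sup>2 / 4 * t + c) + (a\<^sup>2 / 4 * (2 * t) + c)) / (2 * t)"
      using elim c[of t] c[of "2 * t"]
      by (intro order_trans[OF A_on_off_square_le] divide_right_mono add_mono mult_left_mono) auto
    also have "\<dots> = a\<^sup>2 / 2 + 3 * c / 2 / t"
      using elim by (simp add: field_simps)
    also have "\<dots> < a\<^sup>2"
      using elim by simp
    finally have "(A_on_off M Off On t)\<^sup>2 < a\<^sup>2" .
    then show ?case
      by (rule power2_less_imp_less) (use a in simp)
  qed
qed

end

theorem theorem4:
  fixes M :: "'a measure" and R :: "nat \<Rightarrow> 'a \<Rightarrow> real"
    and N :: "'b measure" and Off On :: "nat \<Rightarrow> 'b \<Rightarrow> real" and p C :: real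
  assumes discrete: "packet_gaps M R"
    and nondegenerate: "\<not> (\<exists>c. AE \<omega> in M. R 0 \<omega> = c)"
    and continuous: "on_off_durations N Off On p C"
  shows "(A_discrete M R \<in> \<Theta>[at_top](\<lambda>\<Delta>. \<Delta> powr (-1/2)) \<and>
          (A_discrete M R \<longlongrightarrow> 0) at_top) \<and>
         ((A_on_off N Off On \<longlongrightarrow> 0) (at_right 0) \<and>
          (A_on_off N Off On \<longlongrightarrow> 0) at_top \<and>
          (\<exists>K>0. A_on_off N Off On (prob_space.expectation N (\<lambda>\<omega>. On 0 \<omega> + Off 0 \<omega>) / 2) \<ge> K))"
proof -
  interpret on_off_durations N Off On p C
    by (rule continuous)
  have "expectation (\<lambda>\<omega>. On 0 \<omega> + Off 0 \<omega>) = m"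
    by (simp add: m_def X_def[abs_def] add.commute)
  \<comment> \<open>This positive value itself serves as the constant \<open>K\<close>.\<close>
  then have "0 < A_on_off N Off On (expectation (\<lambda>\<omega>. On 0 \<omega> + Off 0 \<omega>) / 2)"
    using m_pos by (intro A_on_off_pos) simp
  then show ?thesis
    using A_discrete_order[OF discrete nondegenerate] A_on_off_at_right_0 A_on_off_at_top by blast
qed

end
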